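(* Let $c,\delta\in\mathbb{R}$ and consider the linear drift model $Y_n=X_n+cn$. Assume $\mu^+<\infty$, $c>0$ and $x_+-x_->\delta-c$. Then, as $n\to\infty$: (a) $N_{n,\delta}/n\to p_\delta$ almost surely, and $\mathbb{E}[N_{n,\delta}/n]\to p_\delta$. (b) If, additionally, $\int_0^\infty x^2f(x)\,dx<\infty$, then $$\sqrt{n}\left(\frac{N_{n,\delta}}{n}-p_\delta\right)\to N(0,\sigma_\delta^2)\quad\text{in distribution},$$ where $$\sigma_\delta^2=p_\delta-p_\delta^2+2\sum_{m=1}^{\infty}\left(\mathbb{E}[1_{i,\delta}^*1_{i+m,\delta}^*]-p_\delta^2\right)$$ (the expectations $\mathbb{E}[1_{i,\delta}^*1_{i+m,\delta}^*]$ do not depend on $i\in\mathbb{Z}$).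
   Context: Linear drift model: $Y_n=X_n+cn$, $n\ge1$, where $c\in\mathbb{R}$ and $(X_n)_{n\ge1}$ are iid real random variables with absolutely continuous cdf $F$ and pdf $f$. It is assumed that there are $-\infty\le x_-<x_+\le\infty$ such that $f(x)>0$ for all $x\in(x_-,x_+)$ and $f(x)=0$ otherwise; so $x_-=\inf\{x:F(x)>0\}$ and $x_+=\sup\{x:F(x)<1\}$ ($x_+-x_-=\infty$ if either endpoint is infinite). Put $\mu^+=\int_0^\infty xf(x)\,dx\in[0,\infty]$. For $\delta\in\mathbb{R}$, $Y_1$ is by convention a $\delta$-record, and for $j\ge2$, $Y_j$ is a $\delta$-record if $Y_j>\max\{Y_1,\dots,Y_{j-1}\}+\delta$. Let $1_{j,\delta}$ be the indicator of the event that $Y_j$ is a $\delta$-record, $N_{n,\delta}=\sum_{j=1}^n1_{j,\delta}$, and $$p_\delta=\lim_{n\to\infty}\mathbb{E}[1_{n,\delta}]=\int_{-\infty}^\infty\prod_{i=1}^{\infty}F(x+ci-\delta)f(x)\,dx.$$ Bilateral model: let $(X_n)_{n\in\mathbb{Z}}$ be iid with cdf $F$, $Y_n=X_n+cn$ for $n\in\mathbb{Z}$, $M_n^*=\sup\{Y_i:i\le n\}$, and let $1_{n,\delta}^*$ be the indicator of the event $\{Y_n>M_{n-1}^*+\delta\}$, $n\in\mathbb{Z}$. $N(0,\sigma^2)$ is the Gaussian law with mean $0$ and variance $\sigma^2$, understood as the point mass at $0$ if $\sigma^2=0$. *)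

theory Defs
  imports "HOL-Probability.Probability"
begin

definition iid_with_density ::
    "'a measure \<Rightarrow> ('i \<Rightarrow> 'a \<Rightarrow> real) \<Rightarrow> 'i set \<Rightarrow> (real \<Rightarrow> real) \<Rightarrow> bool" where
  "iid_with_density M X I f \<longleftrightarrow>
     prob_space M \<and>
     prob_space.indep_vars M (\<lambda>_. borel) X I \<and>
     (\<forall>i\<in>I. distributed M lborel (X i) (\<lambda>x. ennreal (f x)))"

definition cdf_of_density :: "(real \<Rightarrow> real) \<Rightarrow> real \<Rightarrow> real" where
  "cdf_of_density f = cdf (density lborel (\<lambda>x. ennreal (f x)))"

definition mu_plus :: "(real \<Rightarrow> real) \<Rightarrow> ennreal" where
  "mu_plus f = (\<integral>\<^sup>+x\<in>{0..}. ennreal (x * f x) \<partial>lborel)"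

definition second_moment_plus :: "(real \<Rightarrow> real) \<Rightarrow> ennreal" where
  "second_moment_plus f = (\<integral>\<^sup>+x\<in>{0..}. ennreal (x\<^sup>2 * f x) \<partial>lborel)"

definition drift :: "real \<Rightarrow> (nat \<Rightarrow> 'a \<Rightarrow> real) \<Rightarrow> nat \<Rightarrow> 'a \<Rightarrow> real" where
  "drift c X n \<omega> = X n \<omega> + c * real n"

text \<open>Sequences are indexed by \<open>1, 2, \<dots>\<close>; the value at index \<open>0\<close> is never used.\<close>

definition delta_record :: "real \<Rightarrow> (nat \<Rightarrow> real) \<Rightarrow> nat \<Rightarrow> bool" where
  "delta_record \<delta> y j \<longleftrightarrow> j = 1 \<or> (j \<ge> 2 \<and> y j > Max (y ` {1..<j}) + \<delta>)"

definition record_ind ::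
    "real \<Rightarrow> (nat \<Rightarrow> 'a \<Rightarrow> real) \<Rightarrow> real \<Rightarrow> nat \<Rightarrow> 'a \<Rightarrow> real" where
  "record_ind c X \<delta> j \<omega> = of_bool (delta_record \<delta> (\<lambda>n. drift c X n \<omega>) j)"

definition record_count ::
    "real \<Rightarrow> (nat \<Rightarrow> 'a \<Rightarrow> real) \<Rightarrow> real \<Rightarrow> nat \<Rightarrow> 'a \<Rightarrow> real" where
  "record_count c X \<delta> n \<omega> = (\<Sum>j=1..n. record_ind c X \<delta> j \<omega>)"

text \<open>
  The infinite product is the limit of its partial products, which decrease in \<open>[0, 1]\<close>.
  The constant \<open>prodinf\<close> is avoided because it does not count a product of
  nonzero factors tending to \<open>0\<close> as convergent.
\<close>

definition record_prob :: "real \<Rightarrow> (real \<Rightarrow> real) \<Rightarrow> real \<Rightarrow> real" where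
  "record_prob c f \<delta> =
     (\<integral>x. lim (\<lambda>n. \<Prod>i=1..n. cdf_of_density f (x + c * real i - \<delta>)) * f x \<partial>lborel)"

definition bi_drift :: "real \<Rightarrow> (int \<Rightarrow> 'b \<Rightarrow> real) \<Rightarrow> int \<Rightarrow> 'b \<Rightarrow> real" where
  "bi_drift c X n \<omega> = X n \<omega> + c * real_of_int n"

text \<open>The running supremum is over an infinite set and may equal \<open>\<infinity>\<close>, hence \<open>ereal\<close>.\<close>

definition bi_sup :: "real \<Rightarrow> (int \<Rightarrow> 'b \<Rightarrow> real) \<Rightarrow> int \<Rightarrow> 'b \<Rightarrow> ereal" where
  "bi_sup c X n \<omega> = (SUP i\<in>{..n}. ereal (bi_drift c X i \<omega>))"

definition bi_record_ind ::
    "real \<Rightarrow> (int \<Rightarrow> 'b \<Rightarrow> real) \<Rightarrow> real \<Rightarrow> int \<Rightarrow> 'b \<Rightarrow> real" where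
  "bi_record_ind c X \<delta> n \<omega> =
     of_bool (ereal (bi_drift c X n \<omega>) > bi_sup c X (n - 1) \<omega> + ereal \<delta>)"

definition bi_pair_expectation ::
    "'b measure \<Rightarrow> real \<Rightarrow> (int \<Rightarrow> 'b \<Rightarrow> real) \<Rightarrow> real \<Rightarrow> int \<Rightarrow> nat \<Rightarrow> real" where
  "bi_pair_expectation N c X \<delta> i m =
     (\<integral>\<omega>. bi_record_ind c X \<delta> i \<omega> * bi_record_ind c X \<delta> (i + int m) \<omega> \<partial>N)"

text \<open>In the series below, the term with index \<open>m\<close> is the covariance at lag \<open>m + 1\<close>.\<close>

definition asymp_variance ::
    "'b measure \<Rightarrow> real \<Rightarrow> (int \<Rightarrow> 'b \<Rightarrow> real) \<Rightarrow> (real \<Rightarrow> real) \<Rightarrow> real \<Rightarrow> int \<Rightarrow> real" where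
  "asymp_variance N c X f \<delta> i =
     record_prob c f \<delta> - (record_prob c f \<delta>)\<^sup>2
     + 2 * (\<Sum>m. bi_pair_expectation N c X \<delta> i (Suc m) - (record_prob c f \<delta>)\<^sup>2)"

text \<open>Parametrised by the variance; meaningful for \<open>v \<ge> 0\<close>.\<close>

definition centered_gaussian :: "real \<Rightarrow> real measure" where
  "centered_gaussian v =
     (if v = 0 then return borel 0
      else density lborel (\<lambda>x. ennreal (normal_density 0 (sqrt v) x)))"

end

theory Submission
  imports Defs "HOL-Library.Discrete_Functions"
begin

text \<open>
  Let \<open>R a j\<close> indicate that \<open>Y j\<close> beats \<open>Y a, \<dots>, Y (j - 1)\<close> by more than \<open>\<delta>\<close>.
  Its mean \<open>P (j - a)\<close> depends only on the window length, and \<open>P k\<close> decreases to \<open>p\<^sub>\<delta>\<close>.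

  Law of large numbers: \<open>R (j - k) j\<close> is a \<open>k\<close>-dependent sequence with averages tending to
  \<open>P k\<close>. It differs from \<open>R 0 j\<close> only if \<open>X j < - L\<close> or some \<open>X (j - i)\<close> with \<open>i > k\<close> exceeds
  \<open>c i - \<delta> - L\<close>. Counting the latter events by the early observation bounds them by an iid sum
  with mean \<open>E[max 0 ((X + \<delta> + L) / c - k)]\<close>, which is small for large \<open>k\<close> because \<open>\<mu>\<^sup>+\<close> is finite.

  Central limit theorem: a finite second moment makes \<open>P k - p\<^sub>\<delta>\<close> summable, and this dominates
  the covariances, since \<open>R 0 i\<close> is independent of \<open>R (i + 1) j\<close>. Restarting the records at the
  beginning of every block of length \<open>b\<close> gives iid blocks, to which the classical theorem
  applies. The second moment of the error, divided by \<open>n\<close>, vanishes as \<open>n \<rightarrow> \<infinity>\<close> and then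
  \<open>b \<rightarrow> \<infinity>\<close>, so the characteristic functions converge.
\<close>

section \<open>Averages and quadratic expansions\<close>

text \<open>The obstacle is that \<open>R 0 j\<close> depends on the whole past and is not
  stationary. Monotonicity in the starting point tames this: for \<open>a \<le> b \<le> j\<close>,
  \<open>R b j - R a j\<close> is again 0 or 1, with mean \<open>P (j - b) - P (j - a)\<close>, so
  every loss of memory is priced by \<open>P\<close> alone. This bounds the covariance at lag m + 1
  by \<open>P m - p\<close> uniformly in position, and limits pass through the covariance series by
  domination. Summability of \<open>P k - p\<close> amounts, by summation by parts, to that of
  \<open>(k + 1) * (P k - P (k + 1))\<close>. A step of \<open>P\<close> is at most a geometric term
  plus the mass of the law above a height of order k, and such masses weighted by k add up to a
  second moment. For the strong law only a first moment is available, so the iid error sum is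
  bounded merely up to a factor 2; this is enough because its mean is small. Block 0 starts at the
  true origin, so its variance is that of the record count, which identifies the variance of the
  limit. The two-sided model, living on another probability space, is reached through pair
  expectations that depend on the law alone: seen from time i - k on, it is a one-sided
  model.\<close>

lemma cesaro_mean:
  fixes a :: "nat \<Rightarrow> real"
  assumes "a \<longlonglongrightarrow> L"
  shows "(\<lambda>n. (\<Sum>i<n. a i) / real n) \<longlonglongrightarrow> L"
proof (rule LIMSEQ_I)
  fix e :: real assume e: "e > 0"
  obtain n0 where n0: "\<And>n. n \<ge> n0 \<Longrightarrow> \<bar>a n - L\<bar> < e / 2"
    using LIMSEQ_D[OF assms, of "e/2"] e by auto
  define K where "K = (\<Sum>i<n0. \<bar>a i - L\<bar>)"
  have K0: "K \<ge> 0" unfolding K_def by (intro sum_nonneg) auto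
  obtain n1 where n1: "2 * K / e < real n1" using reals_Archimedean2 by blast
  show "\<exists>no. \<forall>n\<ge>no. norm ((\<Sum>i<n. a i) / real n - L) < e"
  proof (intro exI allI impI)
    fix n assume n: "n \<ge> n0 + n1 + 1"
    have npos: "real n > 0" using n by simp
    have "(\<Sum>i<n. a i) / real n - L = (\<Sum>i<n. a i - L) / real n"
      using npos by (simp add: sum_subtractf field_simps)
    also have "\<bar>\<dots>\<bar> \<le> (\<Sum>i<n. \<bar>a i - L\<bar>) / real n"
      using npos by (simp add: divide_right_mono)
    also have "(\<Sum>i<n. \<bar>a i - L\<bar>) = K + (\<Sum>i=n0..<n. \<bar>a i - L\<bar>)"
      unfolding K_def lessThan_atLeast0 using n by (intro sum.atLeastLessThan_concat[symmetric]) auto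
    also have "(\<Sum>i=n0..<n. \<bar>a i - L\<bar>) \<le> (\<Sum>i=n0..<n. e / 2)"
      using n0 by (intro sum_mono) (auto intro: less_imp_le)
    also have "\<dots> \<le> real n * (e / 2)"
      using e by (simp add: mult_right_mono)
    finally have "\<bar>(\<Sum>i<n. a i) / real n - L\<bar> \<le> (K + real n * (e/2)) / real n"
      using npos by (simp add: divide_right_mono)
    also have "\<dots> < e"
    proof -
      have "2 * K < e * real n1" using n1 e by (simp add: field_simps)
      also have "\<dots> \<le> e * real n" using n e by (intro mult_left_mono) auto
      finally show ?thesis using npos by (simp add: field_simps)
    qed
    finally show "norm ((\<Sum>i<n. a i) / real n - L) < e" by simp
  qed
qed

text \<open>Consecutive squares differ by 2 m + 1, which is negligible against the square of m, so
  averages of terms in [0, 1] cannot move much between them. Deviations then have to be controlled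
  along the squares only.\<close>

lemma averages_from_squares:
  fixes x :: "nat \<Rightarrow> real"
  assumes x01: "\<And>j. 0 \<le> x j" "\<And>j. x j \<le> 1"
    and lim: "(\<lambda>m. (\<Sum>j<m\<^sup>2. x j) / (real m)\<^sup>2) \<longlonglongrightarrow> p"
  shows "(\<lambda>n. (\<Sum>j<n. x j) / real n) \<longlonglongrightarrow> p"
proof -
  define r where "r n = floor_sqrt n" for n
  have r_le: "(r n)\<^sup>2 \<le> n" and r_gt: "n < (Suc (r n))\<^sup>2" for n
    unfolding r_def using Suc_floor_sqrt_power2_gt by auto
  have r_top: "filterlim r at_top sequentially"
    unfolding filterlim_at_top
  proof
    fix Z :: nat
    show "\<forall>\<^sub>F n in sequentially. Z \<le> r n"
      using eventually_ge_at_top[of "Z\<^sup>2"] by eventually_elim (simp add: r_def le_floor_sqrtI)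
  qed
  have ratio_bound: "\<bar>(\<Sum>j<n. x j) / real n - (\<Sum>j<(r n)\<^sup>2. x j) / (real (r n))\<^sup>2\<bar> \<le> 4 / real (r n)"
    if "r n \<ge> 1" for n
  proof -
    define s where "s = (\<Sum>j<(r n)\<^sup>2. x j)"
    define R where "R = real (r n)"
    have R1: "R \<ge> 1" using that by (simp add: R_def)
    have n1: "R\<^sup>2 \<le> real n" using r_le[of n] unfolding R_def
      by (metis of_nat_le_iff of_nat_power)
    have n2: "real n \<le> R\<^sup>2 + 2 * R"
    proof -
      have "n + 1 \<le> (Suc (r n))\<^sup>2" using r_gt[of n] by simp
      then have "real (n + 1) \<le> real ((Suc (r n))\<^sup>2)" by (simp only: of_nat_le_iff)
      then show ?thesis by (simp add: R_def power2_eq_square algebra_simps)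
    qed
    have s0: "0 \<le> s" unfolding s_def using x01 by (intro sum_nonneg) auto
    have sR: "s \<le> R\<^sup>2"
      unfolding s_def R_def using sum_bounded_above[of "{..<(r n)\<^sup>2}" x 1] x01 by simp
    have eq: "(\<Sum>j<n. x j) = s + (\<Sum>j=(r n)\<^sup>2..<n. x j)"
      unfolding s_def lessThan_atLeast0 using r_le[of n]
      by (intro sum.atLeastLessThan_concat[symmetric]) auto
    define t where "t = (\<Sum>j=(r n)\<^sup>2..<n. x j)"
    have t0: "0 \<le> t" unfolding t_def using x01 by (intro sum_nonneg) auto
    have "t \<le> real (n - (r n)\<^sup>2)"
      unfolding t_def using sum_bounded_above[of "{(r n)\<^sup>2..<n}" x 1] x01 by simp
    also have "\<dots> = real n - R\<^sup>2" unfolding R_def using r_le[of n] by (simp add: of_nat_diff)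
    finally have tn: "t \<le> 2 * R" using n2 by simp
    have npos: "real n > 0" using n1 R1 by (smt (verit) one_le_power)
    \<comment> \<open>The first summand is the contribution of the indices beyond the last square,
      the second the effect of the changed denominator; each lies in [0, 2 / R].\<close>
    have "(\<Sum>j<n. x j) / real n - s / R\<^sup>2 = t / real n - s * (real n - R\<^sup>2) / (R\<^sup>2 * real n)"
      using npos R1 unfolding eq t_def[symmetric] by (simp add: field_simps)
    moreover have "0 \<le> t / real n" "t / real n \<le> 2 / R"
    proof -
      show "0 \<le> t / real n" using t0 npos by simp
      have "t / real n \<le> 2 * R / R\<^sup>2" using tn t0 n1 R1 npos by (intro frac_le) auto
      then show "t / real n \<le> 2 / R" using R1 by (simp add: power2_eq_square)
    qed
    moreover have "0 \<le> s * (real n - R\<^sup>2) / (R\<^sup>2 * real n)" "s * (real n - R\<^sup>2) / (R\<^sup>2 * real n) \<le> 2 / R"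
    proof -
      show "0 \<le> s * (real n - R\<^sup>2) / (R\<^sup>2 * real n)" using s0 n1 npos by simp
      have "s * (real n - R\<^sup>2) / (R\<^sup>2 * real n) \<le> R\<^sup>2 * (2 * R) / (R\<^sup>2 * R\<^sup>2)"
        using s0 sR n1 n2 R1 npos by (intro frac_le mult_mono) auto
      then show "s * (real n - R\<^sup>2) / (R\<^sup>2 * real n) \<le> 2 / R" using R1 by (simp add: power2_eq_square)
    qed
    moreover have fourR: "4 / R = 2 / R + 2 / R" by simp
    ultimately show ?thesis unfolding s_def[symmetric] R_def[symmetric] unfolding fourR by linarith
  qed
  have l1: "(\<lambda>n. (\<Sum>j<(r n)\<^sup>2. x j) / (real (r n))\<^sup>2) \<longlonglongrightarrow> p"
    using filterlim_compose[OF lim r_top] by simp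
  have l2: "(\<lambda>n. 4 / real (r n)) \<longlonglongrightarrow> 0"
    using filterlim_compose[OF lim_const_over_n[of 4] r_top] by simp
  have "(\<lambda>n. (\<Sum>j<n. x j) / real n - (\<Sum>j<(r n)\<^sup>2. x j) / (real (r n))\<^sup>2) \<longlonglongrightarrow> 0"
  proof (rule tendsto_rabs_zero_cancel, rule tendsto_sandwich[OF _ _ tendsto_const l2])
    show "\<forall>\<^sub>F n in sequentially. \<bar>(\<Sum>j<n. x j) / real n - (\<Sum>j<(r n)\<^sup>2. x j) / (real (r n))\<^sup>2\<bar> \<le> 4 / real (r n)"
      using filterlim_at_top[THEN iffD1, OF r_top, rule_format, of 1]
      by eventually_elim (rule ratio_bound)
  qed auto
  from tendsto_add[OF this l1] show ?thesis by simp
qed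

text \<open>Levels below \<open>w\<close> contribute a geometric sum of \<open>2 ^ m\<close>, levels
  above it one of \<open>w\<^sup>2 / 2 ^ m\<close>. Under the expectation this bounds all truncated
  second moments at dyadic levels by a first moment.\<close>

lemma sum_min_dyadic_le:
  fixes w :: real
  assumes "w \<ge> 0"
  shows "(\<Sum>m<K. (min w (2 ^ m))\<^sup>2 / 2 ^ m) \<le> 4 * w"
proof -
  \<comment> \<open>For \<open>w < 2 ^ K\<close> the strengthened bound reserves
    \<open>2 * w\<^sup>2 / 2 ^ K\<close>, the sum of all remaining terms of the series.\<close>
  have "(\<Sum>m<K. (min w (2 ^ m))\<^sup>2 / 2 ^ m) \<le> (if 2 ^ K \<le> w then 2 ^ K else 4 * w - 2 * w\<^sup>2 / 2 ^ K)"
  proof (induction K)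
    case 0
    have "2 * w\<^sup>2 \<le> 4 * w" if "w < 1"
      using mult_left_mono[of w 1 w] assms that by (simp add: power2_eq_square)
    then show ?case by auto
  next
    case (Suc K)
    define P :: real where "P = 2 ^ K"
    have P: "P > 0" by (simp add: P_def)
    note IH = Suc[folded P_def]
    show ?case
    proof (cases "P \<le> w")
      case True
      then have *: "(\<Sum>m<Suc K. (min w (2 ^ m))\<^sup>2 / 2 ^ m) \<le> P + P"
        using IH P by (simp add: P_def[symmetric] power2_eq_square)
      have "2 * P \<le> 4 * w - 2 * w\<^sup>2 / (2 * P)" if "w < 2 * P"
      proof -
        \<comment> \<open>Here the bound changes regime: \<open>w\<close> lies between the
          consecutive powers \<open>P\<close> and \<open>2 * P\<close>.\<close>
        have "0 \<le> (w - P) * (2 * P - w)" using True that by simp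
        then have "w * w \<le> 3 * (w * P) - 2 * (P * P)" by (simp add: algebra_simps)
        moreover have "0 \<le> w * P" using assms P by simp
        ultimately have "w * w \<le> 4 * (w * P) - 2 * (P * P)" by linarith
        then show ?thesis using P by (simp add: field_simps power2_eq_square)
      qed
      then show ?thesis using * by (auto simp: P_def)
    next
      case False
      then have "(\<Sum>m<Suc K. (min w (2 ^ m))\<^sup>2 / 2 ^ m) \<le> 4 * w - 2 * w\<^sup>2 / P + w\<^sup>2 / P"
        using IH by (simp add: P_def[symmetric] min_def)
      also have "\<dots> = 4 * w - 2 * w\<^sup>2 / (2 * P)" using P by (simp add: field_simps)
      finally have "(\<Sum>m<Suc K. (min w (2 ^ m))\<^sup>2 / 2 ^ m) \<le> 4 * w - 2 * w\<^sup>2 / (2 * P)" .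
      moreover have "\<not> 2 * P \<le> w" using False P by simp
      ultimately show ?thesis by (simp add: P_def)
    qed
  qed
  also have "\<dots> \<le> 4 * w" using assms by auto
  finally show ?thesis .
qed

text \<open>The cross terms are grouped by the earlier index and the lag, because covariance bounds
  will depend on the lag and each row has a limit of its own.\<close>

lemma square_of_sum_split:
  fixes z :: "nat \<Rightarrow> real"
  shows "(\<Sum>i<n. z i)\<^sup>2 = (\<Sum>i<n. (z i)\<^sup>2 + 2 * (\<Sum>m<n - Suc i. z i * z (i + Suc m)))"
proof (induction n)
  case (Suc n)
  have "(\<Sum>i<n. (z i)\<^sup>2 + 2 * (\<Sum>m<Suc n - Suc i. z i * z (i + Suc m)))
      = (\<Sum>i<n. ((z i)\<^sup>2 + 2 * (\<Sum>m<n - Suc i. z i * z (i + Suc m))) + 2 * (z i * z n))"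
  proof (rule sum.cong[OF refl])
    fix i assume "i \<in> {..<n}"
    then have i: "Suc n - Suc i = Suc (n - Suc i)" "i + Suc (n - Suc i) = n" by auto
    show "(z i)\<^sup>2 + 2 * (\<Sum>m<Suc n - Suc i. z i * z (i + Suc m))
        = ((z i)\<^sup>2 + 2 * (\<Sum>m<n - Suc i. z i * z (i + Suc m))) + 2 * (z i * z n)"
      unfolding i(1) using i(2) by (simp del: add_Suc_right)
  qed
  also have "\<dots> = (\<Sum>i<n. z i)\<^sup>2 + 2 * (\<Sum>i<n. z i) * z n"
    by (simp add: sum.distrib Suc sum_distrib_left sum_distrib_right mult.assoc)
  finally show ?case by (simp add: power2_sum)
qed simp

section \<open>Covariances and laws of large numbers\<close>

context prob_space
begin

lemma bounded_integrable:
  fixes f :: "'a \<Rightarrow> real"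
  assumes "random_variable borel f" "\<And>\<omega>. \<bar>f \<omega>\<bar> \<le> K"
  shows "integrable M f"
  using assms by (intro integrable_const_bound[where B=K]) auto

definition covariance :: "('a \<Rightarrow> real) \<Rightarrow> ('a \<Rightarrow> real) \<Rightarrow> real" where
  "covariance A B = expectation (\<lambda>\<omega>. A \<omega> * B \<omega>) - expectation A * expectation B"

lemma bounded_mult_integrable:
  fixes A B :: "'a \<Rightarrow> real"
  assumes "random_variable borel A" "random_variable borel B"
    and "\<And>\<omega>. \<bar>A \<omega>\<bar> \<le> K" "\<And>\<omega>. \<bar>B \<omega>\<bar> \<le> L"
  shows "integrable M (\<lambda>\<omega>. A \<omega> * B \<omega>)"
proof (rule bounded_integrable[where K="K * L"])
  have K: "0 \<le> K" using assms(3) by (metis abs_ge_zero order_trans)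
  show "\<bar>A \<omega> * B \<omega>\<bar> \<le> K * L" for \<omega>
    unfolding abs_mult using assms(3,4) K by (intro mult_mono) auto
qed (use assms in measurable)

lemma expectation_centered_mult:
  assumes "random_variable borel A" "random_variable borel B"
    and "\<And>\<omega>. \<bar>A \<omega>\<bar> \<le> K" "\<And>\<omega>. \<bar>B \<omega>\<bar> \<le> L"
  shows "expectation (\<lambda>\<omega>. (A \<omega> - expectation A) * (B \<omega> - expectation B)) = covariance A B"
proof -
  have i: "integrable M A" "integrable M B" "integrable M (\<lambda>\<omega>. A \<omega> * B \<omega>)"
    using bounded_integrable[OF assms(1,3)] bounded_integrable[OF assms(2,4)]
      bounded_mult_integrable[OF assms] by auto
  have "(\<lambda>\<omega>. (A \<omega> - expectation A) * (B \<omega> - expectation B))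
    = (\<lambda>\<omega>. A \<omega> * B \<omega> - expectation B * A \<omega> - expectation A * B \<omega> + expectation A * expectation B)"
    by (simp add: algebra_simps)
  then show ?thesis using i by (simp add: covariance_def prob_space algebra_simps)
qed

lemma expectation_square_of_sum:
  fixes Z :: "nat \<Rightarrow> 'a \<Rightarrow> real"
  assumes meas: "\<And>i. random_variable borel (Z i)" and bdd: "\<And>i \<omega>. \<bar>Z i \<omega>\<bar> \<le> K i"
  shows "expectation (\<lambda>\<omega>. (\<Sum>i<n. Z i \<omega>)\<^sup>2) =
    (\<Sum>i<n. expectation (\<lambda>\<omega>. (Z i \<omega>)\<^sup>2) + 2 * (\<Sum>m<n - Suc i. expectation (\<lambda>\<omega>. Z i \<omega> * Z (i + Suc m) \<omega>)))"
proof -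
  have i: "integrable M (\<lambda>\<omega>. Z i \<omega> * Z j \<omega>)" for i j
    by (rule bounded_mult_integrable[OF meas meas bdd bdd])
  have i2: "integrable M (\<lambda>\<omega>. (Z i \<omega>)\<^sup>2)" for i
    using i[of i i] by (simp add: power2_eq_square)
  have i3: "integrable M (\<lambda>\<omega>. 2 * (\<Sum>m<k. Z i \<omega> * Z (i + Suc m) \<omega>))" for i k
    using i by (intro integrable_mult_right integrable_sum) auto
  show ?thesis
    unfolding square_of_sum_split
    using i i2 i3 by (simp add: Bochner_Integration.integral_sum Bochner_Integration.integral_add
        Bochner_Integration.integrable_sum del: add_Suc_right)
qed

lemma variance_of_sum:
  fixes B :: "nat \<Rightarrow> 'a \<Rightarrow> real"
  assumes meas: "\<And>i. random_variable borel (B i)" and bdd: "\<And>i \<omega>. \<bar>B i \<omega>\<bar> \<le> K"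
  shows "variance (\<lambda>\<omega>. \<Sum>i<n. B i \<omega>) =
    (\<Sum>i<n. covariance (B i) (B i) + 2 * (\<Sum>m<n - Suc i. covariance (B i) (B (i + Suc m))))"
proof -
  have "(\<Sum>i<n. B i \<omega>) - expectation (\<lambda>\<omega>. \<Sum>i<n. B i \<omega>) = (\<Sum>i<n. B i \<omega> - expectation (B i))" for \<omega>
    using bounded_integrable[OF meas bdd] by (simp add: sum_subtractf)
  then have "variance (\<lambda>\<omega>. \<Sum>i<n. B i \<omega>) = expectation (\<lambda>\<omega>. (\<Sum>i<n. B i \<omega> - expectation (B i))\<^sup>2)"
    by simp
  also have "\<dots> = (\<Sum>i<n. expectation (\<lambda>\<omega>. (B i \<omega> - expectation (B i))\<^sup>2) + 2 * (\<Sum>m<n - Suc i.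
      expectation (\<lambda>\<omega>. (B i \<omega> - expectation (B i)) * (B (i + Suc m) \<omega> - expectation (B (i + Suc m))))))"
  proof (rule expectation_square_of_sum[where K="\<lambda>i. K + \<bar>expectation (B i)\<bar>"])
    show "\<bar>B i \<omega> - expectation (B i)\<bar> \<le> K + \<bar>expectation (B i)\<bar>" for i \<omega>
      using bdd[of i \<omega>] by linarith
  qed (use meas in measurable)
  finally show ?thesis
    unfolding power2_eq_square expectation_centered_mult[OF meas meas bdd bdd] .
qed

text \<open>A covariance of indicators is controlled through \<open>E[A B]\<close> and \<open>E[A] E[B]\<close> lying in \<open>[0, E[B]]\<close>.\<close>

lemma covariance_abs_le:
  assumes "random_variable borel A" "random_variable borel B"
    and "\<And>\<omega>. 0 \<le> A \<omega>" "\<And>\<omega>. A \<omega> \<le> 1" "\<And>\<omega>. 0 \<le> B \<omega>" "\<And>\<omega>. B \<omega> \<le> 1"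
  shows "\<bar>covariance A B\<bar> \<le> expectation A" "\<bar>covariance A B\<bar> \<le> expectation B"
proof -
  have bA: "\<bar>A \<omega>\<bar> \<le> 1" and bB: "\<bar>B \<omega>\<bar> \<le> 1" for \<omega>
    using assms(3)[of \<omega>] assms(4)[of \<omega>] assms(5)[of \<omega>] assms(6)[of \<omega>] by auto
  have i: "integrable M A" "integrable M B" "integrable M (\<lambda>\<omega>. A \<omega> * B \<omega>)"
    using bounded_integrable[OF assms(1) bA] bounded_integrable[OF assms(2) bB]
      bounded_mult_integrable[OF assms(1,2) bA bB] by auto
  have EA: "0 \<le> expectation A" "expectation A \<le> 1" "0 \<le> expectation B" "expectation B \<le> 1"
    using assms i by (auto intro!: integral_nonneg_AE integral_le_const)
  have "0 \<le> expectation (\<lambda>\<omega>. A \<omega> * B \<omega>)"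
    using assms by (intro integral_nonneg_AE) auto
  moreover have "expectation (\<lambda>\<omega>. A \<omega> * B \<omega>) \<le> expectation A"
    using i assms by (intro integral_mono) (auto intro: mult_right_le_one_le)
  moreover have "expectation (\<lambda>\<omega>. A \<omega> * B \<omega>) \<le> expectation B"
    using i assms by (intro integral_mono) (auto intro: mult_left_le_one_le)
  moreover have "0 \<le> expectation A * expectation B" using EA by simp
  moreover have "expectation A * expectation B \<le> expectation A"
    using EA by (intro mult_right_le_one_le) auto
  moreover have "expectation A * expectation B \<le> expectation B"
    using EA by (intro mult_left_le_one_le) auto
  ultimately show "\<bar>covariance A B\<bar> \<le> expectation A" "\<bar>covariance A B\<bar> \<le> expectation B"
    unfolding covariance_def by linarith+
qed

lemma covariance_diff_right:
  assumes "random_variable borel A" "random_variable borel B" "random_variable borel B'"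
    and "\<And>\<omega>. \<bar>A \<omega>\<bar> \<le> K" "\<And>\<omega>. \<bar>B \<omega>\<bar> \<le> K" "\<And>\<omega>. \<bar>B' \<omega>\<bar> \<le> K"
  shows "covariance A (\<lambda>\<omega>. B \<omega> - B' \<omega>) = covariance A B - covariance A B'"
proof -
  have "integrable M B" "integrable M B'" "integrable M (\<lambda>\<omega>. A \<omega> * B \<omega>)" "integrable M (\<lambda>\<omega>. A \<omega> * B' \<omega>)"
    using bounded_integrable[OF assms(2,5)] bounded_integrable[OF assms(3,6)]
      bounded_mult_integrable[OF assms(1,2,4,5)] bounded_mult_integrable[OF assms(1,3,4,6)] by auto
  then show ?thesis by (simp add: covariance_def algebra_simps)
qed

lemma covariance_commute: "covariance A B = covariance B A"
  by (simp add: covariance_def mult.commute)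

lemma indep_vars_expectation_mult:
  fixes B :: "'i \<Rightarrow> 'a \<Rightarrow> real"
  assumes "indep_vars (\<lambda>_. borel) B I" "i \<in> I" "j \<in> I" "i \<noteq> j" "integrable M (B i)" "integrable M (B j)"
  shows "expectation (\<lambda>\<omega>. B i \<omega> * B j \<omega>) = expectation (B i) * expectation (B j)"
proof -
  have "indep_vars (\<lambda>_. borel) B {i, j}" using assms by (intro indep_vars_subset[OF assms(1)]) auto
  from indep_vars_lebesgue_integral[OF _ this] show ?thesis using assms by auto
qed

text \<open>A variance of order n makes the squared deviations of the averages at
  \<open>m\<^sup>2\<close> summable in mean, hence almost surely summable and null. Boundedness of
  the terms fills the gaps between squares.\<close>

lemma AE_averages_tendsto:
  fixes B :: "nat \<Rightarrow> 'a \<Rightarrow> real"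
  assumes meas [measurable]: "\<And>j. random_variable borel (B j)"
    and B01: "\<And>j \<omega>. 0 \<le> B j \<omega>" "\<And>j \<omega>. B j \<omega> \<le> 1"
    and var: "\<And>n. variance (\<lambda>\<omega>. \<Sum>j<n. B j \<omega>) \<le> C * real n"
    and mean: "(\<lambda>n. expectation (\<lambda>\<omega>. \<Sum>j<n. B j \<omega>) / real n) \<longlonglongrightarrow> p"
  shows "AE \<omega> in M. (\<lambda>n. (\<Sum>j<n. B j \<omega>) / real n) \<longlonglongrightarrow> p"
proof -
  define S where "S n \<omega> = (\<Sum>j<n. B j \<omega>)" for n \<omega>
  have [measurable]: "random_variable borel (S n)" for n unfolding S_def by measurable
  have Sb: "\<bar>S n \<omega>\<bar> \<le> real n" for n \<omega>
  proof -
    have "\<bar>S n \<omega>\<bar> \<le> (\<Sum>j<n. \<bar>B j \<omega>\<bar>)" unfolding S_def by (rule sum_abs)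
    also have "\<dots> \<le> (\<Sum>j<n. 1)" using B01 by (intro sum_mono) auto
    finally show ?thesis by simp
  qed
  define g where "g m \<omega> = ((S (m\<^sup>2) \<omega> - expectation (S (m\<^sup>2))) / (real m)\<^sup>2)\<^sup>2" for m \<omega>
  have [measurable]: "random_variable borel (g m)" for m unfolding g_def by measurable
  have g_int: "integrable M (g m)" and g_le: "expectation (g m) \<le> C / (real m)\<^sup>2" for m
  proof -
    have b: "\<bar>S (m\<^sup>2) \<omega> - expectation (S (m\<^sup>2))\<bar> \<le> real (m\<^sup>2) + \<bar>expectation (S (m\<^sup>2))\<bar>" for \<omega>
      using Sb[of "m\<^sup>2" \<omega>] by linarith
    have "integrable M (\<lambda>\<omega>. (S (m\<^sup>2) \<omega> - expectation (S (m\<^sup>2))) * (S (m\<^sup>2) \<omega> - expectation (S (m\<^sup>2))))"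
      by (rule bounded_mult_integrable[OF _ _ b b]) measurable
    then have i: "integrable M (\<lambda>\<omega>. (S (m\<^sup>2) \<omega> - expectation (S (m\<^sup>2)))\<^sup>2)"
      by (simp add: power2_eq_square)
    then show "integrable M (g m)" by (simp add: g_def[abs_def] power_divide)
    have "expectation (g m) = variance (S (m\<^sup>2)) / (real m)^4"
      by (simp add: g_def[abs_def] power_divide)
    also have "\<dots> \<le> C * real (m\<^sup>2) / (real m)^4"
      using var[of "m\<^sup>2"] by (intro divide_right_mono) (auto simp: S_def[abs_def])
    also have "\<dots> = C / (real m)\<^sup>2"
      by (cases "m = 0") (auto simp: field_simps power2_eq_square power4_eq_xxxx)
    finally show "expectation (g m) \<le> C / (real m)\<^sup>2" .
  qed
  have g0: "0 \<le> g m \<omega>" for m \<omega> by (simp add: g_def)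
  have sumC: "summable (\<lambda>m. C / (real m)\<^sup>2)"
    using summable_mult[OF inverse_power_summable[of 2], of C] by (simp add: field_simps)
  have sumE: "summable (\<lambda>m. expectation (g m))"
    by (rule summable_comparison_test'[OF sumC, of 0]) (use g_le g0 in \<open>auto intro: integral_nonneg_AE\<close>)
  have "(\<integral>\<^sup>+\<omega>. (\<Sum>m. ennreal (g m \<omega>)) \<partial>M) = (\<Sum>m. \<integral>\<^sup>+\<omega>. ennreal (g m \<omega>) \<partial>M)"
    by (rule nn_integral_suminf) measurable
  also have "\<dots> = (\<Sum>m. ennreal (expectation (g m)))"
    using g_int g0 by (simp add: nn_integral_eq_integral)
  also have "\<dots> = ennreal (\<Sum>m. expectation (g m))"
    using g0 sumE by (intro suminf_ennreal2) (auto intro: integral_nonneg_AE)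
  finally have "(\<integral>\<^sup>+\<omega>. (\<Sum>m. ennreal (g m \<omega>)) \<partial>M) \<noteq> \<infinity>" by simp
  then have "AE \<omega> in M. (\<Sum>m. ennreal (g m \<omega>)) \<noteq> \<infinity>"
    by (intro nn_integral_PInf_AE) measurable
  then show ?thesis
  proof eventually_elim
    case (elim \<omega>)
    then have "summable (\<lambda>m. g m \<omega>)"
      using g0 by (intro summable_suminf_not_top) (auto simp: infinity_ennreal_def)
    then have "(\<lambda>m. g m \<omega>) \<longlonglongrightarrow> 0" by (rule summable_LIMSEQ_zero)
    then have "(\<lambda>m. sqrt (g m \<omega>)) \<longlonglongrightarrow> 0" using tendsto_real_sqrt by fastforce
    then have d0: "(\<lambda>m. (S (m\<^sup>2) \<omega> - expectation (S (m\<^sup>2))) / (real m)\<^sup>2) \<longlonglongrightarrow> 0"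
      unfolding g_def real_sqrt_abs by (rule tendsto_rabs_zero_cancel)
    have sq: "filterlim (\<lambda>m::nat. m\<^sup>2) at_top sequentially"
    proof (rule filterlim_at_top_mono[OF filterlim_ident])
      show "\<forall>\<^sub>F m in sequentially. m \<le> m\<^sup>2" by (simp add: power2_nat_le_imp_le power2_eq_square)
    qed
    have "(\<lambda>m. expectation (S (m\<^sup>2)) / (real m)\<^sup>2) \<longlonglongrightarrow> p"
      using filterlim_compose[OF mean sq] by (simp add: S_def[abs_def])
    from tendsto_add[OF d0 this] have "(\<lambda>m. S (m\<^sup>2) \<omega> / (real m)\<^sup>2) \<longlonglongrightarrow> p"
      by (simp add: diff_divide_distrib)
    then show ?case using B01 by (intro averages_from_squares) (auto simp: S_def)
  qed
qed

text \<open>On each dyadic range the variables are truncated at the number of summands, Chebyshev's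
  inequality handles the truncated sum, and Borel-Cantelli the exceptional events. The factor 2 is
  the price of passing from n to the next power of two.\<close>

lemma AE_eventually_iid_sum_le:
  fixes W :: "nat \<Rightarrow> 'a \<Rightarrow> real"
  assumes indep: "indep_vars (\<lambda>_. borel) W UNIV"
    and W0: "\<And>i \<omega>. 0 \<le> W i \<omega>"
    and law: "\<And>i. distr M borel (W i) = distr M borel (W 0)"
    and int: "integrable M (W 0)" and \<eta>: "\<eta> > 0"
  shows "AE \<omega> in M. \<forall>\<^sub>F n in sequentially. (\<Sum>s<n. W s \<omega>) \<le> 2 * (expectation (W 0) + \<eta>) * real n"
proof -
  have [measurable]: "random_variable borel (W i)" for i using indep by (simp add: indep_vars_def2)
  define w where "w = expectation (W 0)"
  have w0: "0 \<le> w" unfolding w_def using W0 by (intro integral_nonneg_AE) auto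
  define V where "V m i \<omega> = min (W i \<omega>) (2 ^ m)" for m i \<omega>
  have [measurable]: "random_variable borel (V m i)" for m i unfolding V_def by measurable
  have Vb: "\<bar>V m i \<omega>\<bar> \<le> 2 ^ m" for m i \<omega> using W0[of i \<omega>] by (simp add: V_def)
  have V0: "0 \<le> V m i \<omega>" for m i \<omega> using W0[of i \<omega>] by (simp add: V_def)
  have Vlaw: "expectation (\<lambda>\<omega>. h (W i \<omega>)) = expectation (\<lambda>\<omega>. h (W 0 \<omega>))"
    if [measurable]: "h \<in> borel_measurable borel" for h :: "real \<Rightarrow> real" and i
    using integral_distr[of "W i" M borel h] integral_distr[of "W 0" M borel h] law[of i] by simp
  define q where "q m = expectation (\<lambda>\<omega>. (V m 0 \<omega>)\<^sup>2)" for m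
  have Vq: "expectation (\<lambda>\<omega>. (V m i \<omega>)\<^sup>2) = q m" for m i
    unfolding q_def V_def by (rule Vlaw) measurable
  have Vsq_int: "integrable M (\<lambda>\<omega>. (V m i \<omega>)\<^sup>2)" for m i
    using bounded_mult_integrable[of "V m i" "V m i", OF _ _ Vb Vb] by (simp add: power2_eq_square)
  have q0: "0 \<le> q m" for m unfolding q_def by (intro integral_nonneg_AE) auto
  have EV: "expectation (V m i) \<le> w" for m i
  proof -
    have "expectation (V m i) = expectation (V m 0)" unfolding V_def by (rule Vlaw) measurable
    also have "\<dots> \<le> w" unfolding w_def
      by (intro integral_mono bounded_integrable[OF _ Vb] int) (auto simp: V_def)
    finally show ?thesis .
  qed
  have indepV: "indep_vars (\<lambda>_. borel) (V m) UNIV" for m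
    unfolding V_def[abs_def] by (rule indep_vars_compose2[OF indep]) measurable
  have var: "variance (\<lambda>\<omega>. \<Sum>i<n. V m i \<omega>) \<le> real n * q m" for n m
  proof -
    have "covariance (V m i) (V m (i + Suc k)) = 0" for i k
    proof -
      have "integrable M (V m j)" for j by (rule bounded_integrable[OF _ Vb]) measurable
      then show ?thesis
        unfolding covariance_def
        using indep_vars_expectation_mult[OF indepV, of i "i + Suc k" m] by simp
    qed
    then have "variance (\<lambda>\<omega>. \<Sum>i<n. V m i \<omega>) = (\<Sum>i<n. covariance (V m i) (V m i))"
      using variance_of_sum[of "V m", OF _ Vb] by simp
    also have "\<dots> \<le> (\<Sum>i<n. q m)"
      by (intro sum_mono) (simp add: covariance_def Vq power2_eq_square[symmetric])
    finally show ?thesis by simp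
  qed
  define bad where "bad m = {\<omega> \<in> space M. (\<Sum>i<2^m. W i \<omega>) > 2^m * (w + \<eta>)}" for m :: nat
  have [measurable]: "bad m \<in> sets M" for m unfolding bad_def by measurable
  have bad_le: "prob (bad m) \<le> (1 + 1 / \<eta>\<^sup>2) * (q m / 2^m)" for m
  proof -
    define T where "T \<omega> = (\<Sum>i<2^m. V m i \<omega>)" for \<omega>
    have [measurable]: "random_variable borel T" unfolding T_def by measurable
    have ET: "expectation T \<le> 2^m * w"
    proof -
      have "expectation T = (\<Sum>i<2^m. expectation (V m i))"
        unfolding T_def by (intro Bochner_Integration.integral_sum bounded_integrable[OF _ Vb]) measurable
      also have "\<dots> \<le> (\<Sum>i<(2::nat)^m. w)" by (intro sum_mono EV)
      finally show ?thesis by simp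
    qed
    have Tb: "\<bar>T \<omega>\<bar> \<le> (\<Sum>i<(2::nat)^m. 2^m)" for \<omega>
      unfolding T_def by (rule order_trans[OF sum_abs]) (intro sum_mono Vb)
    have Tsq: "integrable M (\<lambda>\<omega>. T \<omega> ^ 2)"
      using bounded_mult_integrable[OF _ _ Tb Tb] by (simp add: power2_eq_square)
    \<comment> \<open>Either some variable reaches the truncation level, or truncation changes
      nothing and the sum exceeds its mean by at least \<eta> per summand. Both events cost a
      multiple of \<open>q m / 2 ^ m\<close>.\<close>
    have "bad m \<subseteq> (\<Union>i<2^m. {\<omega> \<in> space M. 2^m \<le> \<bar>V m i \<omega>\<bar>})
        \<union> {\<omega> \<in> space M. 2^m * \<eta> \<le> \<bar>T \<omega> - expectation T\<bar>}"
    proof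
      fix \<omega> assume om: "\<omega> \<in> bad m"
      show "\<omega> \<in> (\<Union>i<2^m. {\<omega> \<in> space M. 2^m \<le> \<bar>V m i \<omega>\<bar>})
        \<union> {\<omega> \<in> space M. 2^m * \<eta> \<le> \<bar>T \<omega> - expectation T\<bar>}"
      proof (cases "\<exists>i<2^m. 2^m \<le> W i \<omega>")
        case True
        then obtain i where i: "i < 2^m" "2^m \<le> W i \<omega>" by blast
        then have "2^m \<le> \<bar>V m i \<omega>\<bar>" by (simp add: V_def)
        then show ?thesis using om i(1) by (auto simp: bad_def)
      next
        case False
        then have "T \<omega> = (\<Sum>i<2^m. W i \<omega>)"
          unfolding T_def V_def by (intro sum.cong) (auto simp: not_le)
        then have "T \<omega> > 2^m * w + 2^m * \<eta>" using om by (simp add: bad_def algebra_simps)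
        then show ?thesis using ET om by (auto simp: bad_def)
      qed
    qed
    then have "prob (bad m) \<le> prob (\<Union>i<2^m. {\<omega> \<in> space M. 2^m \<le> \<bar>V m i \<omega>\<bar>})
        + prob {\<omega> \<in> space M. 2^m * \<eta> \<le> \<bar>T \<omega> - expectation T\<bar>}"
      by (intro order_trans[OF finite_measure_mono measure_Un_le]) auto
    also have "prob (\<Union>i<2^m. {\<omega> \<in> space M. 2^m \<le> \<bar>V m i \<omega>\<bar>})
        \<le> (\<Sum>i<2^m. prob {\<omega> \<in> space M. 2^m \<le> \<bar>V m i \<omega>\<bar>})"
      by (rule measure_UNION_le) auto
    also have "\<dots> \<le> (\<Sum>i<(2::nat)^m. q m / (2^m)\<^sup>2)"
    proof (rule sum_mono)
      show "prob {\<omega> \<in> space M. 2^m \<le> \<bar>V m i \<omega>\<bar>} \<le> q m / (2^m)\<^sup>2" for i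
        using second_moment_method[of "V m i" "2^m"] Vsq_int Vq by simp
    qed
    also have "\<dots> = q m / 2^m" by (simp add: power2_eq_square)
    also have "prob {\<omega> \<in> space M. 2^m * \<eta> \<le> \<bar>T \<omega> - expectation T\<bar>} \<le> variance T / (2^m * \<eta>)\<^sup>2"
      using Chebyshev_inequality[of T "2^m * \<eta>"] Tsq \<eta> by simp
    also have "\<dots> \<le> (2^m * q m) / (2^m * \<eta>)\<^sup>2"
      using var[of m "2^m"] by (intro divide_right_mono) (auto simp: T_def[abs_def])
    also have "\<dots> = (1 / \<eta>\<^sup>2) * (q m / 2^m)"
      using \<eta> by (simp add: power2_eq_square field_simps)
    finally show ?thesis by (simp add: algebra_simps)
  qed
  have q_sum: "summable (\<lambda>m. q m / 2^m)"
  proof (rule summableI_nonneg_bounded)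
    show "(\<Sum>m<K. q m / 2^m) \<le> 4 * w" for K
    proof -
      have "(\<Sum>m<K. q m / 2^m) = expectation (\<lambda>\<omega>. \<Sum>m<K. (V m 0 \<omega>)\<^sup>2 / 2^m)"
        unfolding q_def using Vsq_int by simp
      also have "\<dots> \<le> expectation (\<lambda>\<omega>. 4 * W 0 \<omega>)"
        using Vsq_int int sum_min_dyadic_le[OF W0] by (intro integral_mono) (auto simp: V_def)
      finally show ?thesis by (simp add: w_def)
    qed
  qed (use q0 in auto)
  have "summable (\<lambda>m. prob (bad m))"
    by (rule summable_comparison_test'[OF summable_mult[OF q_sum], of 0]) (use bad_le in auto)
  then have "AE \<omega> in M. \<forall>\<^sub>F m in sequentially. \<omega> \<in> space M - bad m"
    by (intro borel_cantelli_AE1) (auto simp: emeasure_eq_measure)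
  then show ?thesis
  proof eventually_elim
    case (elim \<omega>)
    then obtain m0 where m0: "\<And>m. m \<ge> m0 \<Longrightarrow> (\<Sum>i<2^m. W i \<omega>) \<le> 2^m * (w + \<eta>)"
      by (auto simp: eventually_sequentially bad_def not_less)
    have "(\<Sum>s<n. W s \<omega>) \<le> 2 * (w + \<eta>) * real n" if n: "n \<ge> 2 ^ m0" for n
    proof -
      have "n > 0" using n by (cases n) auto
      then obtain m where m: "2 ^ m \<le> n" "n < 2 ^ Suc m" using ex_power_ivl1[of 2 n] by auto
      have "m0 \<le> Suc m" 
        using power_less_imp_less_exp[of "2::nat" m0 "Suc m"] n m by simp
      have "(\<Sum>s<n. W s \<omega>) \<le> (\<Sum>s<2 ^ Suc m. W s \<omega>)"
        using m W0 by (intro sum_mono2) auto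
      also have "\<dots> \<le> 2 ^ Suc m * (w + \<eta>)" by (rule m0) fact
      also have "\<dots> = 2 * (w + \<eta>) * real (2 ^ m)" by simp
      also have "\<dots> \<le> 2 * (w + \<eta>) * real n"
        using m w0 \<eta> by (intro mult_left_mono) (auto simp del: of_nat_power)
      finally show ?thesis .
    qed
    then show ?case unfolding w_def eventually_sequentially by blast
  qed
qed

end

section \<open>Records in a window of an iid process\<close>

definition window_record :: "real \<Rightarrow> real \<Rightarrow> (nat \<Rightarrow> real) \<Rightarrow> nat \<Rightarrow> nat \<Rightarrow> bool" where
  "window_record c \<delta> x a j \<longleftrightarrow> (\<forall>i\<in>{a..<j}. x i + c * real i + \<delta> < x j + c * real j)"

text \<open>Given the candidate's value x, its predecessor at distance i must lie below
  \<open>x + c * i - \<delta>\<close>, independently of the others. Open half-lines match the strict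
  record inequality.\<close>

definition window_prob :: "real measure \<Rightarrow> real \<Rightarrow> real \<Rightarrow> nat \<Rightarrow> real" where
  "window_prob \<mu> c \<delta> k = (\<integral>x. (\<Prod>i=1..k. measure \<mu> {..<x + c * real i - \<delta>}) \<partial>\<mu>)"

lemma window_record_cong:
  "a \<le> j \<Longrightarrow> (\<And>i. i \<in> {a..j} \<Longrightarrow> x i = y i) \<Longrightarrow> window_record c \<delta> x a j = window_record c \<delta> y a j"
  by (auto simp: window_record_def)

lemma window_record_measurable:
  assumes "{a..j} \<subseteq> K" "a \<le> j"
  shows "(\<lambda>x. of_bool (window_record c \<delta> x a j) :: real) \<in> borel_measurable (PiM K (\<lambda>_. borel))"
proof -
  have [measurable]: "(\<lambda>x::nat \<Rightarrow> real. x i) \<in> borel_measurable (PiM K (\<lambda>_. borel))" if "i \<in> {a..j}" for i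
    using assms that by (intro measurable_component_singleton) auto
  have "(\<lambda>x::nat \<Rightarrow> real. x i + c * real i + \<delta> < x j + c * real j) \<in> measurable (PiM K (\<lambda>_. borel)) (count_space UNIV)"
    if "i \<in> {a..<j}" for i
  proof -
    have [measurable]: "(\<lambda>x::nat \<Rightarrow> real. x i) \<in> borel_measurable (PiM K (\<lambda>_. borel))"
      "(\<lambda>x::nat \<Rightarrow> real. x j) \<in> borel_measurable (PiM K (\<lambda>_. borel))"
      using assms that by (auto intro!: measurable_component_singleton)
    show ?thesis by measurable
  qed
  then have [measurable]: "(\<lambda>x. window_record c \<delta> x a j) \<in> measurable (PiM K (\<lambda>_. borel)) (count_space UNIV)"
    unfolding window_record_def by (intro pred_intros_finite) auto
  show ?thesis by measurable
qed

lemma (in prob_space) indep_vars_blocks: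
  assumes "indep_vars (\<lambda>_. N) X I" "\<And>l. l \<in> L \<Longrightarrow> K l \<subseteq> I" "disjoint_family_on K L"
    and "\<And>l. l \<in> L \<Longrightarrow> G l \<in> measurable (PiM (K l) (\<lambda>_. N)) N'"
  shows "indep_vars (\<lambda>_. N') (\<lambda>l \<omega>. G l (restrict (\<lambda>i. X i \<omega>) (K l))) L"
  by (rule indep_vars_compose2[OF indep_vars_restrict[OF assms(1-3)]]) (use assms(4) in auto)

lemma (in prob_space) indep_vars_inj_reindex:
  assumes "indep_vars (\<lambda>_. N) X I" "inj_on f L" "f ` L \<subseteq> I"
  shows "indep_vars (\<lambda>_. N) (\<lambda>l. X (f l)) L"
proof -
  have "indep_vars (\<lambda>_. N) (\<lambda>l \<omega>. (\<lambda>y. y (f l)) (restrict (\<lambda>i. X i \<omega>) {f l})) L"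
    using assms(2,3)
    by (intro indep_vars_blocks[OF assms(1)]) (auto simp: disjoint_family_on_def inj_on_def)
  then show ?thesis by simp
qed

text \<open>The law is arbitrary and indices start at 0, so that shifted sequences and sections of a
  two-sided process are instances as well. Densities enter only when the limit of \<open>P\<close>
  is identified and the moment conditions are translated.\<close>

locale iid_drift = prob_space M for M :: "'a measure" +
  fixes X :: "nat \<Rightarrow> 'a \<Rightarrow> real" and \<mu> :: "real measure" and c \<delta> :: real
  assumes indep: "indep_vars (\<lambda>_. borel) X UNIV"
    and law: "\<And>i. distr M borel (X i) = \<mu>"
    and c_pos: "c > 0"
begin

lemma X_measurable [measurable]: "random_variable borel (X i)"
  using indep by (simp add: indep_vars_def2)

lemma real_distribution_law: "real_distribution \<mu>"
  unfolding law[of 0, symmetric] by (intro real_distribution_distr) measurable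

sublocale \<mu>: real_distribution \<mu> by (rule real_distribution_law)

definition R :: "nat \<Rightarrow> nat \<Rightarrow> 'a \<Rightarrow> real" where
  "R a j \<omega> = of_bool (window_record c \<delta> (\<lambda>i. X i \<omega>) a j)"

abbreviation "P \<equiv> window_prob \<mu> c \<delta>"

lemma R_measurable [measurable]: "random_variable borel (R a j)"
  unfolding R_def window_record_def by measurable

lemma R_bounds: "0 \<le> R a j \<omega>" "R a j \<omega> \<le> 1" "\<bar>R a j \<omega>\<bar> \<le> 1"
  by (auto simp: R_def)

lemma R_integrable [simp]: "integrable M (R a j)"
  by (rule bounded_integrable[OF _ R_bounds(3)]) measurable

lemma R_mono: "a \<le> b \<Longrightarrow> R a j \<omega> \<le> R b j \<omega>"
  by (auto simp: R_def window_record_def)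

lemma distr_restrict:
  assumes "finite K" "K \<noteq> {}"
  shows "distr M (PiM K (\<lambda>_. borel)) (\<lambda>\<omega>. \<lambda>i\<in>K. X i \<omega>) = PiM K (\<lambda>_. \<mu>)"
  using indep_vars_iff_distr_eq_PiM'[of K X "\<lambda>_. borel"] indep_vars_subset[OF indep, of K] assms
  by (simp add: law)

lemma nn_integral_finite_window:
  assumes "finite K" "K \<noteq> {}" "h \<in> borel_measurable (PiM K (\<lambda>_. borel))"
  shows "(\<integral>\<^sup>+\<omega>. h (\<lambda>i\<in>K. X i \<omega>) \<partial>M) = (\<integral>\<^sup>+y. h y \<partial>PiM K (\<lambda>_. \<mu>))"
  unfolding distr_restrict[OF assms(1,2), symmetric]
  by (subst nn_integral_distr) (use assms in \<open>auto intro!: measurable_restrict\<close>)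

lemma expectation_finite_window:
  fixes h :: "(nat \<Rightarrow> real) \<Rightarrow> real"
  assumes "finite K" "K \<noteq> {}" "h \<in> borel_measurable (PiM K (\<lambda>_. borel))"
  shows "expectation (\<lambda>\<omega>. h (\<lambda>i\<in>K. X i \<omega>)) = (\<integral>y. h y \<partial>PiM K (\<lambda>_. \<mu>))"
  unfolding distr_restrict[OF assms(1,2), symmetric]
  by (subst integral_distr) (use assms in \<open>auto intro!: measurable_restrict\<close>)

lemma R_eq_restrict:
  assumes "{a..j} \<subseteq> K" "a \<le> j"
  shows "R a j \<omega> = of_bool (window_record c \<delta> (\<lambda>i\<in>K. X i \<omega>) a j)"
  unfolding R_def using assms
  by (intro arg_cong[where f=of_bool] window_record_cong) auto

lemma measurable_lessThan_measure [measurable]: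
  assumes [measurable]: "g \<in> borel_measurable N"
  shows "(\<lambda>x. measure \<mu> {..<g x}) \<in> borel_measurable N"
proof -
  have "mono (\<lambda>y. measure \<mu> {..<y})" by (intro monoI \<mu>.finite_measure_mono) auto
  then have [measurable]: "(\<lambda>y. measure \<mu> {..<y}) \<in> borel_measurable borel"
    by (rule borel_measurable_mono)
  show ?thesis by measurable
qed

text \<open>With the value at \<open>j\<close> held fixed, the event is a box in the remaining
  coordinates and its product measure factorises. Reindexing by the distance \<open>j - i\<close>
  leaves only the window length.\<close>

lemma expectation_R:
  assumes "a \<le> j"
  shows "expectation (R a j) = P (j - a)"
proof -
  interpret product_sigma_finite "\<lambda>_::nat. \<mu>"
    by (simp add: product_sigma_finite_def \<mu>.sigma_finite_measure_axioms)
  define J where "J = {a..<j}"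
  have J: "finite J" "j \<notin> J" "insert j J = {a..j}" using assms by (auto simp: J_def)
  define h where "h y = ennreal (of_bool (window_record c \<delta> y a j))" for y
  have h [measurable]: "h \<in> borel_measurable (PiM {a..j} (\<lambda>_. borel))"
    unfolding h_def using window_record_measurable[of a j "{a..j}" c \<delta>] assms by measurable
  have "ennreal (expectation (R a j)) = (\<integral>\<^sup>+\<omega>. ennreal (R a j \<omega>) \<partial>M)"
    using R_bounds by (simp add: nn_integral_eq_integral)
  also have "\<dots> = (\<integral>\<^sup>+\<omega>. h (\<lambda>i\<in>{a..j}. X i \<omega>) \<partial>M)"
    unfolding h_def using assms by (simp add: R_eq_restrict[of a j "{a..j}"])
  also have "\<dots> = (\<integral>\<^sup>+y. h y \<partial>PiM (insert j J) (\<lambda>_. \<mu>))"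
    using assms by (subst nn_integral_finite_window) (auto simp: J)
  also have "\<dots> = (\<integral>\<^sup>+y. (\<integral>\<^sup>+x. h (x(j := y)) \<partial>PiM J (\<lambda>_. \<mu>)) \<partial>\<mu>)"
  proof (rule product_nn_integral_insert_rev[OF J(1,2)])
    have "sets (PiM (insert j J) (\<lambda>_. \<mu>)) = sets (PiM {a..j} (\<lambda>_. borel))"
      unfolding J(3) by (intro sets_PiM_cong) auto
    then show "h \<in> borel_measurable (PiM (insert j J) (\<lambda>_. \<mu>))"
      using h measurable_cong_sets by blast
  qed
  also have "\<dots> = (\<integral>\<^sup>+y. ennreal (\<Prod>i=1..j - a. measure \<mu> {..<y + c * real i - \<delta>}) \<partial>\<mu>)"
  proof (rule nn_integral_cong)
    fix y
    have "(\<integral>\<^sup>+x. h (x(j := y)) \<partial>PiM J (\<lambda>_. \<mu>))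
        = (\<integral>\<^sup>+x. indicator (PiE J (\<lambda>i. {..<y + c * real (j - i) - \<delta>})) x \<partial>PiM J (\<lambda>_. \<mu>))"
    proof (rule nn_integral_cong)
      fix x assume "x \<in> space (PiM J (\<lambda>_. \<mu>))"
      then have x: "x \<in> extensional J" by (auto simp: space_PiM PiE_def)
      have "window_record c \<delta> (x(j := y)) a j \<longleftrightarrow> x \<in> PiE J (\<lambda>i. {..<y + c * real (j - i) - \<delta>})"
        using x by (auto simp: window_record_def PiE_def Pi_def J_def of_nat_diff algebra_simps)
      then show "h (x(j := y)) = indicator (PiE J (\<lambda>i. {..<y + c * real (j - i) - \<delta>})) x"
        by (simp add: h_def indicator_def)
    qed
    also have "\<dots> = emeasure (PiM J (\<lambda>_. \<mu>)) (PiE J (\<lambda>i. {..<y + c * real (j - i) - \<delta>}))"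
      using J by (intro nn_integral_indicator sets_PiM_I_finite) auto
    also have "\<dots> = (\<Prod>i\<in>J. emeasure \<mu> {..<y + c * real (j - i) - \<delta>})"
      using J by (intro emeasure_PiM) auto
    also have "\<dots> = ennreal (\<Prod>i\<in>J. measure \<mu> {..<y + c * real (j - i) - \<delta>})"
      by (simp add: \<mu>.emeasure_eq_measure prod_ennreal)
    also have "(\<Prod>i\<in>J. measure \<mu> {..<y + c * real (j - i) - \<delta>})
        = (\<Prod>i=1..j - a. measure \<mu> {..<y + c * real i - \<delta>})"
      unfolding J_def using assms
      by (intro prod.reindex_bij_witness[of _ "\<lambda>i. j - i" "\<lambda>i. j - i"]) auto
    finally show "(\<integral>\<^sup>+x. h (x(j := y)) \<partial>PiM J (\<lambda>_. \<mu>))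
        = ennreal (\<Prod>i=1..j - a. measure \<mu> {..<y + c * real i - \<delta>})" .
  qed
  also have "\<dots> = ennreal (P (j - a))"
    unfolding window_prob_def
  proof (rule nn_integral_eq_integral)
    show "integrable \<mu> (\<lambda>y. \<Prod>i=1..j - a. measure \<mu> {..<y + c * real i - \<delta>})"
    proof (rule \<mu>.integrable_const_bound[where B=1])
      show "AE y in \<mu>. norm (\<Prod>i=1..j - a. measure \<mu> {..<y + c * real i - \<delta>}) \<le> 1"
        by (auto simp: abs_prod intro!: prod_le_1)
    qed measurable
  qed (auto intro!: prod_nonneg)
  finally show ?thesis
    using R_bounds by (simp add: window_prob_def integral_nonneg_AE prod_nonneg)
qed

lemma P_nonneg: "0 \<le> P k"
  using expectation_R[of 0 k] R_bounds by (metis diff_zero integral_nonneg_AE AE_I2 le0)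

lemma P_0: "P 0 = 1"
  using \<mu>.prob_space by (simp add: window_prob_def)

text \<open>Both windows are made to end at \<open>l\<close>; the one that starts earlier is the
  more demanding.\<close>

lemma P_antimono: "k \<le> l \<Longrightarrow> P l \<le> P k"
  using expectation_R[of 0 l] expectation_R[of "l - k" l] R_mono[of 0 "l - k" l]
    integral_mono[OF R_integrable[of 0 l] R_integrable[of "l - k" l]] by simp

lemma decseq_P: "decseq P"
  using P_antimono by (auto simp: decseq_def)

lemma expectation_R_mult:
  assumes "a \<le> i" "i < b" "b \<le> j"
  shows "expectation (\<lambda>\<omega>. R a i \<omega> * R b j \<omega>) = expectation (R a i) * expectation (R b j)"
proof -
  define K where "K l = (if l then {a..i} else {b..j})" for l
  define G :: "bool \<Rightarrow> (nat \<Rightarrow> real) \<Rightarrow> real"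
    where "G l = (\<lambda>x. of_bool (if l then window_record c \<delta> x a i else window_record c \<delta> x b j))" for l
  have "indep_vars (\<lambda>_. borel) (\<lambda>l \<omega>. G l (restrict (\<lambda>i. X i \<omega>) (K l))) (UNIV :: bool set)"
  proof (rule indep_vars_blocks[OF indep])
    show "disjoint_family_on K UNIV"
      using assms by (auto simp: disjoint_family_on_def K_def)
    show "G l \<in> borel_measurable (PiM (K l) (\<lambda>_. borel))" for l
      using assms window_record_measurable[of a i "K True" c \<delta>] window_record_measurable[of b j "K False" c \<delta>]
      by (cases l) (auto simp: G_def K_def)
  qed auto
  moreover have "G True (restrict (\<lambda>i. X i \<omega>) (K True)) = R a i \<omega>" "G False (restrict (\<lambda>i. X i \<omega>) (K False)) = R b j \<omega>" for \<omega>
    using assms by (auto simp: G_def K_def R_eq_restrict[of a i "{a..i}"] R_eq_restrict[of b j "{b..j}"])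
  ultimately show ?thesis
    using indep_vars_expectation_mult[of "\<lambda>l \<omega>. G l (restrict (\<lambda>i. X i \<omega>) (K l))" UNIV True False] by simp
qed

lemma covariance_R_disjoint: "a \<le> i \<Longrightarrow> i < b \<Longrightarrow> b \<le> j \<Longrightarrow> covariance (R a i) (R b j) = 0"
  by (simp add: covariance_def expectation_R_mult)

lemma covariance_abs_le_1: "\<bar>covariance (R a i) (R b j)\<bar> \<le> 1"
proof -
  have "expectation (R a i) \<le> 1"
    using R_bounds by (intro integral_le_const) auto
  then show ?thesis
    using covariance_abs_le(1)[of "R a i" "R b j"] R_bounds by (auto intro: order_trans)
qed

text \<open>Expresses the joint expectation through the law alone, so that processes on different
  probability spaces can be compared.\<close>

lemma expectation_R_pair:
  assumes "i \<le> j"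
  shows "expectation (\<lambda>\<omega>. R 0 i \<omega> * R 0 j \<omega>)
    = (\<integral>y. of_bool (window_record c \<delta> y 0 i) * of_bool (window_record c \<delta> y 0 j) \<partial>PiM {..j} (\<lambda>_. \<mu>))"
proof -
  have "(\<lambda>y. of_bool (window_record c \<delta> y 0 i) * of_bool (window_record c \<delta> y 0 j) :: real)
      \<in> borel_measurable (PiM {..j} (\<lambda>_. borel))"
    using assms by (intro borel_measurable_times window_record_measurable) auto
  from expectation_finite_window[OF _ _ this] show ?thesis
    using assms R_eq_restrict[of 0 i "{..j}"] R_eq_restrict[of 0 j "{..j}"] by simp
qed

end

section \<open>Almost sure convergence of the record averages\<close>

text \<open>The distances \<open>j - s\<close> are distinct integers in (k, y], and of these there
  are at most y - k, whatever \<open>s\<close> and \<open>n\<close> are.\<close>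

lemma card_shifted_le:
  fixes y :: real
  shows "real (card {j \<in> {s + k<..<n}. real (j - s) \<le> y}) \<le> max 0 (y - real k)"
proof (cases "{j \<in> {s + k<..<n}. real (j - s) \<le> y} = {}")
  case False
  then obtain j where j: "s + k < j" "real (j - s) \<le> y" by auto
  have y: "real k < y" using j by linarith
  have "{j \<in> {s + k<..<n}. real (j - s) \<le> y} \<subseteq> {s + k<..s + nat \<lfloor>y\<rfloor>}"
  proof safe
    fix i assume "i \<in> {s + k<..<n}" and i: "real (i - s) \<le> y"
    then have "int (i - s) \<le> \<lfloor>y\<rfloor>" by (simp add: le_floor_iff)
    then show "i \<in> {s + k<..s + nat \<lfloor>y\<rfloor>}" using \<open>i \<in> {s + k<..<n}\<close> by auto
  qed
  then have "card {j \<in> {s + k<..<n}. real (j - s) \<le> y} \<le> card {s + k<..s + nat \<lfloor>y\<rfloor>}"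
    by (intro card_mono) auto
  also have "\<dots> = nat \<lfloor>y\<rfloor> - k" by simp
  finally have "real (card {j \<in> {s + k<..<n}. real (j - s) \<le> y}) \<le> real (nat \<lfloor>y\<rfloor> - k)" by simp
  also have "k \<le> nat \<lfloor>y\<rfloor>" using y by (simp add: le_nat_floor)
  then have "real (nat \<lfloor>y\<rfloor> - k) \<le> y - real k" using y by (simp add: of_nat_diff)
  finally show ?thesis by simp
next
  case True
  show ?thesis unfolding True by simp
qed

context iid_drift
begin

text \<open>From lag \<open>k + 1\<close> on the two windows are disjoint, so each row of the
  covariance sum has at most \<open>k\<close> nonzero entries, of size at most 1, and the variance
  grows linearly.\<close>

lemma AE_window_averages:
  "AE \<omega> in M. (\<lambda>n. (\<Sum>j<n. R (j - k) j \<omega>) / real n) \<longlonglongrightarrow> P k"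
proof (rule AE_averages_tendsto[where C="1 + 2 * real k"])
  fix n
  have inner: "(\<Sum>m<N. covariance (R (i - k) i) (R (i + Suc m - k) (i + Suc m))) \<le> real k" for i N
  proof -
    have "(\<Sum>m<N. covariance (R (i - k) i) (R (i + Suc m - k) (i + Suc m)))
        \<le> (\<Sum>m<N. if m < k then 1 else 0)"
    proof (rule sum_mono)
      fix m
      show "covariance (R (i - k) i) (R (i + Suc m - k) (i + Suc m)) \<le> (if m < k then 1 else 0)"
      proof (cases "m < k")
        case True
        then show ?thesis using covariance_abs_le_1[of "i - k" i "i + Suc m - k" "i + Suc m"] by auto
      next
        case False
        then show ?thesis by (subst covariance_R_disjoint) auto
      qed
    qed
    also have "\<dots> = real (card ({..<N} \<inter> {m. m < k}))"
      by (subst sum.inter_filter[symmetric]) (auto simp: Int_def)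
    also have "\<dots> \<le> real (card {..<k})" by (intro of_nat_mono card_mono) auto
    finally show ?thesis by simp
  qed
  have "variance (\<lambda>\<omega>. \<Sum>j<n. R (j - k) j \<omega>) = (\<Sum>i<n. covariance (R (i - k) i) (R (i - k) i)
      + 2 * (\<Sum>m<n - Suc i. covariance (R (i - k) i) (R (i + Suc m - k) (i + Suc m))))"
    by (rule variance_of_sum[OF _ R_bounds(3)]) measurable
  also have "\<dots> \<le> (\<Sum>i<n. 1 + 2 * real k)"
    using covariance_abs_le_1 inner by (intro sum_mono add_mono mult_left_mono) (auto simp: abs_le_iff)
  finally show "variance (\<lambda>\<omega>. \<Sum>j<n. R (j - k) j \<omega>) \<le> (1 + 2 * real k) * real n"
    by (simp add: mult.commute)
next
  \<comment> \<open>Truncated subtraction shortens the first \<open>k\<close> windows, which affects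
    finitely many means.\<close>
  have "(\<lambda>j. P (min j k)) \<longlonglongrightarrow> P k"
    by (rule tendsto_eventually) (use eventually_ge_at_top[of k] in eventually_elim, simp)
  from cesaro_mean[OF this]
  show "(\<lambda>n. expectation (\<lambda>\<omega>. \<Sum>j<n. R (j - k) j \<omega>) / real n) \<longlonglongrightarrow> P k"
  proof (rule Lim_transform_eventually, intro always_eventually allI)
    fix n
    have "expectation (R (j - k) j) = P (min j k)" for j
      by (subst expectation_R) (auto simp: min_def)
    then show "(\<Sum>i<n. P (min i k)) / real n = expectation (\<lambda>\<omega>. \<Sum>j<n. R (j - k) j \<omega>) / real n"
      by simp
  qed
qed (auto simp: R_bounds)

lemma AE_low_averages:
  "AE \<omega> in M. (\<lambda>n. (\<Sum>j<n. indicator {..<y} (X j \<omega>)) / real n) \<longlonglongrightarrow> measure \<mu> {..<y}"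
proof (rule AE_averages_tendsto[where C=1])
  define B where "B j \<omega> = indicat_real {..<y} (X j \<omega>)" for j \<omega>
  have [measurable]: "random_variable borel (B j)" for j unfolding B_def by measurable
  have Bb: "\<bar>B j \<omega>\<bar> \<le> 1" "0 \<le> B j \<omega>" "B j \<omega> \<le> 1" for j \<omega> by (auto simp: B_def indicator_def)
  have Bint: "integrable M (B j)" for j by (rule bounded_integrable[OF _ Bb(1)]) measurable
  have EB: "expectation (B j) = measure \<mu> {..<y}" for j
    unfolding B_def law[of j, symmetric]
    using integral_distr[of "X j" M borel "indicat_real {..<y}"] by (simp add: measure_distr)
  have indB: "indep_vars (\<lambda>_. borel) B UNIV"
    unfolding B_def[abs_def] by (rule indep_vars_compose2[OF indep]) measurable
  fix n
  have "covariance (B i) (B (i + Suc m)) = 0" for i m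
    using indep_vars_expectation_mult[OF indB, of i "i + Suc m"] Bint by (simp add: covariance_def)
  then have "variance (\<lambda>\<omega>. \<Sum>j<n. B j \<omega>) = (\<Sum>i<n. covariance (B i) (B i))"
    using variance_of_sum[of B, OF _ Bb(1)] by simp
  also have "\<dots> \<le> (\<Sum>i<n. 1)"
  proof (rule sum_mono)
    fix i
    have "expectation (B i) \<le> 1" using Bb Bint by (intro integral_le_const) auto
    then show "covariance (B i) (B i) \<le> 1" using covariance_abs_le(1)[of "B i" "B i"] Bb by auto
  qed
  finally show "variance (\<lambda>\<omega>. \<Sum>j<n. indicator {..<y} (X j \<omega>)) \<le> 1 * real n"
    by (simp add: B_def)
  have "(\<lambda>n. (\<Sum>j<n. measure \<mu> {..<y}) / real n) \<longlonglongrightarrow> measure \<mu> {..<y}"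
    by (rule cesaro_mean) simp
  moreover have "expectation (\<lambda>\<omega>. \<Sum>j<n. B j \<omega>) = (\<Sum>j<n. measure \<mu> {..<y})" for n
    using EB Bint by simp
  ultimately have means: "(\<lambda>n. expectation (\<lambda>\<omega>. \<Sum>j<n. B j \<omega>) / real n) \<longlonglongrightarrow> measure \<mu> {..<y}"
    by simp
  show "(\<lambda>n. expectation (\<lambda>\<omega>. \<Sum>j<n. indicator {..<y} (X j \<omega>)) / real n) \<longlonglongrightarrow> measure \<mu> {..<y}"
    using means by (simp only: B_def)
qed (auto simp: indicator_def)

text \<open>Bounds how many candidates of height at least \<open>- L\<close>, at distance more than
  \<open>k\<close>, an observation x can defeat: at distance d this requires
  \<open>c * d \<le> x + \<delta> + L\<close>.\<close>

definition overshoot :: "real \<Rightarrow> nat \<Rightarrow> real \<Rightarrow> real" where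
  "overshoot L k x = max 0 ((x + \<delta> + L) / c - real k)"

lemma overshoot_measurable [measurable]: "overshoot L k \<in> borel_measurable borel"
  unfolding overshoot_def by measurable

lemma overshoot_nonneg: "0 \<le> overshoot L k x"
  by (simp add: overshoot_def)

lemma lost_records_le:
  "(\<Sum>j<n. R (j - k) j \<omega>) - (\<Sum>j<n. R 0 j \<omega>)
    \<le> (\<Sum>j<n. indicator {..<-L} (X j \<omega>)) + (\<Sum>s<n. overshoot L k (X s \<omega>))"
proof -
  \<comment> \<open>\<open>g s j\<close> marks that \<open>X s\<close> is large enough to defeat a
    candidate of height \<open>- L\<close> at \<open>j\<close>, at distance more than
    \<open>k\<close>.\<close>
  define g :: "nat \<Rightarrow> nat \<Rightarrow> real"
    where "g s j = (if s + k < j \<and> real (j - s) \<le> (X s \<omega> + \<delta> + L) / c then 1 else 0)" for s j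
  have "R (j - k) j \<omega> - R 0 j \<omega> \<le> indicator {..<-L} (X j \<omega>) + (\<Sum>s<n. g s j)" if j: "j < n" for j
  proof (cases "R (j - k) j \<omega> = 1 \<and> R 0 j \<omega> = 0 \<and> X j \<omega> \<ge> - L")
    case True
    then have rec: "window_record c \<delta> (\<lambda>i. X i \<omega>) (j - k) j" "\<not> window_record c \<delta> (\<lambda>i. X i \<omega>) 0 j"
      by (auto simp: R_def)
    then obtain s where s: "s < j" "\<not> X s \<omega> + c * real s + \<delta> < X j \<omega> + c * real j"
      by (auto simp: window_record_def)
    \<comment> \<open>The candidate wins against the short window, so the index that defeats it lies
      outside that window.\<close>
    have sk: "s + k < j"
      using rec(1) s by (force simp: window_record_def)
    have "c * real (j - s) \<le> X s \<omega> + \<delta> + L"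
      using s True by (simp add: of_nat_diff algebra_simps)
    then have "g s j = 1" using sk c_pos by (simp add: g_def field_simps)
    moreover have "g s j \<le> (\<Sum>s<n. g s j)"
      using s j by (intro member_le_sum) (auto simp: g_def)
    ultimately have "1 \<le> (\<Sum>s<n. g s j)" by simp
    then show ?thesis using True by (simp add: indicator_def)
  next
    case False
    have "0 \<le> (\<Sum>s<n. g s j)" by (intro sum_nonneg) (auto simp: g_def)
    then show ?thesis using False by (auto simp: R_def indicator_def split: if_splits)
  qed
  then have "(\<Sum>j<n. R (j - k) j \<omega> - R 0 j \<omega>) \<le> (\<Sum>j<n. indicator {..<-L} (X j \<omega>) + (\<Sum>s<n. g s j))"
    by (intro sum_mono) auto
  also have "\<dots> = (\<Sum>j<n. indicator {..<-L} (X j \<omega>)) + (\<Sum>s<n. \<Sum>j<n. g s j)"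
    unfolding sum.distrib by (subst sum.swap) (rule refl)
  also have "(\<Sum>s<n. \<Sum>j<n. g s j) \<le> (\<Sum>s<n. overshoot L k (X s \<omega>))"
  proof (rule sum_mono)
    fix s
    have "(\<Sum>j<n. g s j) = real (card {j \<in> {s + k<..<n}. real (j - s) \<le> (X s \<omega> + \<delta> + L) / c})"
      unfolding g_def by (subst sum.inter_filter[symmetric]) (auto intro!: arg_cong[where f=card])
    then show "(\<Sum>j<n. g s j) \<le> overshoot L k (X s \<omega>)"
      using card_shifted_le[of s k n "(X s \<omega> + \<delta> + L) / c"] by (simp add: overshoot_def)
  qed
  finally show ?thesis by (simp add: sum_subtractf)
qed

context
  assumes pos_part: "integrable \<mu> (\<lambda>x. max 0 x)"
begin

lemma overshoot_le: "overshoot L k x \<le> (max 0 x + \<bar>\<delta> + L\<bar>) / c"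
proof -
  have "(x + \<delta> + L) / c \<le> (max 0 x + \<bar>\<delta> + L\<bar>) / c"
    using c_pos by (intro divide_right_mono) auto
  moreover have "0 \<le> (max 0 x + \<bar>\<delta> + L\<bar>) / c" using c_pos by simp
  ultimately show ?thesis unfolding overshoot_def by auto
qed

lemma overshoot_integrable: "integrable \<mu> (overshoot L k)"
proof (rule Bochner_Integration.integrable_bound)
  show "integrable \<mu> (\<lambda>x. (max 0 x + \<bar>\<delta> + L\<bar>) / c)" using pos_part by auto
  show "AE x in \<mu>. norm (overshoot L k x) \<le> norm ((max 0 x + \<bar>\<delta> + L\<bar>) / c)"
    using overshoot_le overshoot_nonneg c_pos by (auto intro: order_trans)
qed measurable

lemma overshoot_mean_tendsto: "(\<lambda>k. \<integral>x. overshoot L k x \<partial>\<mu>) \<longlonglongrightarrow> 0"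
proof -
  have "(\<lambda>k. \<integral>x. overshoot L k x \<partial>\<mu>) \<longlonglongrightarrow> (\<integral>x. 0 \<partial>\<mu>)"
  proof (rule integral_dominated_convergence[where w="\<lambda>x. (max 0 x + \<bar>\<delta> + L\<bar>) / c"])
    show "integrable \<mu> (\<lambda>x. (max 0 x + \<bar>\<delta> + L\<bar>) / c)" using pos_part by auto
    show "AE x in \<mu>. (\<lambda>k. overshoot L k x) \<longlonglongrightarrow> 0"
    proof (intro AE_I2 tendsto_eventually)
      fix x
      obtain k0 where k0: "(x + \<delta> + L) / c < real k0" using reals_Archimedean2 by blast
      show "\<forall>\<^sub>F k in sequentially. overshoot L k x = 0"
        using eventually_ge_at_top[of k0] by eventually_elim (use k0 in \<open>auto simp: overshoot_def\<close>)
    qed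
    show "AE x in \<mu>. norm (overshoot L k x) \<le> (max 0 x + \<bar>\<delta> + L\<bar>) / c" for k
      using overshoot_le overshoot_nonneg by auto
  qed measurable
  then show ?thesis by simp
qed

lemma AE_overshoot_sum_le:
  assumes "\<eta> > 0"
  shows "AE \<omega> in M. \<forall>\<^sub>F n in sequentially.
    (\<Sum>s<n. overshoot L k (X s \<omega>)) \<le> 2 * ((\<integral>x. overshoot L k x \<partial>\<mu>) + \<eta>) * real n"
proof -
  have E: "expectation (\<lambda>\<omega>. overshoot L k (X 0 \<omega>)) = (\<integral>x. overshoot L k x \<partial>\<mu>)"
    unfolding law[of 0, symmetric] by (rule integral_distr[symmetric]) measurable
  have "AE \<omega> in M. \<forall>\<^sub>F n in sequentially. (\<Sum>s<n. overshoot L k (X s \<omega>))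
      \<le> 2 * (expectation (\<lambda>\<omega>. overshoot L k (X 0 \<omega>)) + \<eta>) * real n"
  proof (rule AE_eventually_iid_sum_le)
    show "indep_vars (\<lambda>_. borel) (\<lambda>s \<omega>. overshoot L k (X s \<omega>)) UNIV"
      by (rule indep_vars_compose2[OF indep]) measurable
    have "distr M borel (\<lambda>\<omega>. overshoot L k (X i \<omega>)) = distr \<mu> borel (overshoot L k)" for i
      unfolding law[of i, symmetric] by (simp add: distr_distr comp_def)
    then show "distr M borel (\<lambda>\<omega>. overshoot L k (X i \<omega>)) = distr M borel (\<lambda>\<omega>. overshoot L k (X 0 \<omega>))" for i
      by simp
    have "integrable (distr M borel (X 0)) (overshoot L k)" unfolding law by (rule overshoot_integrable)
    then show "integrable M (\<lambda>\<omega>. overshoot L k (X 0 \<omega>))"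
      by (subst (asm) integrable_distr_eq) measurable
  qed (auto simp: overshoot_nonneg assms)
  then show ?thesis unfolding E .
qed

lemma AE_record_averages:
  assumes P_lim: "P \<longlonglongrightarrow> p"
  shows "AE \<omega> in M. (\<lambda>n. (\<Sum>j<n. R 0 j \<omega>) / real n) \<longlonglongrightarrow> p"
proof -
  define E where "E L k = (\<integral>x. overshoot L k x \<partial>\<mu>)" for L k
  \<comment> \<open>With natural \<open>L\<close> and \<open>k\<close>, and a slack
    \<open>1 / Suc k\<close> that vanishes along with the mean, only countably many null sets
    arise.\<close>
  have "AE \<omega> in M. \<forall>k. (\<lambda>n. (\<Sum>j<n. R (j - k) j \<omega>) / real n) \<longlonglongrightarrow> P k"
    unfolding AE_all_countable using AE_window_averages by blast
  moreover have "AE \<omega> in M. \<forall>L::nat. (\<lambda>n. (\<Sum>j<n. indicator {..<- real L} (X j \<omega>)) / real n) \<longlonglongrightarrow> measure \<mu> {..<- real L}"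
    unfolding AE_all_countable using AE_low_averages by blast
  moreover have "AE \<omega> in M. \<forall>(L::nat) k. \<forall>\<^sub>F n in sequentially.
      (\<Sum>s<n. overshoot (real L) k (X s \<omega>)) \<le> 2 * (E (real L) k + 1 / real (Suc k)) * real n"
    unfolding AE_all_countable E_def by (intro allI AE_overshoot_sum_le) simp
  ultimately show ?thesis
  proof eventually_elim
    case (elim \<omega>)
    show ?case
    proof (rule LIMSEQ_I)
      fix e :: real assume e: "e > 0"
      \<comment> \<open>\<open>L\<close> is fixed before \<open>k\<close>, since the overshoot means
        depend on it. The error budget is e/8 for low candidates and e/4 each for the overshoot, for
        \<open>P k - p\<close> and for the window average.\<close>
      have "((\<lambda>y. measure \<mu> {..y}) \<longlongrightarrow> 0) at_bot"
        using \<mu>.cdf_lim_at_bot by (simp add: cdf_def[abs_def])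
      then have "\<forall>\<^sub>F y in at_bot. measure \<mu> {..y} < e / 8" by (rule order_tendstoD(2)) (use e in simp)
      then obtain y0 where y0: "\<And>y. y \<le> y0 \<Longrightarrow> measure \<mu> {..y} < e / 8"
        by (auto simp: eventually_at_bot_linorder)
      obtain L :: nat where "- y0 < real L" using reals_Archimedean2 by blast
      moreover have "measure \<mu> {..<- real L} \<le> measure \<mu> {..- real L}" by (intro \<mu>.finite_measure_mono) auto
      ultimately have L: "measure \<mu> {..<- real L} < e / 8" using y0[of "- real L"] by simp
      have lim2: "(\<lambda>k. 2 * (E (real L) k + 1 / real (Suc k))) \<longlonglongrightarrow> 2 * (0 + 0)"
        unfolding E_def by (intro tendsto_intros overshoot_mean_tendsto LIMSEQ_Suc lim_const_over_n[of 1, simplified])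
      have "\<forall>\<^sub>F k in sequentially. 2 * (E (real L) k + 1 / real (Suc k)) < e / 4"
        using order_tendstoD(2)[OF lim2, of "e / 4"] e by simp
      moreover have "\<forall>\<^sub>F k in sequentially. P k < p + e / 4"
        using order_tendstoD(2)[OF P_lim, of "p + e / 4"] e by simp
      ultimately have "\<forall>\<^sub>F k in sequentially. 2 * (E (real L) k + 1 / real (Suc k)) < e / 4 \<and> P k < p + e / 4"
        by eventually_elim simp
      then obtain k where k: "2 * (E (real L) k + 1 / real (Suc k)) < e / 4" "P k < p + e / 4"
        using eventually_happens trivial_limit_sequentially by blast
      have pk: "p \<le> P k" by (rule decseq_ge[OF decseq_P P_lim])
      have e1: "\<forall>\<^sub>F n in sequentially. \<bar>(\<Sum>j<n. R (j - k) j \<omega>) / real n - P k\<bar> < e / 4"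
        using tendstoD[OF elim(1)[rule_format, of k], of "e / 4"] e by (simp add: dist_real_def)
      have e2: "\<forall>\<^sub>F n in sequentially. (\<Sum>j<n. indicator {..<- real L} (X j \<omega>)) / real n < e / 8"
        using order_tendstoD(2)[OF elim(2)[rule_format, of L] L] .
      have "\<forall>\<^sub>F n in sequentially. norm ((\<Sum>j<n. R 0 j \<omega>) / real n - p) < e"
        using e1 e2 elim(3)[rule_format, of L k] eventually_gt_at_top[of 0]
      proof eventually_elim
        case (elim n)
        define A where "A = (\<Sum>j<n. R (j - k) j \<omega>) / real n"
        define S where "S = (\<Sum>j<n. R 0 j \<omega>) / real n"
        define lo where "lo = (\<Sum>j<n. indicator {..<- real L} (X j \<omega>)) / real n"
        define ov where "ov = (\<Sum>s<n. overshoot (real L) k (X s \<omega>)) / real n"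
        have "S \<le> A"
          unfolding S_def A_def using elim by (intro divide_right_mono sum_mono R_mono) auto
        moreover have "A - S \<le> lo + ov"
        proof -
          have "A - S = ((\<Sum>j<n. R (j - k) j \<omega>) - (\<Sum>j<n. R 0 j \<omega>)) / real n"
            by (simp add: A_def S_def diff_divide_distrib)
          also have "\<dots> \<le> ((\<Sum>j<n. indicator {..<- real L} (X j \<omega>)) + (\<Sum>s<n. overshoot (real L) k (X s \<omega>))) / real n"
            by (intro divide_right_mono lost_records_le) simp
          finally show ?thesis by (simp add: lo_def ov_def add_divide_distrib)
        qed
        moreover have "ov \<le> 2 * (E (real L) k + 1 / real (Suc k))"
          unfolding ov_def using elim(3,4) by (simp add: divide_le_eq)
        moreover have "\<bar>A - P k\<bar> < e / 4" "lo < e / 8"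
          using elim by (simp_all add: A_def lo_def)
        ultimately have "\<bar>S - p\<bar> < e" using k pk e by linarith
        then show ?case by (simp add: S_def)
      qed
      then show "\<exists>no. \<forall>n\<ge>no. norm ((\<Sum>j<n. R 0 j \<omega>) / real n - p) < e"
        by (simp add: eventually_sequentially)
    qed
  qed
qed

end

end

section \<open>Identification of the limit of the window probabilities\<close>

text \<open>A law with a density has no atoms, which reconciles the strict record inequality with
  the closed half-line in the cdf.\<close>

lemma density_lessThan_eq_cdf:
  assumes [measurable]: "f \<in> borel_measurable borel" and "prob_space (density lborel (\<lambda>x. ennreal (f x)))"
  shows "measure (density lborel (\<lambda>x. ennreal (f x))) {..<y} = cdf_of_density f y"
proof -
  define \<mu> where "\<mu> = density lborel (\<lambda>x. ennreal (f x))"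
  interpret prob_space \<mu> using assms by (simp add: \<mu>_def)
  have sets [simp]: "sets \<mu> = sets borel" by (simp add: \<mu>_def)
  have "absolutely_continuous lborel \<mu>"
    unfolding \<mu>_def by (rule absolutely_continuousI_density) measurable
  moreover have "{y} \<in> null_sets lborel" by (intro null_setsI) auto
  ultimately have "{y} \<in> null_sets \<mu>" unfolding absolutely_continuous_def by blast
  then have "measure \<mu> ({..<y} \<union> {y}) = measure \<mu> {..<y}"
    by (intro measure_Un_null_set) auto
  moreover have "{..<y} \<union> {y} = {..y}" by auto
  ultimately show ?thesis by (simp add: cdf_of_density_def cdf_def \<mu>_def[symmetric])
qed

text \<open>The partial products decrease within [0, 1], so dominated convergence with bound 1
  applies under the law; the density then becomes a factor of the integrand.\<close>

lemma window_prob_tendsto_record_prob: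
  assumes [measurable]: "f \<in> borel_measurable borel" and f0: "\<And>x. 0 \<le> f x"
    and prob: "prob_space (density lborel (\<lambda>x. ennreal (f x)))" and c: "c > 0"
  shows "window_prob (density lborel (\<lambda>x. ennreal (f x))) c \<delta> \<longlonglongrightarrow> record_prob c f \<delta>"
proof -
  define \<mu> where "\<mu> = density lborel (\<lambda>x. ennreal (f x))"
  interpret real_distribution \<mu>
    unfolding \<mu>_def using prob by (simp add: real_distribution_def real_distribution_axioms_def)
  define g where "g n x = (\<Prod>i=1..n. cdf \<mu> (x + c * real i - \<delta>))" for n x
  have F01: "0 \<le> cdf \<mu> y" "cdf \<mu> y \<le> 1" for y by (auto simp: cdf_def)
  have g0: "0 \<le> g n x" for n x unfolding g_def using F01 by (intro prod_nonneg) auto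
  have g1: "g n x \<le> 1" for n x unfolding g_def using F01 by (intro prod_le_1) auto
  have dec: "decseq (\<lambda>n. g n x)" for x
  proof (rule decseq_SucI)
    show "g (Suc n) x \<le> g n x" for n
      using mult_right_le_one_le[OF g0[of n x] F01[of "x + c * real (Suc n) - \<delta>"]] by (simp add: g_def)
  qed
  have lim: "(\<lambda>n. g n x) \<longlonglongrightarrow> lim (\<lambda>n. g n x)" for x
    using decseq_convergent[OF dec, of 0 x] g0 by (metis convergent_LIMSEQ_iff convergent_def)
  have "cdf \<mu> \<in> borel_measurable borel"
    by (intro borel_measurable_mono monoI cdf_nondecreasing)
  then have gm [measurable]: "g n \<in> borel_measurable borel" for n unfolding g_def by measurable
  have lm [measurable]: "(\<lambda>x. lim (\<lambda>n. g n x)) \<in> borel_measurable borel"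
    by (rule borel_measurable_LIMSEQ_metric[OF gm lim])
  have "(\<lambda>n. \<integral>x. g n x \<partial>\<mu>) \<longlonglongrightarrow> (\<integral>x. lim (\<lambda>n. g n x) \<partial>\<mu>)"
    by (rule integral_dominated_convergence[where w="\<lambda>_. 1"]) (use lim g0 g1 in \<open>auto simp: abs_le_iff\<close>)
  moreover have "window_prob \<mu> c \<delta> n = (\<integral>x. g n x \<partial>\<mu>)" for n
    unfolding window_prob_def g_def \<mu>_def
    by (simp add: density_lessThan_eq_cdf[OF assms(1) prob] cdf_of_density_def)
  moreover have "(\<integral>x. lim (\<lambda>n. g n x) \<partial>\<mu>) = record_prob c f \<delta>"
    unfolding \<mu>_def record_prob_def cdf_of_density_def g_def[symmetric]
    using lm f0 by (subst integral_density) (auto simp: g_def \<mu>_def mult.commute)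
  ultimately have "(\<lambda>n. window_prob \<mu> c \<delta> n) \<longlonglongrightarrow> record_prob c f \<delta>" by simp
  then show ?thesis by (simp add: \<mu>_def)
qed

section \<open>Independent blocks\<close>

lemma sum_blocks:
  fixes f :: "nat \<Rightarrow> real"
  shows "(\<Sum>j<b * q. f j) = (\<Sum>l<q. \<Sum>r<b. f (b * l + r))"
proof (induction q)
  case (Suc q)
  have "(\<Sum>j<b * Suc q. f j) = (\<Sum>j<b * q. f j) + (\<Sum>j=b * q..<b * q + b. f j)"
    unfolding lessThan_atLeast0 by (subst sum.atLeastLessThan_concat) (auto simp: algebra_simps)
  also have "(\<Sum>j=b * q..<b * q + b. f j) = (\<Sum>r<b. f (b * q + r))"
    by (subst sum.atLeastLessThan_shift_0) (simp add: lessThan_atLeast0)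
  finally show ?case using Suc by simp
qed simp

lemma cmod_iexp_diff_le: "cmod (iexp x - iexp y) \<le> \<bar>x - y\<bar>"
proof -
  have "iexp x - iexp y = iexp y * (iexp (x - y) - 1)"
    by (simp add: algebra_simps flip: exp_add)
  then have "cmod (iexp x - iexp y) = cmod (iexp (x - y) - 1)" by (simp add: norm_mult)
  also have "\<dots> \<le> \<bar>x - y\<bar>" using iexp_approx1[of "x - y" 0] by simp
  finally show ?thesis .
qed

lemma (in prob_space) char_distr:
  "random_variable borel V \<Longrightarrow> char (distr M borel V) t = (CLINT \<omega>|M. iexp (t * V \<omega>))"
  unfolding char_def by (subst integral_distr) auto

text \<open>Turns closeness in mean into closeness of characteristic functions, so that the
  approximation by blocks only has to be good in the mean.\<close>

lemma (in prob_space) char_distr_diff_le: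
  fixes V V' :: "'a \<Rightarrow> real"
  assumes [measurable]: "integrable M V" "integrable M V'"
  shows "cmod (char (distr M borel V) t - char (distr M borel V') t) \<le> \<bar>t\<bar> * expectation (\<lambda>\<omega>. \<bar>V \<omega> - V' \<omega>\<bar>)"
proof -
  have int: "integrable M (\<lambda>\<omega>. iexp (t * V \<omega>))" "integrable M (\<lambda>\<omega>. iexp (t * V' \<omega>))"
    by (auto intro!: integrable_iexp)
  have "char (distr M borel V) t - char (distr M borel V') t = (CLINT \<omega>|M. iexp (t * V \<omega>)) - (CLINT \<omega>|M. iexp (t * V' \<omega>))"
    by (subst (1 2) char_distr) auto
  also have "\<dots> = (CLINT \<omega>|M. iexp (t * V \<omega>) - iexp (t * V' \<omega>))"
    by (rule Bochner_Integration.integral_diff[OF int, symmetric])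
  also have "cmod \<dots> \<le> expectation (\<lambda>\<omega>. cmod (iexp (t * V \<omega>) - iexp (t * V' \<omega>)))"
    by (rule integral_norm_bound)
  also have "\<dots> \<le> expectation (\<lambda>\<omega>. \<bar>t\<bar> * \<bar>V \<omega> - V' \<omega>\<bar>)"
  proof (rule integral_mono)
    show "integrable M (\<lambda>\<omega>. \<bar>t\<bar> * \<bar>V \<omega> - V' \<omega>\<bar>)"
      using assms by (intro integrable_mult_right integrable_abs Bochner_Integration.integrable_diff)
    show "cmod (iexp (t * V \<omega>) - iexp (t * V' \<omega>)) \<le> \<bar>t\<bar> * \<bar>V \<omega> - V' \<omega>\<bar>" for \<omega>
      using cmod_iexp_diff_le[of "t * V \<omega>" "t * V' \<omega>"] by (simp add: abs_mult flip: right_diff_distrib)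
  qed (intro integrable_norm Bochner_Integration.integrable_diff int)
  finally show ?thesis by simp
qed

lemma (in prob_space) expectation_abs_le_sqrt:
  fixes Y :: "'a \<Rightarrow> real"
  assumes "random_variable borel Y" "\<And>\<omega>. \<bar>Y \<omega>\<bar> \<le> K"
  shows "expectation (\<lambda>\<omega>. \<bar>Y \<omega>\<bar>) \<le> sqrt (expectation (\<lambda>\<omega>. (Y \<omega>)\<^sup>2))"
proof -
  have "integrable M (\<lambda>\<omega>. \<bar>Y \<omega>\<bar>)" "integrable M (\<lambda>\<omega>. (\<bar>Y \<omega>\<bar>)\<^sup>2)"
    using bounded_integrable[OF assms] bounded_mult_integrable[OF assms(1,1,2,2)]
    by (auto simp: power2_eq_square)
  from variance_eq[OF this] variance_positive[of "\<lambda>\<omega>. \<bar>Y \<omega>\<bar>"]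
  have "(expectation (\<lambda>\<omega>. \<bar>Y \<omega>\<bar>))\<^sup>2 \<le> expectation (\<lambda>\<omega>. (Y \<omega>)\<^sup>2)" by simp
  then show ?thesis by (rule real_le_rsqrt)
qed

text \<open>A two-stage limit: \<open>e b\<close> is the error that remains as n grows, while
  \<open>d b n\<close> may depend on \<open>b\<close> arbitrarily as long as it vanishes for each
  fixed \<open>b\<close>.\<close>

lemma LIMSEQ_by_approximation:
  fixes x :: "nat \<Rightarrow> 'a::real_normed_vector"
  assumes e: "e \<longlonglongrightarrow> 0" and L: "(\<lambda>b. L b) \<longlonglongrightarrow> l"
    and y: "\<And>b. b \<ge> 1 \<Longrightarrow> y b \<longlonglongrightarrow> L b"
    and d: "\<And>b. b \<ge> 1 \<Longrightarrow> d b \<longlonglongrightarrow> (0::real)"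
    and bound: "\<And>b. b \<ge> (1::nat) \<Longrightarrow> \<forall>\<^sub>F n in sequentially. norm (x n - y b n) \<le> e b + d b n"
  shows "x \<longlonglongrightarrow> l"
proof (rule tendstoI)
  fix r :: real assume r: "r > 0"
  have "\<forall>\<^sub>F b in sequentially. e b < r / 4" using order_tendstoD(2)[OF e, of "r/4"] r by simp
  moreover have "\<forall>\<^sub>F b in sequentially. dist (L b) l < r / 4" using tendstoD[OF L, of "r/4"] r by simp
  ultimately have "\<forall>\<^sub>F b in sequentially. e b < r / 4 \<and> dist (L b) l < r / 4 \<and> b \<ge> 1"
    using eventually_ge_at_top[of 1] by eventually_elim auto
  then obtain b where b: "e b < r / 4" "dist (L b) l < r / 4" "b \<ge> 1"
    using eventually_happens trivial_limit_sequentially by blast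
  have "\<forall>\<^sub>F n in sequentially. dist (y b n) (L b) < r / 4" using tendstoD[OF y[OF b(3)], of "r/4"] r by simp
  moreover have "\<forall>\<^sub>F n in sequentially. d b n < r / 4" using order_tendstoD(2)[OF d[OF b(3)], of "r/4"] r by simp
  ultimately show "\<forall>\<^sub>F n in sequentially. dist (x n) l < r"
    using bound[OF b(3)]
  proof eventually_elim
    case (elim n)
    have "dist (x n) l \<le> dist (x n) (y b n) + dist (y b n) (L b) + dist (L b) l"
      using dist_triangle[of "x n" l "y b n"] dist_triangle[of "y b n" l "L b"] by linarith
    then show ?case using elim b by (simp add: dist_norm)
  qed
qed

text \<open>Moving the time origin by \<open>a\<close> adds \<open>c * a\<close> to both sides of
  each comparison.\<close>

lemma window_record_shift:
  "window_record c \<delta> (\<lambda>i. x (a + i)) 0 r \<longleftrightarrow> window_record c \<delta> x a (a + r)"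
proof -
  have "(\<forall>i\<in>{a..<a + r}. Q i) \<longleftrightarrow> (\<forall>i\<in>{0..<r}. Q (a + i))" for Q
    by (metis (no_types, lifting) add_less_cancel_left atLeastLessThan_iff le_add1 le_add_diff_inverse zero_le)
  then show ?thesis by (simp add: window_record_def algebra_simps)
qed

text \<open>Serves three embeddings: shifted blocks, the one-based sequence, and a two-sided
  sequence read from a chosen time on.\<close>

lemma iid_drift_reindex:
  assumes "prob_space M" "prob_space.indep_vars M (\<lambda>_. borel) X I" "\<And>i. i \<in> I \<Longrightarrow> distr M borel (X i) = \<mu>"
    and "c > 0" "inj f" "range f \<subseteq> I"
  shows "iid_drift M (\<lambda>i::nat. X (f i)) \<mu> c"
proof -
  interpret prob_space M by fact
  show ?thesis
    using assms indep_vars_inj_reindex[OF assms(2), of f UNIV]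
    by unfold_locales auto
qed

context iid_drift
begin

lemma iid_drift_shift: "iid_drift M (\<lambda>i. X (a + i)) \<mu> c"
  by (rule iid_drift_reindex[of M X UNIV]) (auto simp: indep law c_pos prob_space_axioms)

text \<open>Only the comparisons of \<open>j\<close> with indices up to \<open>i\<close> can
  correlate with \<open>R a i\<close>. Starting the window after \<open>i\<close> makes the
  covariance vanish, and the 0/1 difference \<open>D\<close> has the stated mean.\<close>

lemma covariance_R_overlap:
  "\<bar>covariance (R a i) (R b j) \<bar> \<le> P (j - Suc i) - P (j - b)" if "a \<le> i" "i < j" "b \<le> Suc i"
proof -
  define D where "D \<omega> = R (Suc i) j \<omega> - R b j \<omega>" for \<omega>
  have [measurable]: "random_variable borel D" unfolding D_def by measurable
  have D: "0 \<le> D \<omega>" "D \<omega> \<le> 1" for \<omega>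
    using R_mono[OF that(3), of j \<omega>] R_bounds[of "Suc i" j \<omega>] R_bounds[of b j \<omega>] by (auto simp: D_def)
  have "covariance (R a i) D = covariance (R a i) (R (Suc i) j) - covariance (R a i) (R b j)"
    unfolding D_def by (rule covariance_diff_right[OF _ _ _ R_bounds(3) R_bounds(3) R_bounds(3)]) measurable
  also have "covariance (R a i) (R (Suc i) j) = 0" using that by (intro covariance_R_disjoint) auto
  finally have "\<bar>covariance (R a i) (R b j)\<bar> = \<bar>covariance (R a i) D\<bar>" by simp
  also have "\<dots> \<le> expectation D" by (rule covariance_abs_le(2)) (auto simp: D R_bounds)
  also have "\<dots> = P (j - Suc i) - P (j - b)"
    unfolding D_def using that by (simp add: expectation_R)
  finally show ?thesis .
qed

definition block_sum :: "nat \<Rightarrow> nat \<Rightarrow> 'a \<Rightarrow> real" where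
  "block_sum b l \<omega> = (\<Sum>r<b. R (b * l) (b * l + r) \<omega>)"

lemma block_sum_measurable [measurable]: "random_variable borel (block_sum b l)"
  unfolding block_sum_def by measurable

lemma block_sum_bounds: "0 \<le> block_sum b l \<omega>" "block_sum b l \<omega> \<le> real b" "\<bar>block_sum b l \<omega>\<bar> \<le> real b"
proof -
  show "0 \<le> block_sum b l \<omega>" unfolding block_sum_def by (intro sum_nonneg R_bounds)
  show "block_sum b l \<omega> \<le> real b"
    unfolding block_sum_def using sum_bounded_above[of "{..<b}" "\<lambda>r. R (b * l) (b * l + r) \<omega>" 1] R_bounds by simp
  with \<open>0 \<le> block_sum b l \<omega>\<close> show "\<bar>block_sum b l \<omega>\<bar> \<le> real b" by simp
qed

lemma block_sum_integrable: "integrable M (block_sum b l)"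
  by (rule bounded_integrable[OF _ block_sum_bounds(3)]) measurable

lemma indep_block_sums: "indep_vars (\<lambda>_. borel) (block_sum b) UNIV"
proof -
  define K where "K l = {b * l..<b * l + b}" for l
  define G where "G l y = (\<Sum>r<b. of_bool (window_record c \<delta> y (b * l) (b * l + r)) :: real)" for l y
  have disj: "K l \<inter> K l' = {}" if "l < l'" for l l'
  proof -
    have "b * l + b \<le> b * l'" using mult_le_mono2[of "Suc l" l' b] that by simp
    then show ?thesis by (auto simp: K_def)
  qed
  have "indep_vars (\<lambda>_. borel) (\<lambda>l \<omega>. G l (restrict (\<lambda>i. X i \<omega>) (K l))) UNIV"
  proof (rule indep_vars_blocks[OF indep])
    show "disjoint_family_on K UNIV"
      unfolding disjoint_family_on_def using disj by (metis Int_commute linorder_neq_iff)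
    show "G l \<in> borel_measurable (PiM (K l) (\<lambda>_. borel))" for l
      unfolding G_def[abs_def]
      by (intro borel_measurable_sum window_record_measurable) (auto simp: K_def)
  qed auto
  moreover have "(\<lambda>l \<omega>. G l (restrict (\<lambda>i. X i \<omega>) (K l))) = block_sum b"
    unfolding G_def block_sum_def
    by (intro ext sum.cong refl R_eq_restrict[symmetric]) (auto simp: K_def)
  ultimately show ?thesis by (simp only:)
qed

text \<open>Each block sum is one fixed functional \<open>G\<close> of \<open>b\<close> consecutive
  iid coordinates. The case \<open>b = 0\<close> is separate because \<open>distr_restrict\<close>
  requires a nonempty index set.\<close>

lemma block_sum_law: "distr M borel (block_sum b l) = distr M borel (block_sum b 0)"
proof (cases "b = 0")
  case True
  then show ?thesis by (simp add: block_sum_def[abs_def])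
next
  case False
  define G where "G y = (\<Sum>r<b. of_bool (window_record c \<delta> y 0 r) :: real)" for y
  have G [measurable]: "G \<in> borel_measurable (PiM {..<b} (\<lambda>_. borel))"
    unfolding G_def[abs_def] by (intro borel_measurable_sum window_record_measurable) auto
  have "distr M borel (block_sum b l) = distr (PiM {..<b} (\<lambda>_. \<mu>)) borel G" for l
  proof -
    interpret sh: iid_drift M "\<lambda>i. X (b * l + i)" \<mu> c \<delta> by (rule iid_drift_shift)
    have "block_sum b l \<omega> = G (\<lambda>i\<in>{..<b}. X (b * l + i) \<omega>)" for \<omega>
      unfolding block_sum_def G_def
    proof (rule sum.cong[OF refl])
      fix r assume "r \<in> {..<b}"
      then have r: "r < b" by simp
      have "R (b * l) (b * l + r) \<omega> = of_bool (window_record c \<delta> (\<lambda>i. X (b * l + i) \<omega>) 0 r)"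
        unfolding R_def by (simp add: window_record_shift[of c \<delta> "\<lambda>i. X i \<omega>" "b * l" r])
      also have "window_record c \<delta> (\<lambda>i. X (b * l + i) \<omega>) 0 r
          = window_record c \<delta> (\<lambda>i\<in>{..<b}. X (b * l + i) \<omega>) 0 r"
        using r by (intro window_record_cong) auto
      finally show "R (b * l) (b * l + r) \<omega> = of_bool (window_record c \<delta> (\<lambda>i\<in>{..<b}. X (b * l + i) \<omega>) 0 r)" .
    qed
    then have "block_sum b l = G \<circ> (\<lambda>\<omega>. \<lambda>i\<in>{..<b}. X (b * l + i) \<omega>)" by (intro ext) simp
    then have "distr M borel (block_sum b l) = distr M borel (G \<circ> (\<lambda>\<omega>. \<lambda>i\<in>{..<b}. X (b * l + i) \<omega>))"
      by (simp only:)
    also have "\<dots> = distr (distr M (PiM {..<b} (\<lambda>_. borel)) (\<lambda>\<omega>. \<lambda>i\<in>{..<b}. X (b * l + i) \<omega>)) borel G"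
      by (rule distr_distr[symmetric]) measurable
    also have "\<dots> = distr (PiM {..<b} (\<lambda>_. \<mu>)) borel G"
      using False by (subst sh.distr_restrict) auto
    finally show ?thesis .
  qed
  from this[of l] this[of 0] show ?thesis by simp
qed

lemma block_sum_moments:
  assumes "h \<in> borel_measurable borel"
  shows "expectation (\<lambda>\<omega>. h (block_sum b l \<omega>)) = expectation (\<lambda>\<omega>. h (block_sum b 0 \<omega>) :: real)"
  using assms block_sum_law[of b l] integral_distr[of "block_sum b l" M borel h]
    integral_distr[of "block_sum b 0" M borel h] by simp

abbreviation "block_var b \<equiv> variance (block_sum b 0)"

definition centered_blocks :: "nat \<Rightarrow> nat \<Rightarrow> 'a \<Rightarrow> real" where
  "centered_blocks b q \<omega> = (\<Sum>l<q. block_sum b l \<omega> - expectation (block_sum b 0))"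

lemma expectation_block_sum: "expectation (block_sum b l) = expectation (block_sum b 0)"
  using block_sum_moments[of "\<lambda>x. x" b l] by simp

lemma centered_blocks_measurable [measurable]: "random_variable borel (centered_blocks b q)"
  unfolding centered_blocks_def by measurable

lemma expectation_block_sum_bounds: "0 \<le> expectation (block_sum b l)" "expectation (block_sum b l) \<le> real b"
  using block_sum_bounds block_sum_integrable by (auto intro!: integral_nonneg_AE integral_le_const)

lemma centered_block_bound: "\<bar>block_sum b l \<omega> - expectation (block_sum b 0)\<bar> \<le> real b"
  using block_sum_bounds[of b l \<omega>] expectation_block_sum_bounds[of b 0] by (simp add: abs_le_iff)

lemma centered_blocks_bound: "\<bar>centered_blocks b q \<omega>\<bar> \<le> real q * real b"
  unfolding centered_blocks_def
  using sum_bounded_above[of "{..<q}" "\<lambda>l. \<bar>block_sum b l \<omega> - expectation (block_sum b 0)\<bar>" "real b"]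
    centered_block_bound by (intro order_trans[OF sum_abs]) auto

lemma centered_blocks_second_moment:
  "expectation (\<lambda>\<omega>. (centered_blocks b q \<omega>)\<^sup>2) = real q * block_var b"
proof -
  have cov0: "covariance (block_sum b i) (block_sum b (i + Suc m)) = 0" for i m
    using indep_vars_expectation_mult[OF indep_block_sums, of i "i + Suc m" b] block_sum_integrable
    by (simp add: covariance_def)
  have "expectation (\<lambda>\<omega>. (centered_blocks b q \<omega>)\<^sup>2) = variance (\<lambda>\<omega>. \<Sum>l<q. block_sum b l \<omega>)"
  proof -
    have "expectation (\<lambda>\<omega>. \<Sum>l<q. block_sum b l \<omega>) = (\<Sum>l<q. expectation (block_sum b l))"
      by (rule Bochner_Integration.integral_sum[OF block_sum_integrable])
    also have "\<dots> = (\<Sum>l<q. expectation (block_sum b 0))"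
      by (intro sum.cong refl expectation_block_sum)
    finally show ?thesis by (simp add: centered_blocks_def sum_subtractf)
  qed
  also have "\<dots> = (\<Sum>i<q. covariance (block_sum b i) (block_sum b i))"
    using variance_of_sum[of "block_sum b", OF _ block_sum_bounds(3)] cov0 by simp
  also have "\<dots> = (\<Sum>i<q. block_var b)"
  proof (rule sum.cong[OF refl])
    fix i
    have "covariance (block_sum b i) (block_sum b i) = variance (block_sum b i)"
      using expectation_centered_mult[of "block_sum b i" "block_sum b i", OF _ _ block_sum_bounds(3) block_sum_bounds(3)]
      by (simp add: power2_eq_square)
    also have "\<dots> = block_var b"
      unfolding expectation_block_sum[of b i] by (rule block_sum_moments) measurable
    finally show "covariance (block_sum b i) (block_sum b i) = block_var b" .
  qed
  finally show ?thesis by simp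
qed

lemma block_var_nonneg: "0 \<le> block_var b"
  by (rule variance_positive)

text \<open>The classical theorem requires a positive variance. If the variance is 0, the centered
  sum vanishes in mean and the characteristic function is 1, in agreement with the formula.\<close>

lemma char_centered_blocks_tendsto:
  assumes b: "b \<ge> 1"
  shows "(\<lambda>q. char (distr M borel (\<lambda>\<omega>. centered_blocks b q \<omega> / sqrt (real q * real b))) t)
    \<longlonglongrightarrow> complex_of_real (exp (- (t\<^sup>2 * (block_var b / real b)) / 2))"
proof (cases "block_var b = 0")
  case True
  have "char (distr M borel (\<lambda>\<omega>. centered_blocks b q \<omega> / sqrt (real q * real b))) t = 1" for q
  proof -
    have i: "integrable M (centered_blocks b q)"
      by (rule bounded_integrable[OF _ centered_blocks_bound]) measurable
    have "expectation (\<lambda>\<omega>. \<bar>centered_blocks b q \<omega>\<bar>) \<le> sqrt (expectation (\<lambda>\<omega>. (centered_blocks b q \<omega>)\<^sup>2))"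
      by (rule expectation_abs_le_sqrt[OF _ centered_blocks_bound]) measurable
    then have le0: "expectation (\<lambda>\<omega>. \<bar>centered_blocks b q \<omega>\<bar>) \<le> 0"
      unfolding centered_blocks_second_moment True by simp
    have "cmod (char (distr M borel (\<lambda>\<omega>. centered_blocks b q \<omega> / sqrt (real q * real b))) t
        - char (distr M borel (\<lambda>\<omega>. 0)) t)
      \<le> \<bar>t\<bar> * expectation (\<lambda>\<omega>. \<bar>centered_blocks b q \<omega> / sqrt (real q * real b) - 0\<bar>)"
      by (rule char_distr_diff_le) (use i in auto)
    also have "\<dots> = \<bar>t\<bar> * (expectation (\<lambda>\<omega>. \<bar>centered_blocks b q \<omega>\<bar>) / sqrt (real q * real b))"
      by simp
    also have "\<dots> \<le> 0"
      using le0 by (intro mult_nonneg_nonpos divide_nonpos_nonneg) auto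
    finally have "char (distr M borel (\<lambda>\<omega>. centered_blocks b q \<omega> / sqrt (real q * real b))) t
        = char (distr M borel (\<lambda>\<omega>. 0)) t" by simp
    also have "\<dots> = 1" by (simp add: char_def integral_distr prob_space del: distr_const)
    finally show ?thesis .
  qed
  then show ?thesis unfolding True by simp
next
  case False
  define v where "v = block_var b"
  have v: "v > 0" using False block_var_nonneg[of b] unfolding v_def by linarith
  define Z where "Z l \<omega> = block_sum b l \<omega> - expectation (block_sum b 0)" for l \<omega>
  have Zb: "\<bar>Z l \<omega>\<bar> \<le> real b" for l \<omega> unfolding Z_def by (rule centered_block_bound)
  have Zm [measurable]: "random_variable borel (Z l)" for l unfolding Z_def by measurable
  have EZ: "expectation (Z l) = 0" for l
    unfolding Z_def using block_sum_integrable by (simp add: prob_space expectation_block_sum[of b l])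
  have wc: "weak_conv_m (\<lambda>q. distr M borel (\<lambda>\<omega>. (\<Sum>l<q. Z l \<omega>) / sqrt (real q * (sqrt v)\<^sup>2))) std_normal_distribution"
  proof (rule central_limit_theorem_zero_mean[where \<mu>="distr M borel (Z 0)"])
    show "indep_vars (\<lambda>_. borel) Z UNIV"
      unfolding Z_def[abs_def] by (rule indep_vars_compose2[OF indep_block_sums]) measurable
    show "integrable M (\<lambda>x. (Z n x)\<^sup>2)" for n
      using bounded_mult_integrable[OF Zm Zm Zb Zb, of n n] by (simp add: power2_eq_square)
    have "variance (Z n) = expectation (\<lambda>\<omega>. (block_sum b n \<omega> - expectation (block_sum b 0))\<^sup>2)" for n
      unfolding EZ by (simp add: Z_def)
    also have "\<dots> n = v" for n
      unfolding v_def by (rule block_sum_moments) measurable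
    finally show "variance (Z n) = (sqrt v)\<^sup>2" for n using v by simp
    show "distr M borel (Z n) = distr M borel (Z 0)" for n
    proof -
      have "distr M borel (Z n) = distr (distr M borel (block_sum b n)) borel (\<lambda>x. x - expectation (block_sum b 0))" for n
        by (subst distr_distr) (auto simp: comp_def Z_def[abs_def])
      then show ?thesis by (simp add: block_sum_law[of b n])
    qed
  qed (use v EZ in auto)
  \<comment> \<open>Evaluation at \<open>t * sqrt (v / b)\<close> exchanges the norming by
    \<open>sqrt (q * v)\<close> for one by \<open>sqrt (q * b)\<close>.\<close>
  have "(\<lambda>q. char (distr M borel (\<lambda>\<omega>. (\<Sum>l<q. Z l \<omega>) / sqrt (real q * (sqrt v)\<^sup>2))) (t * sqrt (v / real b)))
      \<longlonglongrightarrow> char std_normal_distribution (t * sqrt (v / real b))"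
    by (rule levy_continuity1[OF _ real_dist_normal_dist wc]) (intro real_distribution_distr, measurable)
  also have "char std_normal_distribution (t * sqrt (v / real b)) = complex_of_real (exp (- (t\<^sup>2 * (v / real b)) / 2))"
    using v by (simp add: char_std_normal_distribution power_mult_distrib)
  also have "(\<lambda>q. char (distr M borel (\<lambda>\<omega>. (\<Sum>l<q. Z l \<omega>) / sqrt (real q * (sqrt v)\<^sup>2))) (t * sqrt (v / real b)))
     = (\<lambda>q. char (distr M borel (\<lambda>\<omega>. centered_blocks b q \<omega> / sqrt (real q * real b))) t)"
  proof
    fix q
    have "t * sqrt (v / real b) * ((\<Sum>l<q. Z l \<omega>) / sqrt (real q * (sqrt v)\<^sup>2))
        = t * (centered_blocks b q \<omega> / sqrt (real q * real b))" for \<omega>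
      using v b by (simp add: real_sqrt_mult real_sqrt_divide Z_def centered_blocks_def)
    then show "char (distr M borel (\<lambda>\<omega>. (\<Sum>l<q. Z l \<omega>) / sqrt (real q * (sqrt v)\<^sup>2))) (t * sqrt (v / real b))
       = char (distr M borel (\<lambda>\<omega>. centered_blocks b q \<omega> / sqrt (real q * real b))) t"
      by (subst (1 2) char_distr) (simp_all only: borel_measurable_divide borel_measurable_sum
          borel_measurable_const Zm centered_blocks_measurable)
  qed
  finally show ?thesis by (simp add: v_def)
qed

end

section \<open>The central limit theorem for records\<close>

lemma real_distribution_centered_gaussian:
  assumes "v \<ge> 0"
  shows "real_distribution (centered_gaussian v)"
proof (cases "v = 0")
  case True
  then show ?thesis
    by (simp add: centered_gaussian_def real_distribution_def real_distribution_axioms_def prob_space_return)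
next
  case False
  then show ?thesis using assms
    by (simp add: centered_gaussian_def real_distribution_def real_distribution_axioms_def prob_space_normal_density)
qed

lemma char_centered_gaussian:
  assumes "v \<ge> 0"
  shows "char (centered_gaussian v) t = complex_of_real (exp (- (t\<^sup>2 * v) / 2))"
proof (cases "v = 0")
  case True
  have "char (return borel 0) t = 1"
    unfolding char_def by (subst integral_return) auto
  then show ?thesis using True by (simp add: centered_gaussian_def)
next
  case False
  define s where "s = sqrt v"
  have s: "s > 0" "s\<^sup>2 = v" using False assms by (auto simp: s_def)
  define G where "G = density lborel (\<lambda>x. ennreal (normal_density 0 s x))"
  interpret G: prob_space G unfolding G_def using s by (intro prob_space_normal_density)
  have "distributed G lborel (\<lambda>x. x) (normal_density 0 s)"
    unfolding distributed_def G_def by (auto simp: distr_id2)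
  then have "distributed G lborel (\<lambda>x. x / s) std_normal_density"
    using G.normal_standard_normal_convert[OF s(1), of "\<lambda>x. x" 0] by simp
  then have d: "distr G lborel (\<lambda>x. x / s) = std_normal_distribution"
    by (simp add: distributed_def)
  have sG [measurable_cong, simp]: "sets G = sets borel" by (simp add: G_def)
  have "char G t = (CLINT x|G. iexp (t * s * (x / s)))"
    unfolding char_def using s by simp
  also have "\<dots> = (CLINT y|distr G lborel (\<lambda>x. x / s). iexp (t * s * y))"
    by (rule integral_distr[symmetric]) measurable
  also have "\<dots> = char std_normal_distribution (t * s)"
    unfolding d char_def by simp
  also have "\<dots> = complex_of_real (exp (- (t\<^sup>2 * v) / 2))"
    using s by (simp add: char_std_normal_distribution power_mult_distrib)
  finally show ?thesis using False by (simp add: centered_gaussian_def G_def s_def)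
qed

context iid_drift
begin

lemma R_square: "R a j \<omega> * R a j \<omega> = R a j \<omega>"
  by (simp add: R_def)

lemma covariance_R_self: "covariance (R a j) (R a j) = expectation (R a j) - (expectation (R a j))\<^sup>2"
  by (simp add: covariance_def R_square power2_eq_square)

context
  fixes p :: real
  assumes P_lim: "P \<longlonglongrightarrow> p" and rate: "summable (\<lambda>k. P k - p)"
begin

abbreviation eps :: "nat \<Rightarrow> real" where "eps k \<equiv> P k - p"

lemma eps_nonneg: "0 \<le> eps k"
  using decseq_ge[OF decseq_P P_lim, of k] by simp

lemma p_bounds: "0 \<le> p" "p \<le> 1"
  using LIMSEQ_le_const[OF P_lim, of 0] P_nonneg eps_nonneg[of 0] P_0 by auto

text \<open>The bound is uniform in \<open>i\<close>, which makes \<open>eps\<close> a dominating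
  sequence for every row of covariances.\<close>

lemma covariance_record_le: "\<bar>covariance (R 0 i) (R 0 (i + Suc m))\<bar> \<le> eps m"
  using covariance_R_overlap[of 0 i "i + Suc m" 0] eps_nonneg[of "i + Suc m"] by simp

text \<open>Row \<open>i\<close> of the variance, extended to an infinite series, converges by
  Tannery's theorem with dominating sequence \<open>eps\<close>, hence so do the averages of the
  rows. Cutting row \<open>i\<close> at \<open>n - Suc i\<close> costs at most a constant times a
  tail of \<open>eps\<close>, and the averages of these tails vanish.\<close>

lemma variance_records_tendsto:
  assumes q: "\<And>m. (\<lambda>i. expectation (\<lambda>\<omega>. R 0 i \<omega> * R 0 (i + Suc m) \<omega>)) \<longlonglongrightarrow> q m"
  shows "summable (\<lambda>m. q m - p\<^sup>2)"
    and "(\<lambda>n. variance (\<lambda>\<omega>. \<Sum>j<n. R 0 j \<omega>) / real n) \<longlonglongrightarrow> p - p\<^sup>2 + 2 * (\<Sum>m. q m - p\<^sup>2)"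
proof -
  define C where "C m i = covariance (R 0 i) (R 0 (i + Suc m))" for m i
  have C_le: "\<bar>C m i\<bar> \<le> eps m" for m i unfolding C_def by (rule covariance_record_le)
  have C_sum: "summable (\<lambda>m. C m i)" for i
    by (rule summable_comparison_test'[OF rate, of 0]) (use C_le in auto)
  have C_lim: "C m \<longlonglongrightarrow> q m - p\<^sup>2" for m
  proof -
    have "(\<lambda>i. P (i + Suc m)) \<longlonglongrightarrow> p" using P_lim by (rule LIMSEQ_ignore_initial_segment)
    then have "(\<lambda>i. expectation (\<lambda>\<omega>. R 0 i \<omega> * R 0 (i + Suc m) \<omega>) - P i * P (i + Suc m)) \<longlonglongrightarrow> q m - p * p"
      by (intro tendsto_diff tendsto_mult q P_lim)
    then show ?thesis
      by (simp add: C_def[abs_def] covariance_def expectation_R power2_eq_square)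
  qed
  have tann: "summable (\<lambda>m. norm (q m - p\<^sup>2)) \<and> ((\<lambda>i. \<Sum>m. C m i) \<longlongrightarrow> (\<Sum>m. q m - p\<^sup>2)) sequentially"
    using tannerys_theorem[of C "\<lambda>m. q m - p\<^sup>2" sequentially "\<lambda>m. eps m", OF C_lim _ rate] C_le
    by (auto intro!: always_eventually)
  then show "summable (\<lambda>m. q m - p\<^sup>2)" by (auto intro: summable_norm_cancel)
  define tail where "tail k = (\<Sum>m. eps (m + k))" for k
  have tail_sum: "summable (\<lambda>m. eps (m + k))" for k
    using rate by (subst summable_iff_shift)
  have tail_lim: "tail \<longlonglongrightarrow> 0"
    unfolding tail_def using suminf_exist_split2[OF rate] by simp
  have rem: "\<bar>(\<Sum>m. C m i) - (\<Sum>m<k. C m i)\<bar> \<le> tail k" for i k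
  proof -
    have "(\<Sum>m. C m i) - (\<Sum>m<k. C m i) = (\<Sum>m. C (m + k) i)"
      using suminf_split_initial_segment[OF C_sum, of i k] by simp
    also have "\<bar>\<dots>\<bar> \<le> tail k"
      unfolding tail_def real_norm_def[symmetric]
      by (rule norm_suminf_le[OF _ tail_sum]) (use C_le in auto)
    finally show ?thesis .
  qed
  define G where "G i = (P i - (P i)\<^sup>2) + 2 * (\<Sum>m. C m i)" for i
  define B where "B n = (\<Sum>i<n. (P i - (P i)\<^sup>2) + 2 * (\<Sum>m<n - Suc i. C m i))" for n
  have var_eq: "variance (\<lambda>\<omega>. \<Sum>j<n. R 0 j \<omega>) = B n" for n
  proof -
    have "variance (\<lambda>\<omega>. \<Sum>j<n. R 0 j \<omega>) = (\<Sum>i<n. covariance (R 0 i) (R 0 i)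
        + 2 * (\<Sum>m<n - Suc i. covariance (R 0 i) (R 0 (i + Suc m))))"
      by (rule variance_of_sum[OF _ R_bounds(3)]) measurable
    then show ?thesis by (simp add: B_def C_def covariance_R_self expectation_R)
  qed
  have "G \<longlonglongrightarrow> p - p\<^sup>2 + 2 * (\<Sum>m. q m - p\<^sup>2)"
    unfolding G_def by (intro tendsto_intros P_lim) (use tann in auto)
  note G_lim = cesaro_mean[OF this]
  have diff: "\<bar>B n / real n - (\<Sum>i<n. G i) / real n\<bar> \<le> 2 * ((\<Sum>i<n. tail i) / real n)" for n
  proof -
    have "\<bar>B n - (\<Sum>i<n. G i)\<bar> \<le> (\<Sum>i<n. \<bar>2 * ((\<Sum>m<n - Suc i. C m i) - (\<Sum>m. C m i))\<bar>)"
      unfolding B_def G_def sum_subtractf[symmetric] by (rule order_trans[OF sum_abs]) (simp add: algebra_simps)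
    also have "\<dots> \<le> (\<Sum>i<n. 2 * tail (n - Suc i))"
    proof (rule sum_mono)
      have aux: "\<bar>2 * (x - y)\<bar> \<le> 2 * z" if "\<bar>y - x\<bar> \<le> z" for x y z :: real
        using that unfolding abs_le_iff by (simp add: algebra_simps)
      show "\<bar>2 * ((\<Sum>m<n - Suc i. C m i) - (\<Sum>m. C m i))\<bar> \<le> 2 * tail (n - Suc i)" for i
        by (rule aux[OF rem])
    qed
    \<comment> \<open>Reversing the order of the rows turns the cut-off points into 0, ..., n - 1,
      so that plain averages of a null sequence appear.\<close>
    also have "\<dots> = 2 * (\<Sum>i<n. tail i)"
      by (simp add: sum_distrib_left[symmetric] sum.nat_diff_reindex[of tail n])
    finally show ?thesis
      by (simp add: diff_divide_distrib[symmetric] divide_right_mono)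
  qed
  have "(\<lambda>n. 2 * ((\<Sum>i<n. tail i) / real n)) \<longlonglongrightarrow> 2 * 0"
    by (intro tendsto_intros cesaro_mean tail_lim)
  then have "(\<lambda>n. 2 * ((\<Sum>i<n. tail i) / real n)) \<longlonglongrightarrow> 0" by simp
  then have "(\<lambda>n. B n / real n - (\<Sum>i<n. G i) / real n) \<longlonglongrightarrow> 0"
    by (rule Lim_null_comparison[rotated]) (use diff in \<open>simp only: real_norm_def eventually_True\<close>)
  from tendsto_add[OF this G_lim]
  show "(\<lambda>n. variance (\<lambda>\<omega>. \<Sum>j<n. R 0 j \<omega>) / real n) \<longlonglongrightarrow> p - p\<^sup>2 + 2 * (\<Sum>m. q m - p\<^sup>2)"
    unfolding var_eq by simp
qed

section \<open>Second moment of the error made by restarting the records in blocks\<close>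

text \<open>\<open>b * (j div b)\<close> is the start of the block containing \<open>j\<close>; the
  value 1 means that \<open>j\<close> is a record within its block only.\<close>

definition surplus :: "nat \<Rightarrow> nat \<Rightarrow> 'a \<Rightarrow> real" where
  "surplus b j \<omega> = R (b * (j div b)) j \<omega> - R 0 j \<omega>"

lemma surplus_measurable [measurable]: "random_variable borel (surplus b j)"
  unfolding surplus_def by measurable

lemma surplus_bounds: "0 \<le> surplus b j \<omega>" "surplus b j \<omega> \<le> 1" "\<bar>surplus b j \<omega>\<bar> \<le> 1"
  using R_mono[of 0 "b * (j div b)" j \<omega>] R_bounds[of 0 j \<omega>] R_bounds[of "b * (j div b)" j \<omega>]
  by (auto simp: surplus_def)

lemma expectation_surplus: "expectation (surplus b j) = P (j mod b) - P j"
proof -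
  have "expectation (surplus b j) = expectation (R (b * (j div b)) j) - expectation (R 0 j)"
    unfolding surplus_def by simp
  moreover have "expectation (R (b * (j div b)) j) = P (j mod b)"
    by (subst expectation_R) (auto simp: minus_mult_div_eq_mod)
  ultimately show ?thesis by (simp add: expectation_R)
qed

text \<open>Bounds the row of the variance that belongs to a surplus at position \<open>r\<close> of
  its block. Of the two bounds for a covariance, \<open>eps r\<close> does not decay in the lag and
  \<open>eps m\<close> does not vanish as \<open>r\<close> grows; their minimum has both
  properties.\<close>

definition surplus_weight :: "nat \<Rightarrow> real" where
  "surplus_weight r = eps r + 2 * (\<Sum>m. min (eps r) (eps m))"

lemma min_eps_summable: "summable (\<lambda>m. min (eps r) (eps m))"
  by (rule summable_comparison_test'[OF rate, of 0]) (use eps_nonneg in auto)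

lemma surplus_weight_nonneg: "0 \<le> surplus_weight r"
  unfolding surplus_weight_def
  by (intro add_nonneg_nonneg mult_nonneg_nonneg suminf_nonneg min_eps_summable) (use eps_nonneg in auto)

lemma surplus_weight_tendsto: "surplus_weight \<longlonglongrightarrow> 0"
proof -
  have e: "eps \<longlonglongrightarrow> 0" using rate by (rule summable_LIMSEQ_zero)
  have "(\<lambda>r. min (eps r) (eps m)) \<longlonglongrightarrow> min 0 (eps m)" for m
    by (intro tendsto_min e tendsto_const)
  moreover have "min 0 (eps m) = 0" for m using eps_nonneg[of m] by (simp add: min_def)
  ultimately have "(\<lambda>r. min (eps r) (eps m)) \<longlonglongrightarrow> 0" for m by metis
  from tannerys_theorem[of "\<lambda>m r. min (eps r) (eps m)" "\<lambda>_. 0" sequentially eps, OF this _ rate]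
  have "(\<lambda>r. \<Sum>m. min (eps r) (eps m)) \<longlonglongrightarrow> 0"
    using eps_nonneg by (auto intro!: always_eventually)
  from tendsto_add[OF e tendsto_mult[OF tendsto_const this, of 2]] show ?thesis
    by (simp add: surplus_weight_def[abs_def])
qed

text \<open>The bound \<open>eps (i mod b)\<close> comes from the mean of the earlier surplus. For
  \<open>eps m\<close>, either both indices share a block and the later one lies deep inside it, or
  the block of the later one starts after \<open>i\<close> and its restarted indicator is
  uncorrelated with the earlier surplus.\<close>

lemma covariance_surplus_le:
  assumes b: "b \<ge> 1"
  shows "\<bar>covariance (surplus b i) (surplus b (i + Suc m))\<bar> \<le> min (eps (i mod b)) (eps m)"
proof -
  define j where "j = i + Suc m"
  have ij: "Suc i \<le> j" by (simp add: j_def)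
  have le1: "\<bar>covariance (surplus b i) (surplus b j)\<bar> \<le> expectation (surplus b i)"
    and le2: "\<bar>covariance (surplus b i) (surplus b j)\<bar> \<le> expectation (surplus b j)"
    by (rule covariance_abs_le; simp add: surplus_bounds)+
  have "expectation (surplus b i) \<le> eps (i mod b)"
    using eps_nonneg[of i] by (simp add: expectation_surplus)
  moreover have "\<bar>covariance (surplus b i) (surplus b j)\<bar> \<le> eps m"
  proof (cases "b * (j div b) \<le> i")
    case True
    \<comment> \<open>The block of \<open>j\<close> already contains \<open>i\<close>, so more than
      \<open>m\<close> members of the block precede \<open>j\<close>.\<close>
    have "j mod b = j - b * (j div b)" by (simp add: minus_mult_div_eq_mod)
    then have "m \<le> j mod b" using True by (simp add: j_def)
    then have "P (j mod b) \<le> P m" by (rule P_antimono)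
    then show ?thesis using le2 eps_nonneg[of j] by (simp add: expectation_surplus)
  next
    case False
    \<comment> \<open>An indicator whose window starts after \<open>i\<close> has covariance 0 with
      \<open>surplus b i\<close>. Hence the restarted indicator may be exchanged for
      \<open>R (Suc i) j\<close>, which turns \<open>surplus b j\<close> into \<open>T\<close>,
      whose mean is governed by the lag.\<close>
    define T where "T \<omega> = R (Suc i) j \<omega> - R 0 j \<omega>" for \<omega>
    have [measurable]: "random_variable borel T" unfolding T_def by measurable
    have T: "0 \<le> T \<omega>" "T \<omega> \<le> 1" for \<omega>
      using R_mono[of 0 "Suc i" j \<omega>] R_bounds[of "Suc i" j \<omega>] R_bounds[of 0 j \<omega>] by (auto simp: T_def)
    have zero: "covariance (surplus b i) (R a j) = 0" if "i < a" "a \<le> j" for a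
    proof -
      have "covariance (surplus b i) (R a j) = covariance (R a j) (\<lambda>\<omega>. R (b * (i div b)) i \<omega> - R 0 i \<omega>)"
        by (subst covariance_commute) (simp add: surplus_def[abs_def])
      also have "\<dots> = covariance (R a j) (R (b * (i div b)) i) - covariance (R a j) (R 0 i)"
        by (rule covariance_diff_right[OF _ _ _ R_bounds(3) R_bounds(3) R_bounds(3)]) measurable
      also have "\<dots> = 0"
        unfolding covariance_commute[of "R a j"] using that by (simp add: covariance_R_disjoint)
      finally show ?thesis .
    qed
    have "covariance (surplus b i) (surplus b j) = - covariance (surplus b i) (R 0 j)"
      unfolding surplus_def[of b j, abs_def] using False
      by (subst covariance_diff_right[OF _ _ _ surplus_bounds(3) R_bounds(3) R_bounds(3)]) (simp_all add: zero)
    moreover have "covariance (surplus b i) T = - covariance (surplus b i) (R 0 j)"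
      unfolding T_def[abs_def]
      by (subst covariance_diff_right[OF _ _ _ surplus_bounds(3) R_bounds(3) R_bounds(3)]) (use ij in \<open>simp_all add: zero\<close>)
    ultimately have "\<bar>covariance (surplus b i) (surplus b j)\<bar> = \<bar>covariance (surplus b i) T\<bar>" by simp
    also have "\<dots> \<le> expectation T" by (rule covariance_abs_le(2)) (auto simp: surplus_bounds T)
    also have "\<dots> = P m - P j" unfolding T_def by (simp add: expectation_R j_def)
    also have "\<dots> \<le> eps m" using eps_nonneg[of j] by simp
    finally show ?thesis .
  qed
  ultimately show ?thesis using le1 by (simp add: j_def)
qed

lemma variance_surplus_le:
  assumes b: "b \<ge> 1"
  shows "variance (\<lambda>\<omega>. \<Sum>j<b * q. surplus b j \<omega>) \<le> real q * (\<Sum>r<b. surplus_weight r)"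
proof -
  have "variance (\<lambda>\<omega>. \<Sum>j<b * q. surplus b j \<omega>) = (\<Sum>i<b * q. covariance (surplus b i) (surplus b i)
      + 2 * (\<Sum>m<b * q - Suc i. covariance (surplus b i) (surplus b (i + Suc m))))"
    by (rule variance_of_sum[OF _ surplus_bounds(3)]) measurable
  also have "\<dots> \<le> (\<Sum>i<b * q. surplus_weight (i mod b))"
  proof (rule sum_mono)
    fix i
    have "\<bar>covariance (surplus b i) (surplus b i)\<bar> \<le> expectation (surplus b i)"
      by (rule covariance_abs_le) (auto simp: surplus_bounds)
    also have "\<dots> \<le> eps (i mod b)" using eps_nonneg[of i] by (simp add: expectation_surplus)
    finally have "covariance (surplus b i) (surplus b i) \<le> eps (i mod b)" by simp
    moreover have "(\<Sum>m<k. covariance (surplus b i) (surplus b (i + Suc m))) \<le> (\<Sum>m. min (eps (i mod b)) (eps m))" for k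
    proof -
      have "(\<Sum>m<k. covariance (surplus b i) (surplus b (i + Suc m))) \<le> (\<Sum>m<k. min (eps (i mod b)) (eps m))"
        using covariance_surplus_le[OF b, of i] by (intro sum_mono) (meson abs_le_D1)
      also have "\<dots> \<le> (\<Sum>m. min (eps (i mod b)) (eps m))"
        using eps_nonneg by (intro sum_le_suminf min_eps_summable) auto
      finally show ?thesis .
    qed
    ultimately show "covariance (surplus b i) (surplus b i)
        + 2 * (\<Sum>m<b * q - Suc i. covariance (surplus b i) (surplus b (i + Suc m))) \<le> surplus_weight (i mod b)"
      unfolding surplus_weight_def by (intro add_mono mult_left_mono) auto
  qed
  also have "\<dots> = real q * (\<Sum>r<b. surplus_weight r)"
    unfolding sum_blocks using b by simp
  finally show ?thesis .
qed

text \<open>The terms are the independent blocks, the incomplete last block, the deterministic bias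
  of the means \<open>P j\<close> against \<open>p\<close>, and the centered surplus. After division
  by \<open>sqrt n\<close> only the first and the last can stay of order one for fixed
  \<open>b\<close>.\<close>

lemma records_block_decomposition:
  fixes q b n :: nat
  assumes b: "b \<ge> 1" and n: "b * q \<le> n"
  shows "(\<Sum>j<n. R 0 j \<omega>) - real n * p = centered_blocks b q \<omega> + (\<Sum>j=b * q..<n. R 0 j \<omega> - p) + (\<Sum>j<b * q. eps j)
    - ((\<Sum>j<b * q. surplus b j \<omega>) - expectation (\<lambda>\<omega>. \<Sum>j<b * q. surplus b j \<omega>))"
proof -
  have blocks: "(\<Sum>l<q. block_sum b l \<omega>) = (\<Sum>j<b * q. R (b * (j div b)) j \<omega>)" for \<omega>
    unfolding sum_blocks block_sum_def using b by (intro sum.cong) auto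
  have s: "(\<Sum>j<b * q. surplus b j \<omega>) = (\<Sum>l<q. block_sum b l \<omega>) - (\<Sum>j<b * q. R 0 j \<omega>)" for \<omega>
    by (simp add: surplus_def sum_subtractf blocks)
  have "expectation (\<lambda>\<omega>. \<Sum>l<q. block_sum b l \<omega>) = (\<Sum>l<q. expectation (block_sum b l))"
    by (rule Bochner_Integration.integral_sum[OF block_sum_integrable])
  also have "\<dots> = (\<Sum>l<q. expectation (block_sum b 0))"
    by (intro sum.cong refl expectation_block_sum)
  finally have Eb: "expectation (\<lambda>\<omega>. \<Sum>l<q. block_sum b l \<omega>) = real q * expectation (block_sum b 0)" by simp
  have E: "expectation (\<lambda>\<omega>. \<Sum>j<b * q. surplus b j \<omega>) = real q * expectation (block_sum b 0) - (\<Sum>j<b * q. P j)"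
    unfolding s using block_sum_integrable by (subst Bochner_Integration.integral_diff) (auto simp: Eb expectation_R)
  have split: "(\<Sum>j<n. R 0 j \<omega>) = (\<Sum>j<b * q. R 0 j \<omega>) + (\<Sum>j=b * q..<n. R 0 j \<omega>)"
    unfolding lessThan_atLeast0 using n by (intro sum.atLeastLessThan_concat[symmetric]) auto
  show ?thesis
    unfolding E unfolding s split centered_blocks_def using n
    by (simp add: sum_subtractf of_nat_diff algebra_simps)
qed

text \<open>The first term is due to the surplus; it is free of \<open>n\<close>, and averaging
  \<open>surplus_weight\<close> makes it small for large \<open>b\<close>. The rest collects the
  incomplete block, the bias and the change of norming, and vanishes for each fixed \<open>b\<close>
  as \<open>n\<close> grows.\<close>

lemma expectation_block_error_le:
  assumes b: "b \<ge> 1" and n: "n \<ge> b" and q: "q = n div b"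
  shows "expectation (\<lambda>\<omega>. \<bar>((\<Sum>j<n. R 0 j \<omega>) - real n * p) / sqrt (real n) - centered_blocks b q \<omega> / sqrt (real q * real b)\<bar>)
    \<le> sqrt ((\<Sum>r<b. surplus_weight r) / real b)
      + ((real b + (\<Sum>k. eps k)) / sqrt (real n) + sqrt (block_var b / real b) * (real b / real n))"
proof -
  define H where "H = (\<Sum>r<b. surplus_weight r) / real b"
  have H0: "0 \<le> H" unfolding H_def using surplus_weight_nonneg by (intro divide_nonneg_nonneg sum_nonneg) auto
  define N where "N = real n"
  define Q where "Q = real q * real b"
  have bq: "b * q \<le> n" "n < b * q + b"
  proof -
    have "b * q + n mod b = n" "n mod b < b" using b q by simp_all
    then show "b * q \<le> n" "n < b * q + b" by linarith+
  qed
  have q1: "q \<ge> 1" using n b q by (simp add: div_greater_zero_iff Suc_leI)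
  have N: "N > 0" using n b by (simp add: N_def)
  have Q: "Q > 0" using q1 b by (simp add: Q_def)
  have QN: "Q \<le> N" "N \<le> Q + real b"
  proof -
    have "real (b * q) \<le> real n" "real n \<le> real (b * q + b)" using bq by (simp_all only: of_nat_le_iff)
    then show "Q \<le> N" "N \<le> Q + real b" by (simp_all add: Q_def N_def mult.commute)
  qed
  define D where "D \<omega> = (\<Sum>j<b * q. surplus b j \<omega>) - expectation (\<lambda>\<omega>. \<Sum>j<b * q. surplus b j \<omega>)" for \<omega>
  have [measurable]: "random_variable borel D" unfolding D_def by measurable
  have D_bound: "\<bar>D \<omega>\<bar> \<le> real (b * q) + \<bar>expectation (\<lambda>\<omega>. \<Sum>j<b * q. surplus b j \<omega>)\<bar>" for \<omega>
  proof -
    have "\<bar>\<Sum>j<b * q. surplus b j \<omega>\<bar> \<le> (\<Sum>j<b * q. 1)"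
      by (rule order_trans[OF sum_abs], intro sum_mono surplus_bounds)
    then show ?thesis unfolding D_def by (simp add: order_trans[OF abs_triangle_ineq4])
  qed
  have D_int: "integrable M D" by (rule bounded_integrable[OF _ D_bound]) measurable
  have A_int: "integrable M (centered_blocks b q)" by (rule bounded_integrable[OF _ centered_blocks_bound]) measurable
  have ED: "expectation (\<lambda>\<omega>. \<bar>D \<omega>\<bar>) \<le> sqrt N * sqrt H"
  proof -
    have "expectation (\<lambda>\<omega>. \<bar>D \<omega>\<bar>) \<le> sqrt (expectation (\<lambda>\<omega>. (D \<omega>)\<^sup>2))"
      by (rule expectation_abs_le_sqrt[OF _ D_bound]) measurable
    also have "expectation (\<lambda>\<omega>. (D \<omega>)\<^sup>2) \<le> real q * (\<Sum>r<b. surplus_weight r)"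
      unfolding D_def by (rule variance_surplus_le[OF b])
    also have "\<dots> = Q * H" using b by (simp add: H_def Q_def)
    also have "\<dots> \<le> N * H" using QN H0 by (intro mult_right_mono) auto
    finally show ?thesis by (simp add: real_sqrt_mult)
  qed
  have EA: "expectation (\<lambda>\<omega>. \<bar>centered_blocks b q \<omega>\<bar>) \<le> sqrt Q * sqrt (block_var b / real b)"
  proof -
    have "expectation (\<lambda>\<omega>. \<bar>centered_blocks b q \<omega>\<bar>) \<le> sqrt (expectation (\<lambda>\<omega>. (centered_blocks b q \<omega>)\<^sup>2))"
      by (rule expectation_abs_le_sqrt[OF _ centered_blocks_bound]) measurable
    also have "\<dots> = sqrt (Q * (block_var b / real b))"
      unfolding centered_blocks_second_moment using b by (simp add: Q_def)
    finally show ?thesis by (simp only: real_sqrt_mult)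
  qed
  \<comment> \<open>The discrepancy between norming by the length \<open>b * q\<close> of the full
    blocks and by \<open>n\<close>. Since \<open>sqrt x \<ge> x\<close> on [0, 1],
    \<open>sqrt Q * \<kappa>\<close> is at most \<open>1 - Q / N\<close>.\<close>
  define \<kappa> where "\<kappa> = 1 / sqrt Q - 1 / sqrt N"
  have \<kappa>0: "0 \<le> \<kappa>" unfolding \<kappa>_def using Q QN by (simp add: frac_le)
  have \<kappa>_le: "sqrt Q * \<kappa> \<le> real b / N"
  proof -
    have w: "0 \<le> Q / N" "Q / N \<le> 1" using Q N QN by auto
    have "Q / N \<le> sqrt (Q / N)"
      by (rule real_le_rsqrt) (simp only: power2_eq_square mult_left_le_one_le[OF w(1) w(1) w(2)])
    moreover have "sqrt Q * \<kappa> = 1 - sqrt (Q / N)"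
      using Q N by (simp add: \<kappa>_def right_diff_distrib real_sqrt_divide)
    moreover have "1 - Q / N \<le> real b / N"
    proof -
      have "(N - Q) / N \<le> real b / N" using QN N by (intro divide_right_mono) auto
      then show ?thesis using N by (simp add: diff_divide_distrib)
    qed
    ultimately show ?thesis by linarith
  qed
  have pointwise: "\<bar>((\<Sum>j<n. R 0 j \<omega>) - real n * p) / sqrt N - centered_blocks b q \<omega> / sqrt Q\<bar>
      \<le> (real b + (\<Sum>k. eps k)) / sqrt N + \<bar>D \<omega>\<bar> / sqrt N + \<kappa> * \<bar>centered_blocks b q \<omega>\<bar>" for \<omega>
  proof -
    define r where "r = (\<Sum>j=b * q..<n. R 0 j \<omega> - p) + (\<Sum>j<b * q. eps j)"
    have "\<bar>\<Sum>j=b * q..<n. R 0 j \<omega> - p\<bar> \<le> (\<Sum>j=b * q..<n. 1)"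
    proof (rule order_trans[OF sum_abs], rule sum_mono)
      show "\<bar>R 0 j \<omega> - p\<bar> \<le> 1" for j using R_bounds[of 0 j \<omega>] p_bounds by (simp add: abs_le_iff)
    qed
    also have "\<dots> = real (n - b * q)" by simp
    also have "\<dots> \<le> real b" using bq by (simp only: of_nat_le_iff)
    finally have "\<bar>\<Sum>j=b * q..<n. R 0 j \<omega> - p\<bar> \<le> real b" .
    moreover have "\<bar>\<Sum>j<b * q. eps j\<bar> \<le> (\<Sum>k. eps k)"
    proof -
      have "0 \<le> (\<Sum>j<b * q. eps j)" by (intro sum_nonneg eps_nonneg)
      then show ?thesis using sum_le_suminf[OF rate, of "{..<b * q}"] eps_nonneg by simp
    qed
    ultimately have r: "\<bar>r\<bar> \<le> real b + (\<Sum>k. eps k)" unfolding r_def by linarith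
    have "((\<Sum>j<n. R 0 j \<omega>) - real n * p) / sqrt N - centered_blocks b q \<omega> / sqrt Q
        = r / sqrt N - D \<omega> / sqrt N - \<kappa> * centered_blocks b q \<omega>"
      unfolding records_block_decomposition[OF b bq(1)] r_def D_def \<kappa>_def
      by (simp add: add_divide_distrib diff_divide_distrib left_diff_distrib)
    also have "\<bar>\<dots>\<bar> \<le> \<bar>r / sqrt N\<bar> + \<bar>D \<omega> / sqrt N\<bar> + \<bar>\<kappa> * centered_blocks b q \<omega>\<bar>"
      by linarith
    also have "\<dots> = \<bar>r\<bar> / sqrt N + \<bar>D \<omega>\<bar> / sqrt N + \<kappa> * \<bar>centered_blocks b q \<omega>\<bar>"
      using N \<kappa>0 by (simp add: abs_mult)
    also have "\<dots> \<le> (real b + (\<Sum>k. eps k)) / sqrt N + \<bar>D \<omega>\<bar> / sqrt N + \<kappa> * \<bar>centered_blocks b q \<omega>\<bar>"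
      using r N by (intro add_mono divide_right_mono) auto
    finally show ?thesis .
  qed
  have "expectation (\<lambda>\<omega>. \<bar>((\<Sum>j<n. R 0 j \<omega>) - real n * p) / sqrt N - centered_blocks b q \<omega> / sqrt Q\<bar>)
      \<le> expectation (\<lambda>\<omega>. (real b + (\<Sum>k. eps k)) / sqrt N + \<bar>D \<omega>\<bar> / sqrt N + \<kappa> * \<bar>centered_blocks b q \<omega>\<bar>)"
  proof (rule integral_mono[OF _ _ pointwise])
    have "integrable M (\<lambda>\<omega>. (\<Sum>j<n. R 0 j \<omega>) - real n * p)" by auto
    then show "integrable M (\<lambda>\<omega>. \<bar>((\<Sum>j<n. R 0 j \<omega>) - real n * p) / sqrt N - centered_blocks b q \<omega> / sqrt Q\<bar>)"
      using A_int by (intro integrable_abs Bochner_Integration.integrable_diff integrable_divide) auto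
  qed (use A_int D_int in auto)
  also have "\<dots> = (real b + (\<Sum>k. eps k)) / sqrt N + expectation (\<lambda>\<omega>. \<bar>D \<omega>\<bar>) / sqrt N
      + \<kappa> * expectation (\<lambda>\<omega>. \<bar>centered_blocks b q \<omega>\<bar>)"
    using A_int D_int by (simp add: prob_space)
  also have "expectation (\<lambda>\<omega>. \<bar>D \<omega>\<bar>) / sqrt N \<le> sqrt H"
    using ED N by (simp add: field_simps)
  also have "\<kappa> * expectation (\<lambda>\<omega>. \<bar>centered_blocks b q \<omega>\<bar>) \<le> \<kappa> * (sqrt Q * sqrt (block_var b / real b))"
    using EA \<kappa>0 by (intro mult_left_mono)
  also have "\<dots> = (sqrt Q * \<kappa>) * sqrt (block_var b / real b)" by simp
  also have "\<dots> \<le> (real b / N) * sqrt (block_var b / real b)"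
    using \<kappa>_le block_var_nonneg by (intro mult_right_mono) auto
  finally show ?thesis by (simp add: H_def N_def Q_def algebra_simps)
qed

theorem records_central_limit:
  assumes q: "\<And>m. (\<lambda>i. expectation (\<lambda>\<omega>. R 0 i \<omega> * R 0 (i + Suc m) \<omega>)) \<longlonglongrightarrow> q m"
  defines "v \<equiv> p - p\<^sup>2 + 2 * (\<Sum>m. q m - p\<^sup>2)"
  shows "v \<ge> 0"
    and "weak_conv_m (\<lambda>n. distr M borel (\<lambda>\<omega>. sqrt (real n) * ((\<Sum>j<n. R 0 j \<omega>) / real n - p))) (centered_gaussian v)"
proof -
  have var_lim: "(\<lambda>n. variance (\<lambda>\<omega>. \<Sum>j<n. R 0 j \<omega>) / real n) \<longlonglongrightarrow> v"
    unfolding v_def by (rule variance_records_tendsto(2)[OF q])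
  show v0: "v \<ge> 0"
    by (rule LIMSEQ_le_const[OF var_lim]) (auto intro!: divide_nonneg_nonneg variance_positive)
  \<comment> \<open>Block 0 starts at index 0, so \<open>block_var b\<close> is the variance of the
    record count itself and inherits its limit.\<close>
  have bv: "(\<lambda>b. block_var b / real b) \<longlonglongrightarrow> v"
    using var_lim by (simp add: block_sum_def[abs_def])
  define V where "V n \<omega> = ((\<Sum>j<n. R 0 j \<omega>) - real n * p) / sqrt (real n)" for n \<omega>
  have V_eq: "sqrt (real n) * ((\<Sum>j<n. R 0 j \<omega>) / real n - p) = V n \<omega>" for n \<omega>
    by (cases "n = 0") (simp_all add: V_def field_simps)
  have [measurable]: "random_variable borel (V n)" for n unfolding V_def by measurable
  have V_int: "integrable M (V n)" for n unfolding V_def by auto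
  show "weak_conv_m (\<lambda>n. distr M borel (\<lambda>\<omega>. sqrt (real n) * ((\<Sum>j<n. R 0 j \<omega>) / real n - p))) (centered_gaussian v)"
    unfolding V_eq
  proof (rule levy_continuity)
    show "real_distribution (distr M borel (V n))" for n by (intro real_distribution_distr) measurable
    show "real_distribution (centered_gaussian v)" by (rule real_distribution_centered_gaussian[OF v0])
    fix t
    show "(\<lambda>n. char (distr M borel (V n)) t) \<longlonglongrightarrow> char (centered_gaussian v) t"
      unfolding char_centered_gaussian[OF v0]
    proof (rule LIMSEQ_by_approximation)
      define H where "H b = (\<Sum>r<b. surplus_weight r) / real b" for b
      have "(\<lambda>b. \<bar>t\<bar> * sqrt (H b)) \<longlonglongrightarrow> \<bar>t\<bar> * sqrt 0"
        unfolding H_def by (intro tendsto_intros cesaro_mean surplus_weight_tendsto)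
      then show "(\<lambda>b. \<bar>t\<bar> * sqrt ((\<Sum>r<b. surplus_weight r) / real b)) \<longlonglongrightarrow> 0" by (simp add: H_def)
      show "(\<lambda>b. complex_of_real (exp (- (t\<^sup>2 * (block_var b / real b)) / 2))) \<longlonglongrightarrow> complex_of_real (exp (- (t\<^sup>2 * v) / 2))"
        by (intro tendsto_intros bv) simp
      fix b :: nat assume b: "b \<ge> 1"
      have div_top: "filterlim (\<lambda>n. n div b) at_top sequentially"
        using b by (simp add: filterlim_at_top_div_const_nat)
      show "(\<lambda>n. char (distr M borel (\<lambda>\<omega>. centered_blocks b (n div b) \<omega> / sqrt (real (n div b) * real b))) t)
          \<longlonglongrightarrow> complex_of_real (exp (- (t\<^sup>2 * (block_var b / real b)) / 2))"
        by (rule filterlim_compose[OF char_centered_blocks_tendsto[OF b] div_top])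
      have s: "(\<lambda>n. K / sqrt (real n)) \<longlonglongrightarrow> 0" for K
        by (intro tendsto_divide_0[OF tendsto_const] filterlim_at_top_imp_at_infinity
            filterlim_compose[OF sqrt_at_top filterlim_real_sequentially])
      have "(\<lambda>n. \<bar>t\<bar> * ((real b + (\<Sum>k. eps k)) / sqrt (real n) + sqrt (block_var b / real b) * (real b / real n)))
          \<longlonglongrightarrow> \<bar>t\<bar> * (0 + sqrt (block_var b / real b) * 0)"
        by (intro tendsto_intros s lim_const_over_n)
      then show "(\<lambda>n. \<bar>t\<bar> * ((real b + (\<Sum>k. eps k)) / sqrt (real n) + sqrt (block_var b / real b) * (real b / real n))) \<longlonglongrightarrow> 0"
        by simp
      show "\<forall>\<^sub>F n in sequentially. cmod (char (distr M borel (V n)) t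
            - char (distr M borel (\<lambda>\<omega>. centered_blocks b (n div b) \<omega> / sqrt (real (n div b) * real b))) t)
          \<le> \<bar>t\<bar> * sqrt ((\<Sum>r<b. surplus_weight r) / real b)
            + \<bar>t\<bar> * ((real b + (\<Sum>k. eps k)) / sqrt (real n) + sqrt (block_var b / real b) * (real b / real n))"
        using eventually_ge_at_top[of b]
      proof eventually_elim
        case (elim n)
        have A_int: "integrable M (\<lambda>\<omega>. centered_blocks b (n div b) \<omega> / sqrt (real (n div b) * real b))"
          by (intro integrable_divide bounded_integrable[OF _ centered_blocks_bound]) auto
        show ?case
          unfolding distrib_left[symmetric]
          by (rule order_trans[OF char_distr_diff_le[OF V_int A_int] mult_left_mono])
            (use expectation_block_error_le[OF b elim refl] in \<open>auto simp: V_def\<close>)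
      qed
    qed
  qed
qed

end

end

section \<open>Rate of convergence and the two-sided model\<close>

text \<open>Let y be the positive part of (x + L) / a. The weights \<open>Suc l\<close> whose
  thresholds do not exceed x are at most y each and at most y in number, so they sum to at most the
  square of y, which is integrable.\<close>

lemma (in real_distribution) weighted_tail_summable:
  assumes sq: "integrable M (\<lambda>x. (max 0 x)\<^sup>2)" and a: "a > 0"
  shows "summable (\<lambda>l. real (Suc l) * measure M {a * real (Suc l) - L..})"
proof (rule summableI_nonneg_bounded)
  define w where "w x = (max 0 ((x + L) / a))\<^sup>2" for x
  have w_le: "w x \<le> 2 / a\<^sup>2 * ((max 0 x)\<^sup>2 + L\<^sup>2)" for x
  proof -
    have "max 0 ((x + L) / a) \<le> (max 0 x + \<bar>L\<bar>) / a" (is "_ \<le> ?r")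
    proof -
      have "(x + L) / a \<le> ?r" using a by (intro divide_right_mono) auto
      moreover have "0 \<le> ?r" using a by simp
      ultimately show ?thesis by simp
    qed
    then have "w x \<le> ?r\<^sup>2" unfolding w_def by (intro power_mono) auto
    also have "\<dots> = (max 0 x + \<bar>L\<bar>)\<^sup>2 / a\<^sup>2" by (simp add: power_divide)
    also have "(max 0 x + \<bar>L\<bar>)\<^sup>2 \<le> 2 * ((max 0 x)\<^sup>2 + L\<^sup>2)"
      using sum_squares_bound[of "max 0 x" "\<bar>L\<bar>"] by (simp add: power2_sum)
    finally show ?thesis using a by (simp add: divide_right_mono)
  qed
  have w_int: "integrable M w"
  proof (rule Bochner_Integration.integrable_bound)
    show "integrable M (\<lambda>x. 2 / a\<^sup>2 * ((max 0 x)\<^sup>2 + L\<^sup>2))" using sq by auto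
    show "AE x in M. norm (w x) \<le> norm (2 / a\<^sup>2 * ((max 0 x)\<^sup>2 + L\<^sup>2))"
    proof (rule AE_I2)
      fix x
      have "norm (w x) = w x" by (simp add: w_def)
      then show "norm (w x) \<le> norm (2 / a\<^sup>2 * ((max 0 x)\<^sup>2 + L\<^sup>2))"
        using order_trans[OF w_le abs_ge_self] by simp
    qed
    show "w \<in> borel_measurable M" unfolding w_def by measurable
  qed
  fix n
  define S where "S x = (\<Sum>l<n. real (Suc l) * indicat_real {a * real (Suc l) - L..} x)" for x
  have S_int: "integrable M (\<lambda>x. real (Suc l) * indicat_real {a * real (Suc l) - L..} x)" for l
    by (intro integrable_mult_right integrable_real_indicator) (auto simp: emeasure_eq_measure)
  have "S x \<le> w x" for x
  proof -
    define y where "y = (x + L) / a"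
    have mem: "x \<in> {a * real (Suc l) - L..} \<longleftrightarrow> real (Suc l) \<le> y" for l
      using a by (auto simp: y_def field_simps)
    have ind: "indicat_real {a * real (Suc l) - L..} x = (if real (Suc l) \<le> y then 1 else 0)" for l
      by (simp only: indicator_def mem of_bool_def)
    have "S x \<le> (\<Sum>l<n. max 0 y * (if real (Suc l) \<le> y then 1 else 0))"
      unfolding S_def ind by (intro sum_mono) auto
    also have "\<dots> = max 0 y * (\<Sum>l<n. if real (Suc l) \<le> y then 1 else 0)"
      by (simp only: sum_distrib_left)
    also have "(\<Sum>l<n. if real (Suc l) \<le> y then 1 else 0) = real (card {l \<in> {..<n}. real (Suc l) \<le> y})"
      by (subst sum.inter_filter[symmetric]) auto
    also have "card {l \<in> {..<n}. real (Suc l) \<le> y} = card (Suc ` {l \<in> {..<n}. real (Suc l) \<le> y})"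
      by (rule card_image[symmetric]) auto
    \<comment> \<open>Written so as to match \<open>card_shifted_le\<close> with
      \<open>s = 0\<close> and \<open>k = 0\<close>.\<close>
    also have "\<dots> \<le> card {j \<in> {0 + 0<..<Suc n}. real (j - 0) \<le> y}"
      by (intro card_mono) auto
    also have "real (card {j \<in> {0 + 0<..<Suc n}. real (j - 0) \<le> y}) \<le> max 0 (y - real 0)"
      by (rule card_shifted_le)
    finally have "S x \<le> max 0 y * max 0 y" by (simp add: mult_left_mono)
    then show ?thesis by (simp add: w_def y_def power2_eq_square)
  qed
  then have "expectation S \<le> expectation w"
    unfolding S_def by (intro integral_mono w_int Bochner_Integration.integrable_sum S_int)
  moreover have "expectation S = (\<Sum>l<n. real (Suc l) * measure M {a * real (Suc l) - L..})"
    unfolding S_def using S_int by (subst Bochner_Integration.integral_sum) auto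
  ultimately show "(\<Sum>l<n. real (Suc l) * measure M {a * real (Suc l) - L..}) \<le> expectation w" by simp
qed simp

context iid_drift
begin

context
  assumes sq_part: "integrable \<mu> (\<lambda>x. (max 0 x)\<^sup>2)"
begin

text \<open>A step of \<open>P\<close> is split according to the size of the candidate record. A value below
  \<open>- c k / 2\<close> is unlikely to beat even its \<open>k div 4\<close> nearest predecessors, while a larger one
  is beaten by the observation at distance \<open>k + 1\<close> only if that observation is of order \<open>k\<close>.\<close>

lemma P_step_le:
  obtains k0 where "\<And>k. k \<ge> k0 \<Longrightarrow> P k - P (Suc k) \<le> 8 * (1 / 2) ^ k + measure \<mu> {c / 2 * real (Suc k) - \<delta>..}"
proof -
  define F where "F y = measure \<mu> {..<y}" for y
  have F01: "0 \<le> F y" "F y \<le> 1" for y by (auto simp: F_def)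
  have F_mono: "F y \<le> F z" if "y \<le> z" for y z unfolding F_def using that by (intro \<mu>.finite_measure_mono) auto
  have Fm [measurable]: "F \<in> borel_measurable borel" unfolding F_def by measurable
  have "((\<lambda>y. measure \<mu> {..y}) \<longlongrightarrow> 0) at_bot"
    using \<mu>.cdf_lim_at_bot by (simp add: cdf_def[abs_def])
  \<comment> \<open>With 1/16, the nearest \<open>k div 4\<close> factors yield
    \<open>(1 / 2) ^ (4 * (k div 4))\<close>; rounding loses at most three factors 1/2, whence the
    constant 8.\<close>
  then have "\<forall>\<^sub>F y in at_bot. measure \<mu> {..y} < 1 / 16" by (rule order_tendstoD(2)) simp
  then obtain y0 where y0: "\<And>y. y \<le> y0 \<Longrightarrow> measure \<mu> {..y} < 1 / 16"
    by (auto simp: eventually_at_bot_linorder)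
  have F_small: "F y \<le> 1 / 16" if "y \<le> y0" for y
  proof -
    have "F y \<le> measure \<mu> {..y}" unfolding F_def by (intro \<mu>.finite_measure_mono) auto
    then show ?thesis using y0[OF that] by simp
  qed
  \<comment> \<open>For \<open>x < - (c * k / 2)\<close> and \<open>i \<le> k / 4\<close> the
    argument \<open>x + c * i - \<delta>\<close> is below \<open>- (c * k / 4) - \<delta>\<close>,
    which from \<open>k0\<close> on is at most \<open>y0\<close>.\<close>
  obtain k0 :: nat where k0: "4 * (- y0 - \<delta>) / c < real k0" using reals_Archimedean2 by blast
  define g where "g k x = (\<Prod>i=1..k. F (x + c * real i - \<delta>))" for k x
  have g0: "0 \<le> g k x" for k x unfolding g_def using F01 by (intro prod_nonneg) auto
  have g1: "g k x \<le> 1" for k x unfolding g_def using F01 by (intro prod_le_1) auto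
  have [measurable]: "g k \<in> borel_measurable borel" for k unfolding g_def by measurable
  have g_int: "integrable \<mu> (g k)" for k
    by (rule \<mu>.integrable_const_bound[where B=1]) (use g0 g1 in \<open>auto simp: abs_le_iff\<close>)
  have P_eq: "P k = (\<integral>x. g k x \<partial>\<mu>)" for k by (simp add: window_prob_def g_def F_def)
  show thesis
  proof (rule that[of k0])
    fix k assume k: "k \<ge> k0"
    have ck: "- (c * real k / 4) - \<delta> \<le> y0"
    proof -
      have "4 * (- y0 - \<delta>) / c \<le> real k" using k0 k by linarith
      then show ?thesis using c_pos by (simp add: field_simps)
    qed
    have low: "g k x \<le> 8 * (1 / 2) ^ k" if x: "x < - (c * real k / 2)" for x
    proof -
      define m where "m = k div 4"
      have m: "k \<le> 4 * m + 3" "4 * m \<le> k" by (auto simp: m_def)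
      have "g k x \<le> (\<Prod>i=1..k. if i \<le> m then 1 / 16 else 1)"
        unfolding g_def
      proof (rule prod_mono, safe)
        fix i assume "i \<in> {1..k}"
        show "F (x + c * real i - \<delta>) \<le> (if i \<le> m then 1 / 16 else 1)"
        proof (cases "i \<le> m")
          case True
          then have "real i \<le> real k / 4" using m by linarith
          then have "c * real i \<le> c * (real k / 4)" using c_pos by (intro mult_left_mono) auto
          then have "x + c * real i - \<delta> \<le> y0" using x ck by simp
          then show ?thesis using True F_small by simp
        qed (use F01 in auto)
      qed (use F01 in auto)
      also have "\<dots> = (1 / 16) ^ card {i \<in> {1..k}. i \<le> m}"
        by (subst prod.inter_filter[symmetric]) auto
      also have "{i \<in> {1..k}. i \<le> m} = {1..m}" using m by auto
      also have "(1 / 16 :: real) ^ card {1..m} = 8 * (1 / 2) ^ (4 * m + 3)"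
      proof -
        have "(1 / 16 :: real) ^ m = ((1 / 2) ^ 4) ^ m" by (simp add: power_divide)
        also have "\<dots> = (1 / 2) ^ (4 * m)" by (rule power_mult[symmetric])
        finally show ?thesis by (simp add: power_add power_divide)
      qed
      also have "\<dots> \<le> 8 * (1 / 2) ^ k" using m by (intro mult_left_mono power_decreasing) auto
      finally show ?thesis .
    qed
    define T where "T = measure \<mu> {c / 2 * real (Suc k) - \<delta>..}"
    \<comment> \<open>Here \<open>x + c * (k + 1) \<ge> c / 2 * (k + 1)\<close>, so defeat at
      distance \<open>k + 1\<close> requires an observation of at least
      \<open>c / 2 * (k + 1) - \<delta>\<close>.\<close>
    have high: "1 - F (x + c * real (Suc k) - \<delta>) \<le> T" if x: "- (c * real k / 2) \<le> x" for x
    proof -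
      have "1 - F (x + c * real (Suc k) - \<delta>) = measure \<mu> {x + c * real (Suc k) - \<delta>..}"
      proof -
        have "{x + c * real (Suc k) - \<delta>..} = space \<mu> - {..<x + c * real (Suc k) - \<delta>}" by auto
        then show ?thesis unfolding F_def by (simp only: \<mu>.prob_compl \<mu>.events_eq_borel lessThan_borel)
      qed
      also have "\<dots> \<le> T" unfolding T_def using x c_pos
        by (intro \<mu>.finite_measure_mono) (auto simp: algebra_simps)
      finally show ?thesis .
    qed
    have T0: "0 \<le> T" by (simp add: T_def)
    have step: "g k x - g (Suc k) x \<le> 8 * (1 / 2) ^ k + T" for x
    proof -
      have "g k x - g (Suc k) x = g k x * (1 - F (x + c * real (Suc k) - \<delta>))"
        by (simp add: g_def right_diff_distrib)
      moreover have "g k x * (1 - F (x + c * real (Suc k) - \<delta>)) \<le> g k x"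
        using F01 g0 by (intro mult_right_le_one_le) (auto simp: diff_le_eq)
      moreover have "g k x * (1 - F (x + c * real (Suc k) - \<delta>)) \<le> 1 - F (x + c * real (Suc k) - \<delta>)"
        using F01 g0 g1 by (intro mult_left_le_one_le) (auto simp: diff_le_eq)
      moreover have "(0::real) \<le> 8 * (1 / 2) ^ k" by simp
      ultimately show ?thesis using low[of x] high[of x] T0 by (cases "x < - (c * real k / 2)") linarith+
    qed
    have "P k - P (Suc k) = (\<integral>x. g k x - g (Suc k) x \<partial>\<mu>)"
      unfolding P_eq using g_int by simp
    also have "\<dots> \<le> (\<integral>x. 8 * (1 / 2) ^ k + T \<partial>\<mu>)"
      using g_int step by (intro integral_mono Bochner_Integration.integrable_diff) auto
    also have "\<dots> = 8 * (1 / 2) ^ k + T" using \<mu>.prob_space by simp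
    finally show "P k - P (Suc k) \<le> 8 * (1 / 2) ^ k + measure \<mu> {c / 2 * real (Suc k) - \<delta>..}"
      by (simp add: T_def)
  qed
qed

lemma rate_summable:
  assumes P_lim: "P \<longlonglongrightarrow> p"
  shows "summable (\<lambda>k. P k - p)"
proof -
  obtain k0 where k0: "\<And>k. k \<ge> k0 \<Longrightarrow> P k - P (Suc k) \<le> 8 * (1 / 2) ^ k + measure \<mu> {c / 2 * real (Suc k) - \<delta>..}"
    using P_step_le by blast
  have d0: "0 \<le> P k - P (Suc k)" for k using P_antimono[of k "Suc k"] by simp
  have s1: "summable (\<lambda>k. 8 * (real (Suc k) * (1 / 2) ^ k))"
    using geometric_deriv_sums[of "1/2::real"] by (intro summable_mult) (auto simp: sums_iff)
  have s2: "summable (\<lambda>k. real (Suc k) * measure \<mu> {c / 2 * real (Suc k) - \<delta>..})"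
    by (rule \<mu>.weighted_tail_summable[OF sq_part]) (use c_pos in simp)
  have s: "summable (\<lambda>k. real (Suc k) * (P k - P (Suc k)))"
  proof (rule summable_comparison_test'[OF summable_add[OF s1 s2], of k0])
    fix k assume "k \<ge> k0"
    then have "real (Suc k) * (P k - P (Suc k)) \<le> real (Suc k) * (8 * (1 / 2) ^ k + measure \<mu> {c / 2 * real (Suc k) - \<delta>..})"
      by (intro mult_left_mono k0) auto
    moreover have "norm (real (Suc k) * (P k - P (Suc k))) = real (Suc k) * (P k - P (Suc k))"
      using d0[of k] by (simp add: abs_mult)
    ultimately show "norm (real (Suc k) * (P k - P (Suc k)))
        \<le> 8 * (real (Suc k) * (1 / 2) ^ k) + real (Suc k) * measure \<mu> {c / 2 * real (Suc k) - \<delta>..}"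
      by (simp add: distrib_left mult.left_commute)
  qed
  \<comment> \<open>Summation by parts with \<open>P m\<close> in place of \<open>p\<close>, so that
    no boundary term appears; \<open>m\<close> tends to infinity afterwards.\<close>
  have by_parts: "(\<Sum>k<m. P k - P m) = (\<Sum>k<m. real (Suc k) * (P k - P (Suc k)))" for m
  proof (induction m)
    case (Suc m)
    have "(\<Sum>k<Suc m. P k - P (Suc m)) = (\<Sum>k<m. (P k - P m) + (P m - P (Suc m))) + (P m - P (Suc m))"
      by simp
    also have "\<dots> = (\<Sum>k<m. P k - P m) + real (Suc m) * (P m - P (Suc m))"
      unfolding sum.distrib by (simp add: algebra_simps)
    finally show ?case using Suc by simp
  qed simp
  have p_le: "p \<le> P k" for k by (rule decseq_ge[OF decseq_P P_lim])
  show ?thesis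
  proof (rule summableI_nonneg_bounded)
    fix n
    have "(\<lambda>m. \<Sum>k<n. P k - P m) \<longlonglongrightarrow> (\<Sum>k<n. P k - p)"
      by (intro tendsto_sum tendsto_diff tendsto_const P_lim)
    moreover have "\<exists>N. \<forall>m\<ge>N. (\<Sum>k<n. P k - P m) \<le> (\<Sum>k. real (Suc k) * (P k - P (Suc k)))"
    proof (intro exI allI impI)
      fix m assume m: "m \<ge> n"
      have "(\<Sum>k<n. P k - P m) \<le> (\<Sum>k<m. P k - P m)"
        using m P_antimono by (intro sum_mono2) auto
      also have "\<dots> \<le> (\<Sum>k. real (Suc k) * (P k - P (Suc k)))"
        unfolding by_parts using d0 by (intro sum_le_suminf s) auto
      finally show "(\<Sum>k<n. P k - P m) \<le> (\<Sum>k. real (Suc k) * (P k - P (Suc k)))" .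
    qed
    ultimately show "(\<Sum>k<n. P k - p) \<le> (\<Sum>k. real (Suc k) * (P k - P (Suc k)))"
      by (rule LIMSEQ_le_const2)
  qed (use p_le in simp)
qed

end

end

section \<open>Pair expectations of the two-sided model\<close>

text \<open>The integral from \<open>expectation_R_pair\<close>, named because it links the
  one-sided process on one space with the two-sided process on another.\<close>

definition pair_prob :: "real measure \<Rightarrow> real \<Rightarrow> real \<Rightarrow> nat \<Rightarrow> nat \<Rightarrow> real" where
  "pair_prob \<mu> c \<delta> i j =
    (\<integral>y. of_bool (window_record c \<delta> y 0 i) * of_bool (window_record c \<delta> y 0 j) \<partial>PiM {..j} (\<lambda>_. \<mu>))"

text \<open>If the drifted past tends to \<open>-\<infinity>\<close>, its supremum is attained, so that
  exceeding the supremum is the same as exceeding every past value.\<close>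

lemma bi_record_ind_eq:
  assumes past: "\<And>L::nat. \<forall>\<^sub>F u in sequentially. Z (i - int u) \<omega> < c * real u - real L"
  shows "bi_record_ind c Z \<delta> i \<omega> = of_bool (\<forall>u\<ge>1. Z (i - int u) \<omega> - c * real u + \<delta> < Z i \<omega>)"
proof -
  define Y where "Y j = bi_drift c Z j \<omega>" for j
  have Q: "Z (i - int u) \<omega> - c * real u + \<delta> < Z i \<omega> \<longleftrightarrow> Y (i - int u) + \<delta> < Y i" for u
    by (auto simp: Y_def bi_drift_def algebra_simps)
  have "ereal (Y i) > bi_sup c Z (i - 1) \<omega> + ereal \<delta> \<longleftrightarrow> (\<forall>u\<ge>1. Y (i - int u) + \<delta> < Y i)"
  proof
    assume a: "ereal (Y i) > bi_sup c Z (i - 1) \<omega> + ereal \<delta>"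
    show "\<forall>u\<ge>1. Y (i - int u) + \<delta> < Y i"
    proof (intro allI impI)
      fix u :: nat assume "u \<ge> 1"
      then have "ereal (Y (i - int u)) \<le> bi_sup c Z (i - 1) \<omega>"
        unfolding bi_sup_def Y_def by (intro SUP_upper) auto
      then have "ereal (Y (i - int u)) + ereal \<delta> \<le> bi_sup c Z (i - 1) \<omega> + ereal \<delta>"
        by (rule add_right_mono)
      then have "ereal (Y (i - int u)) + ereal \<delta> < ereal (Y i)" using a by (rule le_less_trans)
      then show "Y (i - int u) + \<delta> < Y i" by simp
    qed
  next
    assume a: "\<forall>u\<ge>1. Y (i - int u) + \<delta> < Y i"
    obtain L :: nat where L: "\<delta> - Z i \<omega> + 1 < real L" using reals_Archimedean2 by blast
    obtain u0 where u0: "\<And>u. u \<ge> u0 \<Longrightarrow> Z (i - int u) \<omega> < c * real u - real L"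
      using past[of L] by (auto simp: eventually_sequentially)
    \<comment> \<open>Exceeding each past value does not by itself leave room above their supremum.
      The near past gives finitely many positive gaps, the remote past a gap of at least 1 by the
      choice of \<open>L\<close>, and \<eta> is the least of these.\<close>
    define A where "A = insert 1 ((\<lambda>u. Y i - Y (i - int u) - \<delta>) ` {1..u0})"
    define \<eta> where "\<eta> = Min A"
    have A: "finite A" "A \<noteq> {}" by (auto simp: A_def)
    have \<eta>: "\<eta> > 0" unfolding \<eta>_def using a A by (subst Min_gr_iff) (auto simp: A_def)
    have bound: "Y j \<le> Y i - \<delta> - \<eta>" if "j \<le> i - 1" for j
    proof -
      define u where "u = nat (i - j)"
      have u: "u \<ge> 1" "j = i - int u" using that by (auto simp: u_def)
      show ?thesis
      proof (cases "u \<le> u0")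
        case True
        then have "\<eta> \<le> Y i - Y (i - int u) - \<delta>"
          unfolding \<eta>_def using A u by (intro Min_le) (auto simp: A_def)
        then show ?thesis using u by simp
      next
        case False
        have "\<eta> \<le> 1" unfolding \<eta>_def using A by (intro Min_le) (auto simp: A_def)
        moreover have "Z (i - int u) \<omega> < c * real u - real L" using False by (intro u0) simp
        then have "Y (i - int u) \<le> Y i - \<delta> - 1"
          using L by (simp add: Y_def bi_drift_def algebra_simps)
        ultimately show ?thesis using u by simp
      qed
    qed
    have "bi_sup c Z (i - 1) \<omega> \<le> ereal (Y i - \<delta> - \<eta>)"
      unfolding bi_sup_def by (intro SUP_least) (use bound in \<open>auto simp: Y_def\<close>)
    then have "bi_sup c Z (i - 1) \<omega> + ereal \<delta> \<le> ereal (Y i - \<delta> - \<eta>) + ereal \<delta>" by (rule add_right_mono)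
    also have "\<dots> < ereal (Y i)" using \<eta> by simp
    finally show "ereal (Y i) > bi_sup c Z (i - 1) \<omega> + ereal \<delta>" .
  qed
  then show ?thesis by (simp add: bi_record_ind_def Q Y_def)
qed

lemma all_upto_tendsto:
  "(\<lambda>k. of_bool (\<forall>u\<in>{1..k}. Q u) :: real) \<longlonglongrightarrow> of_bool (\<forall>u\<ge>(1::nat). Q u)"
proof (cases "\<forall>u\<ge>1. Q u")
  case False
  then obtain u where u: "u \<ge> 1" "\<not> Q u" by auto
  have "\<forall>\<^sub>F k in sequentially. of_bool (\<forall>u\<in>{1..k}. Q u) = (of_bool (\<forall>u\<ge>1. Q u) :: real)"
    using eventually_ge_at_top[of u] by eventually_elim (use u in auto)
  then show ?thesis by (rule tendsto_eventually)
qed auto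

locale two_sided_iid = prob_space N for N :: "'b measure" +
  fixes Z :: "int \<Rightarrow> 'b \<Rightarrow> real" and \<mu> :: "real measure" and c \<delta> :: real
  assumes indep: "indep_vars (\<lambda>_. borel) Z UNIV"
    and law: "\<And>i. distr N borel (Z i) = \<mu>"
    and c_pos: "c > 0"
    and sq_part: "integrable \<mu> (\<lambda>x. (max 0 x)\<^sup>2)"
begin

lemma Z_measurable [measurable]: "random_variable borel (Z i)"
  using indep by (simp add: indep_vars_def2)

text \<open>Borel-Cantelli for tail probabilities that the weighted tails dominate; the countably
  many \<open>i\<close> and \<open>L\<close> share one null set.\<close>

lemma AE_past_tendsto:
  "AE \<omega> in N. \<forall>i (L::nat). \<forall>\<^sub>F u in sequentially. Z (i - int u) \<omega> < c * real u - real L"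
  unfolding AE_all_countable
proof (intro allI)
  fix i and L :: nat
  interpret \<mu>: real_distribution \<mu>
    unfolding law[of 0, symmetric] by (intro real_distribution_distr) measurable
  define A where "A l = {\<omega> \<in> space N. c * real (Suc l) - real L \<le> Z (i - int (Suc l)) \<omega>}" for l
  have [measurable]: "A l \<in> sets N" for l unfolding A_def by measurable
  have A_eq: "prob (A l) = measure \<mu> {c * real (Suc l) - real L..}" for l
    unfolding law[of "i - int (Suc l)", symmetric] A_def
    by (subst measure_distr) (auto intro!: arg_cong[where f=prob])
  have "summable (\<lambda>l. prob (A l))"
  proof (rule summable_comparison_test'[OF \<mu>.weighted_tail_summable[OF sq_part c_pos, of "real L"], of 0])
    fix l
    have "1 * measure \<mu> {c * real (Suc l) - real L..} \<le> real (Suc l) * measure \<mu> {c * real (Suc l) - real L..}"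
      by (intro mult_right_mono) auto
    then show "norm (prob (A l)) \<le> real (Suc l) * measure \<mu> {c * real (Suc l) - real L..}"
      by (simp add: A_eq)
  qed
  then have "AE \<omega> in N. \<forall>\<^sub>F l in sequentially. \<omega> \<in> space N - A l"
    by (intro borel_cantelli_AE1) (auto simp: emeasure_eq_measure)
  then show "AE \<omega> in N. \<forall>\<^sub>F u in sequentially. Z (i - int u) \<omega> < c * real u - real L"
  proof eventually_elim
    case (elim \<omega>)
    then have "\<forall>\<^sub>F l in sequentially. Z (i - int (Suc l)) \<omega> < c * real (Suc l) - real L"
      by eventually_elim (auto simp: A_def)
    then show ?case by (simp only: eventually_sequentially_Suc[of "\<lambda>u. Z (i - int u) \<omega> < c * real u - real L"])
  qed
qed

lemma bi_record_ind_measurable [measurable]: "random_variable borel (bi_record_ind c Z \<delta> i)"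
  unfolding bi_record_ind_def bi_sup_def bi_drift_def by measurable

text \<open>Read from time \<open>i - k\<close> on, the two-sided process is a one-sided model whose
  indices \<open>k\<close> and \<open>k + m\<close> are the times \<open>i\<close> and
  \<open>i + m\<close>. As \<open>k\<close> grows, comparison with finitely many past values becomes
  comparison with the whole past. The sequence does not involve \<open>i\<close>, which is how
  stationarity is obtained.\<close>

lemma pair_prob_tendsto: "(\<lambda>k. pair_prob \<mu> c \<delta> k (k + m)) \<longlonglongrightarrow> bi_pair_expectation N c Z \<delta> i m"
proof -
  define X where "X k s = Z (i - int k + int s)" for k s
  have iid: "iid_drift N (X k) \<mu> c" for k
    unfolding X_def by (rule iid_drift_reindex[of N Z UNIV])
      (auto simp: indep law c_pos prob_space_axioms inj_def)
  define r where "r j k \<omega> = (of_bool (\<forall>u\<in>{1..k}. Z (j - int u) \<omega> - c * real u + \<delta> < Z j \<omega>) :: real)" for j k \<omega>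
  have [measurable]: "random_variable borel (r j k)" for j k unfolding r_def by measurable
  have rec: "iid_drift.R (X k) c \<delta> 0 (k + l) \<omega> = r (i + int l) (k + l) \<omega>" for k l \<omega>
  proof -
    interpret iid_drift N "X k" \<mu> c \<delta> by (rule iid)
    have "(\<forall>s\<in>{0..<k + l}. X k s \<omega> + c * real s + \<delta> < X k (k + l) \<omega> + c * real (k + l))
      \<longleftrightarrow> (\<forall>u\<in>{1..k + l}. Z (i + int l - int u) \<omega> - c * real u + \<delta> < Z (i + int l) \<omega>)" (is "?A \<longleftrightarrow> ?B")
    proof -
      \<comment> \<open>Times \<open>s\<close> counted from \<open>i - k\<close> are exchanged for
        distances \<open>u = k + l - s\<close> to the candidate.\<close>
      have *: "X k (k + l - u) \<omega> + c * real (k + l - u) + \<delta> < X k (k + l) \<omega> + c * real (k + l)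
        \<longleftrightarrow> Z (i + int l - int u) \<omega> - c * real u + \<delta> < Z (i + int l) \<omega>" if "u \<le> k + l" for u
      proof -
        have "i - int k + int (k + l - u) = i + int l - int u" "i - int k + int (k + l) = i + int l"
          using that by (auto simp: of_nat_diff)
        moreover have "real (k + l - u) = real (k + l) - real u" using that by (rule of_nat_diff)
        ultimately show ?thesis by (simp add: X_def algebra_simps)
      qed
      show ?thesis
      proof
        assume ?A
        show ?B
        proof
          fix u assume u: "u \<in> {1..k + l}"
          then have "k + l - u \<in> {0..<k + l}" by auto
          from bspec[OF \<open>?A\<close> this] show "Z (i + int l - int u) \<omega> - c * real u + \<delta> < Z (i + int l) \<omega>"
            using u by (subst *[symmetric]) auto
        qed
      next
        assume ?B
        show ?A
        proof
          fix s assume s: "s \<in> {0..<k + l}"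
          then have eq: "k + l - (k + l - s) = s" and mem: "k + l - s \<in> {1..k + l}" by auto
          show "X k s \<omega> + c * real s + \<delta> < X k (k + l) \<omega> + c * real (k + l)"
            using *[of "k + l - s"] bspec[OF \<open>?B\<close> mem] unfolding eq by simp
        qed
      qed
    qed
    then show ?thesis unfolding R_def window_record_def r_def by simp
  qed
  have "(\<lambda>k. expectation (\<lambda>\<omega>. r i k \<omega> * r (i + int m) (k + m) \<omega>))
      \<longlonglongrightarrow> expectation (\<lambda>\<omega>. bi_record_ind c Z \<delta> i \<omega> * bi_record_ind c Z \<delta> (i + int m) \<omega>)"
  proof (rule integral_dominated_convergence[where w="\<lambda>_. 1"])
    show "AE \<omega> in N. (\<lambda>k. r i k \<omega> * r (i + int m) (k + m) \<omega>)
        \<longlonglongrightarrow> bi_record_ind c Z \<delta> i \<omega> * bi_record_ind c Z \<delta> (i + int m) \<omega>"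
      using AE_past_tendsto
    proof eventually_elim
      case (elim \<omega>)
      have lim: "(\<lambda>k. r j k \<omega>) \<longlonglongrightarrow> bi_record_ind c Z \<delta> j \<omega>" for j
        unfolding bi_record_ind_eq[of Z j \<omega> c \<delta>, OF elim[rule_format]] r_def by (rule all_upto_tendsto)
      show ?case by (intro tendsto_mult lim LIMSEQ_ignore_initial_segment)
    qed
    show "AE \<omega> in N. norm (r i k \<omega> * r (i + int m) (k + m) \<omega>) \<le> 1" for k
      by (auto simp: r_def)
  qed auto
  moreover have "expectation (\<lambda>\<omega>. r i k \<omega> * r (i + int m) (k + m) \<omega>) = pair_prob \<mu> c \<delta> k (k + m)" for k
  proof -
    interpret iid_drift N "X k" \<mu> c \<delta> by (rule iid)
    have "expectation (\<lambda>\<omega>. R 0 k \<omega> * R 0 (k + m) \<omega>) = pair_prob \<mu> c \<delta> k (k + m)"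
      unfolding pair_prob_def by (rule expectation_R_pair) simp
    then show ?thesis using rec[of k 0] rec[of k m] by simp
  qed
  ultimately show ?thesis by (simp add: bi_pair_expectation_def)
qed

end

section \<open>Translation of the density hypotheses and of the one-based indexing\<close>

lemma integrable_density_pos_part:
  fixes f :: "real \<Rightarrow> real"
  assumes [measurable]: "f \<in> borel_measurable borel" and f0: "\<And>x. 0 \<le> f x"
    and fin: "(\<integral>\<^sup>+x\<in>{0..}. ennreal (x ^ n * f x) \<partial>lborel) < \<infinity>" and n: "n \<ge> 1"
  shows "integrable (density lborel (\<lambda>x. ennreal (f x))) (\<lambda>x. (max 0 x) ^ n)"
proof (rule integrableI_bounded)
  have "(\<integral>\<^sup>+x. ennreal (norm ((max 0 x) ^ n)) \<partial>density lborel (\<lambda>x. ennreal (f x)))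
      = (\<integral>\<^sup>+x. ennreal (f x) * ennreal (norm ((max 0 x) ^ n)) \<partial>lborel)"
    by (rule nn_integral_density) measurable
  also have "\<dots> = (\<integral>\<^sup>+x\<in>{0..}. ennreal (x ^ n * f x) \<partial>lborel)"
  proof (rule nn_integral_cong)
    fix x :: real
    show "ennreal (f x) * ennreal (norm ((max 0 x) ^ n)) = ennreal (x ^ n * f x) * indicator {0..} x"
    proof (cases "0 \<le> x")
      case True
      then show ?thesis using f0 by (simp add: ennreal_mult' mult.commute)
    next
      case False
      then show ?thesis using n by (simp add: max_def zero_power)
    qed
  qed
  finally show "(\<integral>\<^sup>+x. ennreal (norm ((max 0 x) ^ n)) \<partial>density lborel (\<lambda>x. ennreal (f x))) < \<infinity>"
    using fin by simp
qed measurable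

lemma iid_with_densityD:
  assumes "iid_with_density M X I f"
  shows "prob_space M" "prob_space.indep_vars M (\<lambda>_. borel) X I"
    and "\<And>i. i \<in> I \<Longrightarrow> distr M borel (X i) = density lborel (\<lambda>x. ennreal (f x))"
    and "\<And>i. i \<in> I \<Longrightarrow> (\<lambda>x. ennreal (f x)) \<in> borel_measurable borel"
proof -
  show "prob_space M" "prob_space.indep_vars M (\<lambda>_. borel) X I"
    using assms by (auto simp: iid_with_density_def)
  fix i assume "i \<in> I"
  then have d: "distributed M lborel (X i) (\<lambda>x. ennreal (f x))"
    using assms by (auto simp: iid_with_density_def)
  have "distr M borel (X i) = distr M lborel (X i)" by (rule distr_cong) auto
  then show "distr M borel (X i) = density lborel (\<lambda>x. ennreal (f x))"
    using d by (simp add: distributed_def)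
  show "(\<lambda>x. ennreal (f x)) \<in> borel_measurable borel" using d by (simp add: distributed_def)
qed

text \<open>Shifting the index by one adds \<open>c\<close> to both sides of each comparison, and
  the convention for index 1 becomes an empty window.\<close>

lemma delta_record_Suc:
  "delta_record \<delta> (\<lambda>n. drift c X n \<omega>) (Suc j) \<longleftrightarrow> window_record c \<delta> (\<lambda>i. X (Suc i) \<omega>) 0 j"
proof (cases "j = 0")
  case True
  then show ?thesis by (simp add: delta_record_def window_record_def)
next
  case False
  define Y where "Y n = drift c X n \<omega>" for n
  have "delta_record \<delta> Y (Suc j) \<longleftrightarrow> Max (Y ` {1..<Suc j}) < Y (Suc j) - \<delta>"
    using False by (simp add: delta_record_def less_diff_eq del: Max_less_iff)
  also have "\<dots> \<longleftrightarrow> (\<forall>i\<in>{1..<Suc j}. Y i < Y (Suc j) - \<delta>)"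
    using False by (subst Max_less_iff) auto
  also have "\<dots> \<longleftrightarrow> (\<forall>i\<in>{0..<j}. Y (Suc i) < Y (Suc j) - \<delta>)"
  proof -
    have image: "{1..<Suc j} = Suc ` {0..<j}" by (simp add: image_Suc_atLeastLessThan)
    show ?thesis unfolding image by blast
  qed
  also have "\<dots> \<longleftrightarrow> window_record c \<delta> (\<lambda>i. X (Suc i) \<omega>) 0 j"
  proof -
    have "Y (Suc i) < Y (Suc j) - \<delta> \<longleftrightarrow> X (Suc i) \<omega> + c * real i + \<delta> < X (Suc j) \<omega> + c * real j" for i
      unfolding Y_def drift_def of_nat_Suc distrib_left by linarith
    then show ?thesis unfolding window_record_def by (simp only:)
  qed
  finally show ?thesis by (simp only: Y_def[abs_def])
qed

text \<open>Besides the two claims, the conclusion contains the limit that defines the record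
  probability, and the summability and nonnegativity without which the infinite series and the
  Gaussian law would carry no meaning.\<close>

theorem theorem5:
  fixes M :: "'a measure" and X :: "nat \<Rightarrow> 'a \<Rightarrow> real"
    and N :: "'b measure" and Z :: "int \<Rightarrow> 'b \<Rightarrow> real"
    and f :: "real \<Rightarrow> real" and c \<delta> :: real and x_minus x_plus :: ereal
  assumes iid: "iid_with_density M X {1..} f"
    and endpoints: "x_minus < x_plus"
    and f_pos: "\<And>x. x_minus < ereal x \<Longrightarrow> ereal x < x_plus \<Longrightarrow> f x > 0"
    and f_zero: "\<And>x. \<not> (x_minus < ereal x \<and> ereal x < x_plus) \<Longrightarrow> f x = 0"
    and mu_fin: "mu_plus f < \<infinity>"
    and c_pos: "c > 0"
    and width: "x_plus - x_minus > ereal (\<delta> - c)"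
  shows
    "((\<lambda>n. \<integral>\<omega>. record_ind c X \<delta> n \<omega> \<partial>M) \<longlonglongrightarrow> record_prob c f \<delta>) \<and>
     (AE \<omega> in M. (\<lambda>n. record_count c X \<delta> n \<omega> / real n) \<longlonglongrightarrow> record_prob c f \<delta>) \<and>
     ((\<lambda>n. \<integral>\<omega>. record_count c X \<delta> n \<omega> / real n \<partial>M) \<longlonglongrightarrow> record_prob c f \<delta>) \<and>
     (second_moment_plus f < \<infinity> \<longrightarrow> iid_with_density N Z UNIV f \<longrightarrow>
       (\<forall>i j m. m \<ge> 1 \<longrightarrow> bi_pair_expectation N c Z \<delta> i m = bi_pair_expectation N c Z \<delta> j m) \<and>
       (\<forall>i. summable (\<lambda>m. bi_pair_expectation N c Z \<delta> i (Suc m) - (record_prob c f \<delta>)\<^sup>2) \<and>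
            asymp_variance N c Z f \<delta> i \<ge> 0 \<and>
            weak_conv_m
              (\<lambda>n. distr M borel
                 (\<lambda>\<omega>. sqrt (real n) * (record_count c X \<delta> n \<omega> / real n - record_prob c f \<delta>)))
              (centered_gaussian (asymp_variance N c Z f \<delta> i))))"
proof -
  define \<mu> where "\<mu> = density lborel (\<lambda>x. ennreal (f x))"
  define p where "p = record_prob c f \<delta>"
  have f0: "0 \<le> f x" for x
    using f_pos[of x] f_zero[of x] by (cases "x_minus < ereal x \<and> ereal x < x_plus") auto
  \<comment> \<open>The hypothesis yields measurability of the extended density only;
    \<open>f \<ge> 0\<close> recovers \<open>f\<close> from it.\<close>
  have "(\<lambda>x. enn2real (ennreal (f x))) \<in> borel_measurable borel"
    using iid_with_densityD(4)[OF iid, of 1] by measurable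
  then have f_meas: "f \<in> borel_measurable borel" using f0 by simp
  interpret iid_drift M "\<lambda>i. X (Suc i)" \<mu> c \<delta>
    unfolding \<mu>_def using iid_with_densityD[OF iid] c_pos
    by (intro iid_drift_reindex[of M X "{1..}"]) auto
  have prob: "prob_space (density lborel (\<lambda>x. ennreal (f x)))"
    using \<mu>.prob_space_axioms by (simp add: \<mu>_def)
  have P_lim: "P \<longlonglongrightarrow> p"
    unfolding \<mu>_def p_def by (rule window_prob_tendsto_record_prob[OF f_meas f0 prob c_pos])
  have ind: "record_ind c X \<delta> (Suc j) \<omega> = R 0 j \<omega>" for j \<omega>
    by (simp add: record_ind_def R_def delta_record_Suc)
  have count: "record_count c X \<delta> n \<omega> = (\<Sum>j<n. R 0 j \<omega>)" for n \<omega>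
    unfolding record_count_def by (simp add: sum.atLeast1_atMost_eq ind)
  have pos: "integrable \<mu> (\<lambda>x. max 0 x)"
    using integrable_density_pos_part[OF f_meas f0, of 1] mu_fin by (simp add: mu_plus_def \<mu>_def)
  have "(\<lambda>n. \<integral>\<omega>. record_ind c X \<delta> (Suc n) \<omega> \<partial>M) \<longlonglongrightarrow> p"
    using P_lim by (simp add: ind expectation_R)
  then have "(\<lambda>n. \<integral>\<omega>. record_ind c X \<delta> n \<omega> \<partial>M) \<longlonglongrightarrow> p"
    by (rule LIMSEQ_imp_Suc)
  moreover have "AE \<omega> in M. (\<lambda>n. record_count c X \<delta> n \<omega> / real n) \<longlonglongrightarrow> p"
    unfolding count by (rule AE_record_averages[OF pos P_lim])
  moreover have "(\<lambda>n. \<integral>\<omega>. record_count c X \<delta> n \<omega> / real n \<partial>M) \<longlonglongrightarrow> p"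
    unfolding count using cesaro_mean[OF P_lim] by (simp add: expectation_R)
  moreover have "(\<forall>i j m. bi_pair_expectation N c Z \<delta> i m = bi_pair_expectation N c Z \<delta> j m) \<and>
       (\<forall>i. summable (\<lambda>m. bi_pair_expectation N c Z \<delta> i (Suc m) - p\<^sup>2) \<and>
            asymp_variance N c Z f \<delta> i \<ge> 0 \<and>
            weak_conv_m
              (\<lambda>n. distr M borel (\<lambda>\<omega>. sqrt (real n) * (record_count c X \<delta> n \<omega> / real n - p)))
              (centered_gaussian (asymp_variance N c Z f \<delta> i)))"
    if second: "second_moment_plus f < \<infinity>" and bi: "iid_with_density N Z UNIV f"
  proof -
    have sq: "integrable \<mu> (\<lambda>x. (max 0 x)\<^sup>2)"
      using integrable_density_pos_part[OF f_meas f0, of 2] second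
      by (simp add: second_moment_plus_def \<mu>_def)
    interpret bi: two_sided_iid N Z \<mu> c \<delta>
      using iid_with_densityD[OF bi] c_pos sq
      by (intro two_sided_iid.intro two_sided_iid_axioms.intro) (auto simp: \<mu>_def)
    note rate = rate_summable[OF sq P_lim]
    \<comment> \<open>The processes on \<open>M\<close> and on \<open>N\<close> have the same law
      \<mu>, hence the same \<open>pair_prob\<close>, so the one-sided pair expectations converge to
      the two-sided ones.\<close>
    have q: "(\<lambda>k. expectation (\<lambda>\<omega>. R 0 k \<omega> * R 0 (k + Suc m) \<omega>)) \<longlonglongrightarrow> bi_pair_expectation N c Z \<delta> i (Suc m)" for i m
      using bi.pair_prob_tendsto[of "Suc m" i]
      by (subst expectation_R_pair) (simp_all only: pair_prob_def le_add1)
    have v: "asymp_variance N c Z f \<delta> i = p - p\<^sup>2 + 2 * (\<Sum>m. bi_pair_expectation N c Z \<delta> i (Suc m) - p\<^sup>2)" for i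
      by (simp add: asymp_variance_def p_def)
    show ?thesis
    proof (intro conjI allI)
      show "bi_pair_expectation N c Z \<delta> i m = bi_pair_expectation N c Z \<delta> j m" for i j m
        by (rule LIMSEQ_unique[OF bi.pair_prob_tendsto bi.pair_prob_tendsto])
      fix i
      show "summable (\<lambda>m. bi_pair_expectation N c Z \<delta> i (Suc m) - p\<^sup>2)"
        by (rule variance_records_tendsto(1)[OF P_lim rate q])
      show "asymp_variance N c Z f \<delta> i \<ge> 0"
        unfolding v by (rule records_central_limit(1)[OF P_lim rate q])
      show "weak_conv_m
              (\<lambda>n. distr M borel (\<lambda>\<omega>. sqrt (real n) * (record_count c X \<delta> n \<omega> / real n - p)))
              (centered_gaussian (asymp_variance N c Z f \<delta> i))"
        unfolding v count by (rule records_central_limit(2)[OF P_lim rate q])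
    qed
  qed
  ultimately show ?thesis unfolding p_def by blast
qed

end
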